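(* Let $\Omega\subset\mathbb{R}\times(0,\infty)$ be a domain in $\mathbb{R}^2$ and let $\Gamma=\{(x,t):x=\phi(t)\}$ be a smooth curve that divides $\Omega$ into the two halves $\Omega_-=\{(x,t):x-\phi(t)<0\}$ and $\Omega_+=\{(x,t):x-\phi(t)>0\}$. Let $(u,\sigma)$ be a generalised delta-shock wave type solution of the system $$u_t+uu_x-\sigma_x=0,\qquad \sigma_t+u\sigma_x=0,$$ where $\sigma$ is of the form $$\sigma(x,t)=\sigma_0+\sigma_1H(-x+\phi(t))+e(x,t)\,\delta(x-\phi(t))$$ with constants $\sigma_0,\sigma_1$, and suppose $[u]\neq 0$ along $\Gamma$. Then, writing $e(t)=e(\phi(t),t)$, the pair $(u,\sigma)$ satisfies along the discontinuity curve $\Gamma$ (at almost every $t$, where the one-sided values of $u$ exist) the generalised Rankine-Hugoniot conditions $$\dot\phi(t)=\frac{[\frac{u^2}{2}]-[\sigma]}{[u]},\qquad \dot e(t)=\frac{[\sigma]^2}{[u]}.$$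
   Context: $H$ is the Heaviside function, $\delta$ the Dirac delta, $\mathcal{D}(\mathbb{R}\times[0,\infty))$ the smooth compactly supported functions on $\mathbb{R}\times[0,\infty)$. Across $\Gamma$ the jump of a function $v$ is $[v]=v_L-v_R$, where $v_L,v_R$ are the left (from $x<\phi(t)$) and right (from $x>\phi(t)$) values (traces). The jump $[\sigma]$ is that of the regular part $\tilde\sigma=\sigma_0+\sigma_1H(-x+\phi(t))$, so $[\sigma]=\sigma_1$. Definition (generalised delta-shock wave type solution). Let $u\in BV(\mathbb{R}\times(0,\infty);\mathbb{R})$ and $\sigma(x,t)=\tilde\sigma(x,t)+e(x,t)\delta(x-\phi(t))$, where $\tilde\sigma\in BV(\mathbb{R}\times(0,\infty);\mathbb{R})$ and $e$ is a smooth function ($BV$ is understood as locally of bounded variation). The pair $(u,\sigma)$ is a generalised delta-shock wave type solution of the system with initial conditions $u(0)$ and $\sigma(0)=\sigma_0+\sigma_1H(-x)$ if for all $\theta\in\mathcal{D}(\mathbb{R}\times[0,\infty))$: $$\int_0^\infty\!\!\int_{\mathbb{R}}\Big(u\theta_t+\big(\tfrac{u^2}{2}-\tilde\sigma\big)\theta_x\Big)dx\,dt+\int_{\mathbb{R}}u(0)\,\theta(x,0)\,dx=0,$$ $$\int_0^\infty\!\!\int_{\mathbb{R}}(\tilde\sigma_t+\hat u\,\tilde\sigma_x)\,\theta\,dx\,dt-\int_\Gamma e(x,t)\frac{\partial\theta(x,t)}{\partial l}\,dl=0.$$ Here $\tilde\sigma_t,\tilde\sigma_x$ are measures (distributional derivatives),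 $\hat u(x)=\int_0^1\big(u(x-)+\tau(u(x+)-u(x-))\big)d\tau$ (at each fixed $t$), $\Gamma=\{(x,t):x=\phi(t)\}$, and $\frac{\partial\theta}{\partial l}$ is the tangential derivative along $\Gamma$, so that $\int_\Gamma e\,\frac{\partial\theta}{\partial l}\,dl=\int_0^\infty e(\phi(t),t)\,\frac{d}{dt}\theta(\phi(t),t)\,dt$. *)

theory Defs
  imports "HOL-Analysis.Analysis"
begin

text \<open>
  Points of the plane are pairs \<open>(x, t)\<close>: the first component is space, the second is time.
\<close>

section \<open>Smooth functions and test functions\<close>

definition partial :: "'a::euclidean_space \<Rightarrow> ('a \<Rightarrow> real) \<Rightarrow> 'a \<Rightarrow> real" where
  "partial b f p = frechet_derivative f (at p) b"

text \<open>Only meant for open \<open>S\<close>, since derivatives are taken \<open>at p\<close>, not \<open>at p within S\<close>.\<close>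

primrec Ck_on :: "nat \<Rightarrow> 'a::euclidean_space set \<Rightarrow> ('a \<Rightarrow> real) \<Rightarrow> bool" where
  "Ck_on 0 S f \<longleftrightarrow> continuous_on S f"
| "Ck_on (Suc k) S f \<longleftrightarrow>
     (\<forall>p\<in>S. f differentiable (at p)) \<and> (\<forall>b\<in>Basis. Ck_on k S (partial b f))"

definition smooth_on :: "'a::euclidean_space set \<Rightarrow> ('a \<Rightarrow> real) \<Rightarrow> bool" where
  "smooth_on S f \<longleftrightarrow> (\<forall>k. Ck_on k S f)"

definition test_functions :: "'a::euclidean_space set \<Rightarrow> ('a \<Rightarrow> real) set" where
  "test_functions U = {\<theta>. smooth_on UNIV \<theta> \<and>
     compact (closure {p. \<theta> p \<noteq> 0}) \<and> closure {p. \<theta> p \<noteq> 0} \<subseteq> U}"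

section \<open>Signed Radon measures and functions locally of bounded variation\<close>

text \<open>
  A signed Radon measure on an open set \<open>U\<close> is represented by its Jordan decomposition, the
  unique pair of mutually singular positive Borel measures that are finite on the compact
  subsets of \<open>U\<close> (extended by zero outside \<open>U\<close>).
\<close>

definition signed_radon ::
    "'a::euclidean_space set \<Rightarrow> 'a measure \<times> 'a measure \<Rightarrow> bool" where
  "signed_radon U \<mu> \<longleftrightarrow>
     (\<forall>m\<in>{fst \<mu>, snd \<mu>}. sets m = sets borel \<and> emeasure m (- U) = 0 \<and>
        (\<forall>K. compact K \<and> K \<subseteq> U \<longrightarrow> emeasure m K < \<infinity>)) \<and>
     (\<exists>A\<in>sets borel. emeasure (fst \<mu>) (- A) = 0 \<and> emeasure (snd \<mu>) A = 0)"

definition signed_integrable ::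
    "'a set \<Rightarrow> 'a measure \<times> 'a measure \<Rightarrow> ('a \<Rightarrow> real) \<Rightarrow> bool" where
  "signed_integrable U \<mu> f \<longleftrightarrow> set_integrable (fst \<mu>) U f \<and> set_integrable (snd \<mu>) U f"

definition signed_integral ::
    "'a set \<Rightarrow> 'a measure \<times> 'a measure \<Rightarrow> ('a \<Rightarrow> real) \<Rightarrow> real" where
  "signed_integral U \<mu> f = (LINT p:U|fst \<mu>. f p) - (LINT p:U|snd \<mu>. f p)"

definition locally_integrable :: "'a::euclidean_space set \<Rightarrow> ('a \<Rightarrow> real) \<Rightarrow> bool" where
  "locally_integrable U v \<longleftrightarrow> (\<forall>K. compact K \<and> K \<subseteq> U \<longrightarrow> set_integrable lborel K v)"

definition has_distr_deriv ::
    "'a::euclidean_space set \<Rightarrow> 'a \<Rightarrow> ('a \<Rightarrow> real) \<Rightarrow> 'a measure \<times> 'a measure \<Rightarrow> bool" where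
  "has_distr_deriv U b v \<mu> \<longleftrightarrow> signed_radon U \<mu> \<and>
     (\<forall>\<theta>\<in>test_functions U. (LINT p:U|lborel. v p * partial b \<theta> p) = - signed_integral U \<mu> \<theta>)"

definition BV_loc :: "'a::euclidean_space set \<Rightarrow> ('a \<Rightarrow> real) \<Rightarrow> bool" where
  "BV_loc U v \<longleftrightarrow> locally_integrable U v \<and> (\<forall>b\<in>Basis. \<exists>\<mu>. has_distr_deriv U b v \<mu>)"

section \<open>One-sided values and jumps\<close>

text \<open>
  A BV function is determined only almost everywhere, so its one-sided values in \<open>x\<close> at
  fixed \<open>t\<close> are essential limits: limits that disregard null sets of \<open>x\<close>.  For a function that
  is locally BV they exist for almost every \<open>t\<close> at every \<open>x\<close>.
\<close>

definition ess_at_left :: "real \<Rightarrow> real filter" where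
  "ess_at_left x = inf (at_left x) (ae_filter lborel)"

definition ess_at_right :: "real \<Rightarrow> real filter" where
  "ess_at_right x = inf (at_right x) (ae_filter lborel)"

definition has_left_value :: "(real \<times> real \<Rightarrow> real) \<Rightarrow> real \<Rightarrow> real \<Rightarrow> real \<Rightarrow> bool" where
  "has_left_value v x t l \<longleftrightarrow> ((\<lambda>y. v (y, t)) \<longlongrightarrow> l) (ess_at_left x)"

definition has_right_value :: "(real \<times> real \<Rightarrow> real) \<Rightarrow> real \<Rightarrow> real \<Rightarrow> real \<Rightarrow> bool" where
  "has_right_value v x t l \<longleftrightarrow> ((\<lambda>y. v (y, t)) \<longlongrightarrow> l) (ess_at_right x)"

definition left_value :: "(real \<times> real \<Rightarrow> real) \<Rightarrow> real \<Rightarrow> real \<Rightarrow> real" where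
  "left_value v x t = Lim (ess_at_left x) (\<lambda>y. v (y, t))"

definition right_value :: "(real \<times> real \<Rightarrow> real) \<Rightarrow> real \<Rightarrow> real \<Rightarrow> real" where
  "right_value v x t = Lim (ess_at_right x) (\<lambda>y. v (y, t))"

text \<open>The jump across the curve \<open>x = \<phi> t\<close> at time \<open>t\<close>, with the sign convention left minus right.\<close>

definition jump :: "(real \<Rightarrow> real) \<Rightarrow> (real \<times> real \<Rightarrow> real) \<Rightarrow> real \<Rightarrow> real" where
  "jump \<phi> v t = left_value v (\<phi> t) t - right_value v (\<phi> t) t"

definition u_hat :: "(real \<times> real \<Rightarrow> real) \<Rightarrow> real \<times> real \<Rightarrow> real" where
  "u_hat u = (\<lambda>(x, t). integral {0..1}
     (\<lambda>\<tau>. left_value u x t + \<tau> * (right_value u x t - left_value u x t)))"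

section \<open>Generalised delta-shock wave type solutions\<close>

definition half_plane :: "(real \<times> real) set" where
  "half_plane = UNIV \<times> {0<..}"

definition heaviside :: "real \<Rightarrow> real" where
  "heaviside x = (if 0 < x then 1 else 0)"

text \<open>
  The pair \<open>(u, \<sigma>)\<close>, \<open>\<sigma> = \<sigma>r + e \<delta>(x - \<phi>(t))\<close>, is a generalised delta-shock wave type solution
  of \<open>u\<^sub>t + u u\<^sub>x - \<sigma>\<^sub>x = 0\<close>, \<open>\<sigma>\<^sub>t + u \<sigma>\<^sub>x = 0\<close> with initial condition \<open>u(0) = u0\<close>.
  The singular \<open>\<sigma>\<close> is given by its regular part \<open>\<sigma>r\<close>, the amplitude \<open>e\<close> and the curve \<open>\<phi>\<close>.

  \<^item> Smooth compactly supported functions on the closed half plane are the restrictions of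
    those on the whole plane, so \<open>\<theta>\<close> ranges over \<open>test_functions UNIV\<close>; it need not vanish at
    \<open>t = 0\<close>.
  \<^item> The integrability clauses say that the integrals in the two identities exist.
    Regularity of \<open>u\<close>, \<open>\<sigma>r\<close>, \<open>e\<close> is local in the open half plane, so this is a
    genuine condition near \<open>t = 0\<close>.
  \<^item> The initial value of \<open>\<sigma>\<close> does not enter the two identities and hence is no parameter.
\<close>

definition gen_delta_shock_solution ::
    "(real \<Rightarrow> real) \<Rightarrow> (real \<Rightarrow> real) \<Rightarrow> (real \<times> real \<Rightarrow> real) \<Rightarrow> (real \<times> real \<Rightarrow> real) \<Rightarrow>
     (real \<times> real \<Rightarrow> real) \<Rightarrow> bool" where
  "gen_delta_shock_solution \<phi> u0 u \<sigma>r e \<longleftrightarrow>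
     BV_loc half_plane u \<and> BV_loc half_plane \<sigma>r \<and> smooth_on half_plane e \<and>
     (\<forall>\<theta>\<in>test_functions UNIV.
        set_integrable lborel half_plane
          (\<lambda>p. u p * partial (0, 1) \<theta> p + ((u p)\<^sup>2 / 2 - \<sigma>r p) * partial (1, 0) \<theta> p) \<and>
        integrable lborel (\<lambda>x. u0 x * \<theta> (x, 0)) \<and>
        (LINT p:half_plane|lborel.
           u p * partial (0, 1) \<theta> p + ((u p)\<^sup>2 / 2 - \<sigma>r p) * partial (1, 0) \<theta> p)
        + (LINT x|lborel. u0 x * \<theta> (x, 0)) = 0) \<and>
     (\<exists>\<mu>t \<mu>x. has_distr_deriv half_plane (0, 1) \<sigma>r \<mu>t \<and>
        has_distr_deriv half_plane (1, 0) \<sigma>r \<mu>x \<and>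
        (\<forall>\<theta>\<in>test_functions UNIV.
           signed_integrable half_plane \<mu>t \<theta> \<and>
           signed_integrable half_plane \<mu>x (\<lambda>p. u_hat u p * \<theta> p) \<and>
           set_integrable lborel {0<..} (\<lambda>t. e (\<phi> t, t) * deriv (\<lambda>s. \<theta> (\<phi> s, s)) t) \<and>
           signed_integral half_plane \<mu>t \<theta>
           + signed_integral half_plane \<mu>x (\<lambda>p. u_hat u p * \<theta> p)
           - (LINT t:{0<..}|lborel. e (\<phi> t, t) * deriv (\<lambda>s. \<theta> (\<phi> s, s)) t) = 0))"

end

theory Submission
  imports Defs
begin

text \<open>
  Write \<open>G = u\<^sup>2 / 2 - \<sigma>r\<close> for the flux of the first equation.

  For the first condition, the conservation law \<open>u\<^sub>t + G\<^sub>x = 0\<close> is tested with functions that concentrate on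
  the curve.  Two facts make the limit work.  First, a function whose \<open>x\<close>-derivative is a measure is, on
  almost every horizontal line, a constant plus a difference of monotone functions, with bounds that are
  integrable in \<open>t\<close> (\<open>x_derivative_measure_regularity\<close>); in particular it has essential one-sided limits
  on the curve.  Second, this applies not only to \<open>u\<close> but also to \<open>G\<close>, because \<open>G\<^sub>x = - u\<^sub>t\<close> is a measure
  as well (\<open>flux_x_derivative\<close>).  So although the square of a function of bounded variation has no
  reason to possess integrable traces, the flux does, and dominated convergence
  yields \<open>[G] = \<phi>\<^sub>t [u]\<close> at almost every time (\<open>interface_jump_relation_strip\<close>).  Since \<open>[\<sigma>r] = \<sigma>1\<close>, this is
  the first condition.

  For the second condition, the derivatives of the step \<open>\<sigma>r\<close> are computed explicitly.  Its \<open>x\<close>-derivative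
  is \<open>- \<sigma>1\<close> times the image of \<open>dt\<close> under the curve; this has to be known as an identity of measures
  (\<open>signed_integral_step_x\<close>), since the integrand \<open>u_hat\<close> need not be continuous.  A test function
  that equals \<open>q t\<close> on the curve then turns the second identity into \<open>e\<^sub>t = \<sigma>1 (u_hat - \<phi>\<^sub>t)\<close> along the curve
  (\<open>amplitude_equation_strip\<close>).  On the curve \<open>u_hat\<close> is the mean of the one-sided values of \<open>u\<close>, which is
  \<open>[u\<^sup>2 / 2] / [u]\<close>; so the first condition gives \<open>u_hat - \<phi>\<^sub>t = \<sigma>1 / [u]\<close>, and \<open>e\<^sub>t = \<sigma>1\<^sup>2 / [u]\<close>.

  Slicing rests on monotonicity: the part of the derivative on the left of
  \<open>x\<close> has, as a measure in \<open>t\<close>, a density (\<open>cumulative_density\<close>) that is monotone in \<open>x\<close>, and the function minus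
  the cumulative densities of the positive and negative parts does not depend on \<open>x\<close>
  (\<open>AE_independent_of_first\<close>).
\<close>

section \<open>Calculus of smooth functions\<close>

lemma partial_eq:
  "(f has_derivative D) (at p) \<Longrightarrow> partial b f p = D b"
  unfolding partial_def by (metis frechet_derivative_at)

lemma partial_cong_open:
  assumes "open S" "p \<in> S" "\<And>q. q \<in> S \<Longrightarrow> f q = g q"
  shows "partial b f p = partial b g p"
proof -
  have *: "(f has_derivative D) (at p) \<longleftrightarrow> (g has_derivative D) (at p)" for D
    using has_derivative_transform_within_open[OF _ assms(1,2), of f D UNIV g]
      has_derivative_transform_within_open[OF _ assms(1,2), of g D UNIV f] assms(3) by auto
  then show ?thesis unfolding partial_def frechet_derivative_def by simp
qed

text \<open>
  Derivatives at points of an open set \<open>S\<close> only see \<open>S\<close>; this is what allows a test function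
  to be glued from a formula near its support and zero elsewhere.
\<close>

lemma Ck_on_cong:
  assumes "open S" "\<And>q. q \<in> S \<Longrightarrow> f q = g q"
  shows "Ck_on k S f \<longleftrightarrow> Ck_on k S g"
  using assms(2)
proof (induction k arbitrary: f g)
  case 0
  then show ?case by (simp cong: continuous_on_cong)
next
  case (Suc k)
  have "f differentiable (at p) \<longleftrightarrow> g differentiable (at p)" if "p \<in> S" for p
    unfolding differentiable_def
    using has_derivative_transform_within_open[OF _ assms(1) that, of f _ UNIV g]
      has_derivative_transform_within_open[OF _ assms(1) that, of g _ UNIV f] Suc.prems by metis
  moreover have "Ck_on k S (partial b f) \<longleftrightarrow> Ck_on k S (partial b g)" for b
    by (rule Suc.IH) (rule partial_cong_open[OF assms(1)], auto simp: Suc.prems)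
  ultimately show ?case by auto
qed

lemma Ck_on_SucD: "Ck_on (Suc k) S f \<Longrightarrow> Ck_on k S f"
proof (induction k arbitrary: f)
  case 0
  then show ?case
    by (auto simp: continuous_at_imp_continuous_on differentiable_imp_continuous_within)
qed auto

lemma Ck_on_subset: "Ck_on k S f \<Longrightarrow> T \<subseteq> S \<Longrightarrow> Ck_on k T f"
  by (induction k arbitrary: f) (auto intro: continuous_on_subset)

lemma Ck_on_Un:
  "open S \<Longrightarrow> open T \<Longrightarrow> Ck_on k S f \<Longrightarrow> Ck_on k T f \<Longrightarrow> Ck_on k (S \<union> T) f"
  by (induction k arbitrary: f) (auto intro: continuous_on_open_Un)

lemma Ck_on_const: "Ck_on k S (\<lambda>_. c)"
proof (induction k arbitrary: c)
  case (Suc k)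
  have "partial b (\<lambda>_. c) = (\<lambda>_. 0)" for b :: 'a
    by (rule ext) (rule partial_eq, rule has_derivative_const)
  with Suc show ?case by simp
qed simp

lemma Ck_on_add:
  assumes "open S"
  shows "Ck_on k S f \<Longrightarrow> Ck_on k S g \<Longrightarrow> Ck_on k S (\<lambda>p. f p + g p)"
proof (induction k arbitrary: f g)
  case (Suc k)
  have "partial b (\<lambda>p. f p + g p) p = partial b f p + partial b g p" if "p \<in> S" for b p
  proof -
    have "f differentiable at p" "g differentiable at p" using Suc.prems that by auto
    then have "((\<lambda>p. f p + g p) has_derivative
      (\<lambda>h. frechet_derivative f (at p) h + frechet_derivative g (at p) h)) (at p)"
      by (intro has_derivative_add) (simp_all add: frechet_derivative_works[symmetric])
    from partial_eq[OF this] show ?thesis by (simp add: partial_def)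
  qed
  then have "Ck_on k S (partial b (\<lambda>p. f p + g p)) \<longleftrightarrow> Ck_on k S (\<lambda>p. partial b f p + partial b g p)" for b
    by (intro Ck_on_cong assms) auto
  moreover have "Ck_on k S (\<lambda>p. partial b f p + partial b g p)" if "b \<in> Basis" for b
    using Suc.prems that by (intro Suc.IH) auto
  ultimately show ?case using Suc.prems by auto
qed (simp add: continuous_on_add)

text \<open>
  The product rule yields products of one factor with a partial derivative of the other, to which
  the induction hypothesis applies because one order of smoothness may be given away.
\<close>

lemma Ck_on_mult:
  assumes "open S"
  shows "Ck_on k S f \<Longrightarrow> Ck_on k S g \<Longrightarrow> Ck_on k S (\<lambda>p. f p * g p)"
proof (induction k arbitrary: f g)
  case (Suc k)
  have "partial b (\<lambda>p. f p * g p) p = f p * partial b g p + partial b f p * g p" if "p \<in> S" for b p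
  proof -
    have "f differentiable at p" "g differentiable at p" using Suc.prems that by auto
    then have "((\<lambda>p. f p * g p) has_derivative
      (\<lambda>h. f p * frechet_derivative g (at p) h + frechet_derivative f (at p) h * g p)) (at p)"
      by (intro has_derivative_mult) (simp_all add: frechet_derivative_works[symmetric])
    from partial_eq[OF this] show ?thesis by (simp add: partial_def)
  qed
  then have "Ck_on k S (partial b (\<lambda>p. f p * g p)) \<longleftrightarrow>
      Ck_on k S (\<lambda>p. f p * partial b g p + partial b f p * g p)" for b
    by (intro Ck_on_cong assms) auto
  moreover have "Ck_on k S (\<lambda>p. f p * partial b g p + partial b f p * g p)" if "b \<in> Basis" for b
  proof -
    have "Ck_on k S f" "Ck_on k S g" "Ck_on k S (partial b f)" "Ck_on k S (partial b g)"
      using Suc.prems[THEN Ck_on_SucD] Suc.prems that by auto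
    then show ?thesis by (intro Ck_on_add[OF assms] Suc.IH)
  qed
  ultimately show ?case using Suc.prems by auto
qed (simp add: continuous_on_mult)

lemma Ck_on_linear:
  assumes "bounded_linear L" shows "Ck_on k S (L :: _ \<Rightarrow> real)"
proof (cases k)
  case 0
  then show ?thesis using assms by (simp add: linear_continuous_on)
next
  case (Suc j)
  have "partial b L = (\<lambda>_. L b)" for b
    by (rule ext) (rule partial_eq[OF bounded_linear_imp_has_derivative[OF assms]])
  then show ?thesis unfolding Suc using bounded_linear_imp_differentiable[OF assms]
    by (simp add: Ck_on_const)
qed

lemma partial_compose:
  fixes h :: "real \<Rightarrow> real"
  assumes "h differentiable at (f p)" "f differentiable at p"
  shows "partial b (\<lambda>p. h (f p)) p = partial 1 h (f p) * partial b f p"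
proof -
  have 1: "((\<lambda>p. h (f p)) has_derivative
      (\<lambda>x. frechet_derivative h (at (f p)) (frechet_derivative f (at p) x))) (at p)"
    using assms has_derivative_compose[of f _ p UNIV h] by (simp add: frechet_derivative_works)
  have "linear (frechet_derivative h (at (f p)))"
    using assms(1) by (simp add: linear_frechet_derivative)
  from linear_cmul[OF this, of "frechet_derivative f (at p) b" 1] partial_eq[OF 1, of b] show ?thesis
    by (simp add: partial_def)
qed

text \<open>
  By the chain rule a partial derivative of \<open>h \<circ> f\<close> is \<open>partial 1 h \<circ> f\<close> times one of \<open>f\<close>; hence the
  induction over the order runs simultaneously for all \<open>h\<close>.
\<close>

lemma Ck_on_compose:
  fixes h :: "real \<Rightarrow> real"
  assumes "open S" "f ` S \<subseteq> T"
  shows "Ck_on k T h \<Longrightarrow> Ck_on k S f \<Longrightarrow> Ck_on k S (\<lambda>p. h (f p))"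
proof (induction k arbitrary: h)
  case 0
  then show ?case using assms(2) continuous_on_compose2[of T h S f] by simp
next
  case (Suc k)
  have d: "h differentiable at (f p)" "f differentiable at p" if "p \<in> S" for p
    using that Suc.prems assms(2) by auto
  then have "Ck_on k S (partial b (\<lambda>p. h (f p))) \<longleftrightarrow>
      Ck_on k S (\<lambda>p. partial 1 h (f p) * partial b f p)" for b
    by (intro Ck_on_cong assms partial_compose) auto
  moreover have "Ck_on k S (\<lambda>p. partial 1 h (f p) * partial b f p)" if "b \<in> Basis" for b
 proof -
    have "Ck_on k T (partial 1 h)" using Suc.prems(1) by simp
    then have "Ck_on k S (\<lambda>p. partial 1 h (f p))" by (rule Suc.IH) (rule Ck_on_SucD[OF Suc.prems(2)])
    moreover have "Ck_on k S (partial b f)" using Suc.prems(2) that by simp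
    ultimately show ?thesis by (rule Ck_on_mult[OF assms(1)])
  qed
  moreover have "(\<lambda>p. h (f p)) differentiable at p" if "p \<in> S" for p
    using differentiable_chain_at[OF d(2,1), OF that that] by (simp add: o_def)
  ultimately show ?case by auto
qed

lemma
  assumes "smooth_on S f"
  shows smooth_on_differentiable: "p \<in> S \<Longrightarrow> f differentiable at p"
    and smooth_on_continuous: "continuous_on S f"
    and smooth_on_partial: "b \<in> Basis \<Longrightarrow> smooth_on S (partial b f)"
  using assms[unfolded smooth_on_def, rule_format, of 0]
    assms[unfolded smooth_on_def, rule_format, of "Suc _"] by (auto simp: smooth_on_def)

lemma smooth_on_real_iff:
  "smooth_on S f \<longleftrightarrow> (\<forall>p\<in>S. f differentiable at p) \<and> smooth_on S (partial 1 f)" for f :: "real \<Rightarrow> real"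
proof
  assume "smooth_on S f" then show "(\<forall>p\<in>S. f differentiable at p) \<and> smooth_on S (partial 1 f)"
    using smooth_on_differentiable smooth_on_partial[of S f 1] by auto
next
  assume *: "(\<forall>p\<in>S. f differentiable at p) \<and> smooth_on S (partial 1 f)"
  then have "Ck_on (Suc k) S f" for k by (auto simp: smooth_on_def)
  then show "smooth_on S f" unfolding smooth_on_def by (meson Ck_on_SucD)
qed

lemma partial_real: "(f has_real_derivative d) (at x) \<Longrightarrow> partial 1 f x = d"
  by (drule has_field_derivative_imp_has_derivative, drule partial_eq[where b=1]) simp

lemma partial_eq_deriv: "f differentiable at x \<Longrightarrow> partial 1 f x = deriv f x" for x :: real
  by (metis DERIV_imp_deriv partial_real real_differentiable_def)

lemma smooth_on_cong:
  "open S \<Longrightarrow> (\<And>q. q \<in> S \<Longrightarrow> f q = g q) \<Longrightarrow> smooth_on S f \<longleftrightarrow> smooth_on S g"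
  unfolding smooth_on_def using Ck_on_cong by blast

lemma smooth_on_subset: "smooth_on S f \<Longrightarrow> T \<subseteq> S \<Longrightarrow> smooth_on T f"
  unfolding smooth_on_def using Ck_on_subset by blast

lemma smooth_on_Un:
  "open S \<Longrightarrow> open T \<Longrightarrow> smooth_on S f \<Longrightarrow> smooth_on T f \<Longrightarrow> smooth_on (S \<union> T) f"
  unfolding smooth_on_def using Ck_on_Un by blast

lemma smooth_on_const: "smooth_on S (\<lambda>_. c)"
  unfolding smooth_on_def using Ck_on_const by blast

lemma smooth_on_linear: "bounded_linear L \<Longrightarrow> smooth_on S L"
  unfolding smooth_on_def using Ck_on_linear by blast

lemma smooth_on_add:
  "open S \<Longrightarrow> smooth_on S f \<Longrightarrow> smooth_on S g \<Longrightarrow> smooth_on S (\<lambda>p. f p + g p)"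
  unfolding smooth_on_def using Ck_on_add by blast

lemma smooth_on_mult:
  "open S \<Longrightarrow> smooth_on S f \<Longrightarrow> smooth_on S g \<Longrightarrow> smooth_on S (\<lambda>p. f p * g p)"
  unfolding smooth_on_def using Ck_on_mult by blast

lemma smooth_on_cmult: "open S \<Longrightarrow> smooth_on S f \<Longrightarrow> smooth_on S (\<lambda>p. c * f p)"
  using smooth_on_mult smooth_on_const by blast

lemma smooth_on_diff:
  "open S \<Longrightarrow> smooth_on S f \<Longrightarrow> smooth_on S g \<Longrightarrow> smooth_on S (\<lambda>p. f p - g p)"
  using smooth_on_add[of S f "\<lambda>p. (-1) * g p"] smooth_on_cmult[of S g "-1"] by simp

lemma smooth_on_compose:
  fixes h :: "real \<Rightarrow> real"
  shows "open S \<Longrightarrow> f ` S \<subseteq> T \<Longrightarrow> smooth_on T h \<Longrightarrow> smooth_on S f \<Longrightarrow> smooth_on S (\<lambda>p. h (f p))"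
  unfolding smooth_on_def using Ck_on_compose by blast

section \<open>Test functions\<close>

lemma test_functionsI:
  assumes "smooth_on UNIV \<theta>" "compact K" "K \<subseteq> U" "\<And>p. p \<notin> K \<Longrightarrow> \<theta> p = 0"
  shows "\<theta> \<in> test_functions U"
proof -
  have *: "closure {p. \<theta> p \<noteq> 0} \<subseteq> K"
    using assms by (intro closure_minimal compact_imp_closed) auto
  then have "compact (closure {p. \<theta> p \<noteq> 0})"
    using assms(2) by (metis closed_closure compact_Int_closed inf.absorb_iff2)
  with * assms show ?thesis unfolding test_functions_def by auto
qed

lemma test_functions_smooth: "\<theta> \<in> test_functions U \<Longrightarrow> smooth_on UNIV \<theta>"
  and test_functions_mono: "\<theta> \<in> test_functions U \<Longrightarrow> U \<subseteq> V \<Longrightarrow> \<theta> \<in> test_functions V"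
  by (auto simp: test_functions_def)

lemma test_functions_outside: "\<theta> \<in> test_functions U \<Longrightarrow> p \<notin> U \<Longrightarrow> \<theta> p = 0"
  using closure_subset[of "{p. \<theta> p \<noteq> 0}"] unfolding test_functions_def by blast

lemma test_functions_support:
  assumes "\<theta> \<in> test_functions U"
  obtains K where "compact K" "K \<subseteq> U" "\<And>p. p \<notin> K \<Longrightarrow> \<theta> p = 0"
    "\<And>b p. p \<notin> K \<Longrightarrow> partial b \<theta> p = 0"
proof -
  define K where "K = closure {p. \<theta> p \<noteq> 0}"
  have K: "compact K" "K \<subseteq> U" using assms by (auto simp: test_functions_def K_def)
  have 0: "\<theta> p = 0" if "p \<notin> K" for p
    using that closure_subset[of "{p. \<theta> p \<noteq> 0}"] unfolding K_def by blast
  have 1: "partial b \<theta> p = 0" if "p \<notin> K" for b p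
  proof -
    have "open (- K)" using K(1) by (simp add: compact_imp_closed open_Compl)
    then have "partial b \<theta> p = partial b (\<lambda>_. 0) p"
      by (rule partial_cong_open) (use that 0 in auto)
    also have "\<dots> = 0" by (rule partial_eq[of _ "\<lambda>_. 0"]) auto
    finally show ?thesis .
  qed
  show thesis by (rule that[OF K 0 1])
qed

text \<open>
  Adding the midpoint to the support makes it nonempty, and moving its extreme points half way
  to the end points of the interval makes the enclosing interval nondegenerate.
\<close>

lemma test_functions_real_support:
  fixes \<theta> :: "real \<Rightarrow> real"
  assumes "\<theta> \<in> test_functions {a<..<b}" "a < b"
  obtains l r where "a < l" "l < r" "r < b" "\<And>x. x \<notin> {l..r} \<Longrightarrow> \<theta> x = 0"
proof -
  obtain K where K: "compact K" "K \<subseteq> {a<..<b}" "\<And>x. x \<notin> K \<Longrightarrow> \<theta> x = 0"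
    using test_functions_support[OF assms(1)] by metis
  define m where "m = (a + b) / 2"
  have "compact (insert m K)" using K(1) by simp
  then obtain l r where l: "l \<in> insert m K" "\<And>x. x \<in> insert m K \<Longrightarrow> l \<le> x"
    and r: "r \<in> insert m K" "\<And>x. x \<in> insert m K \<Longrightarrow> x \<le> r"
    using compact_attains_inf[of "insert m K"] compact_attains_sup[of "insert m K"] by auto
  have m: "a < m" "m < b" using assms(2) by (auto simp: m_def)
  have "a < l" "r < b" "l \<le> r" using l r K(2) m by auto
  show thesis
  proof (rule that[of "(a + l)/2" "(r + b)/2"])
    show "a < (a + l)/2" "(a + l)/2 < (r + b)/2" "(r + b)/2 < b"
      using \<open>a < l\<close> \<open>r < b\<close> \<open>l \<le> r\<close> by auto
    show "\<theta> x = 0" if "x \<notin> {(a + l)/2..(r + b)/2}" for x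
    proof (rule K(3))
      show "x \<notin> K" using that l(2)[of x] r(2)[of x] \<open>a < l\<close> \<open>r < b\<close> by auto
    qed
  qed
qed

lemma test_functions_bounded:
  assumes "\<theta> \<in> test_functions U"
  obtains B where "\<And>p. \<bar>\<theta> p\<bar> \<le> B" "B \<ge> 0"
proof -
  obtain K where K: "compact K" "\<And>p. p \<notin> K \<Longrightarrow> \<theta> p = 0"
    using test_functions_support[OF assms] by metis
  have "continuous_on K \<theta>"
    using smooth_on_continuous[OF test_functions_smooth[OF assms]] continuous_on_subset by blast
  then have "bounded (\<theta> ` K)" using K(1) by (intro compact_imp_bounded compact_continuous_image)
  then obtain B where "\<And>p. p \<in> K \<Longrightarrow> \<bar>\<theta> p\<bar> \<le> B" "B > 0" by (auto simp: bounded_pos)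
  then show thesis using K by (intro that[of B]) (metis abs_zero less_imp_le, simp)
qed

lemma test_functions_partial:
  assumes "\<theta> \<in> test_functions U" "b \<in> Basis"
  shows "partial b \<theta> \<in> test_functions U"
proof -
  obtain K where "compact K" "K \<subseteq> U" "\<And>p. p \<notin> K \<Longrightarrow> partial b \<theta> p = 0"
    using test_functions_support[OF assms(1)] by metis
  then show ?thesis
    using smooth_on_partial[OF test_functions_smooth[OF assms(1)] assms(2)]
    by (intro test_functionsI)
qed

lemma test_functions_borel [measurable_dest]: "\<theta> \<in> test_functions U \<Longrightarrow> \<theta> \<in> borel_measurable borel"
  by (intro borel_measurable_continuous_onI smooth_on_continuous test_functions_smooth)

lemma test_functions_cmult:
  assumes "\<theta> \<in> test_functions U"
  shows "(\<lambda>p. c * \<theta> p) \<in> test_functions U"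
proof -
  obtain K where "compact K" "K \<subseteq> U" "\<And>p. p \<notin> K \<Longrightarrow> \<theta> p = 0"
    using test_functions_support[OF assms(1)] by metis
  then show ?thesis by (intro test_functionsI smooth_on_cmult test_functions_smooth[OF assms]) auto
qed

lemma test_functions_diff:
  assumes "\<theta> \<in> test_functions U" "\<eta> \<in> test_functions U"
  shows "(\<lambda>p. \<theta> p - \<eta> p) \<in> test_functions U"
proof -
  obtain K where K: "compact K" "K \<subseteq> U" "\<And>p. p \<notin> K \<Longrightarrow> \<theta> p = 0"
    using test_functions_support[OF assms(1)] by metis
  obtain L where L: "compact L" "L \<subseteq> U" "\<And>p. p \<notin> L \<Longrightarrow> \<eta> p = 0"
    using test_functions_support[OF assms(2)] by metis
  show ?thesis
    by (rule test_functionsI[of _ "K \<union> L"])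
      (use K L in \<open>auto intro!: smooth_on_diff test_functions_smooth[OF assms(1)] test_functions_smooth[OF assms(2)]\<close>)
qed

lemma test_functions_deriv:
  assumes "p \<in> test_functions U"
  shows "deriv p = partial 1 p" "deriv p \<in> test_functions U" "(p has_real_derivative deriv p x) (at x)"
proof -
  have d: "p differentiable at x" for x
    using smooth_on_differentiable[OF test_functions_smooth[OF assms]] by auto
  show "deriv p = partial 1 p" using partial_eq_deriv[OF d] by auto
  then show "deriv p \<in> test_functions U" using test_functions_partial[OF assms, of 1] by simp
  show "(p has_real_derivative deriv p x) (at x)"
    using d by (simp add: DERIV_deriv_iff_real_differentiable)
qed

lemma integrable_test_mult:
  fixes M :: "'a::euclidean_space measure"
  assumes "\<theta> \<in> test_functions U" "integrable M f" "sets M = sets borel"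
  shows "integrable M (\<lambda>x. f x * \<theta> x)"
proof -
  obtain B where B: "\<And>p. \<bar>\<theta> p\<bar> \<le> B" "B \<ge> 0" using test_functions_bounded[OF assms(1)] by metis
  have [measurable]: "\<theta> \<in> borel_measurable M"
    using test_functions_borel[OF assms(1)] measurable_cong_sets[OF assms(3) refl] by blast
  show ?thesis
  proof (rule Bochner_Integration.integrable_bound[of M "\<lambda>x. B * f x"])
    show "AE x in M. norm (f x * \<theta> x) \<le> norm (B * f x)"
      using B by (auto simp: abs_mult mult.commute[of B] intro!: mult_left_mono)
  qed (use assms in auto)
qed

lemma integrable_test:
  assumes "\<theta> \<in> test_functions U" shows "integrable lborel \<theta>"
proof -
  obtain K where K: "compact K" "K \<subseteq> U" "\<And>p. p \<notin> K \<Longrightarrow> \<theta> p = 0"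
    using test_functions_support[OF assms(1)] by metis
  have "integrable lborel (\<lambda>x. indicator K x * \<theta> x)"
    using K(1) emeasure_compact_finite[OF K(1)]
    by (intro integrable_test_mult[OF assms] integrable_real_indicator) (auto simp: borel_compact)
  moreover have "(\<lambda>x. indicator K x * \<theta> x) = \<theta>" using K(3) by (auto simp: fun_eq_iff indicator_def)
  ultimately show ?thesis by simp
qed

section \<open>Smooth cut-offs on the line\<close>

text \<open>
  All derivatives of \<open>exp (- 1 / x)\<close>, extended by zero to \<open>x \<le> 0\<close>, have this form, so that smoothness
  follows from a single computation of a derivative.
\<close>

definition flat :: "real poly \<Rightarrow> real \<Rightarrow> real" where
  "flat p x = (if 0 < x then poly p (1 / x) * exp (- (1 / x)) else 0)"

lemma poly_exp_tendsto_0: "((\<lambda>y::real. poly q y * exp (- y)) \<longlongrightarrow> 0) at_top"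
proof -
  have "((\<lambda>y::real. \<Sum>i\<le>degree q. coeff q i * (y ^ i / exp y)) \<longlongrightarrow> (\<Sum>i\<le>degree q. coeff q i * 0)) at_top"
    by (intro tendsto_sum tendsto_mult tendsto_const tendsto_power_div_exp_0)
  then show ?thesis by (simp add: poly_altdef sum_divide_distrib exp_minus field_simps)
qed

lemma flat_has_derivative:
  "(flat p has_real_derivative flat ([:0, 0, 1:] * (p - pderiv p)) x) (at x)"
proof -
  consider "x > 0" | "x < 0" | "x = 0" by linarith
  then show ?thesis
  proof cases
    case 1
    have "((\<lambda>x. poly p (1 / x) * exp (- (1 / x))) has_real_derivative
        flat ([:0, 0, 1:] * (p - pderiv p)) x) (at x)"
      using 1 by (auto intro!: derivative_eq_intros simp: flat_def field_simps power2_eq_square)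
    then show ?thesis
      by (rule has_field_derivative_transform_within_open[of _ _ _ "{0<..}"]) (use 1 in \<open>auto simp: flat_def\<close>)
  next
    case 2
    have "((\<lambda>x. 0) has_real_derivative flat ([:0, 0, 1:] * (p - pderiv p)) x) (at x)"
      using 2 by (simp add: flat_def)
    then show ?thesis
      by (rule has_field_derivative_transform_within_open[of _ _ _ "{..<0}"]) (use 2 in \<open>auto simp: flat_def\<close>)
  next
    case 3
    have "((\<lambda>h. poly ([:0, 1:] * p) (inverse h) * exp (- inverse h)) \<longlongrightarrow> 0) (at_right 0)"
      using poly_exp_tendsto_0[of "[:0, 1:] * p"]
      unfolding filterlim_at_top_to_right by simp
    then have "((\<lambda>h. flat p h / h) \<longlongrightarrow> 0) (at_right 0)"
      by (rule Lim_transform_eventually)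
        (auto simp: eventually_at_right_field flat_def field_simps intro!: exI[of _ 1])
    moreover have "((\<lambda>h. flat p h / h) \<longlongrightarrow> 0) (at_left 0)"
      by (rule Lim_transform_eventually[OF tendsto_const])
        (auto simp: eventually_at_left_field flat_def intro!: exI[of _ "-1"])
    ultimately have "((\<lambda>h. flat p h / h) \<longlongrightarrow> 0) (at 0)" by (simp add: filterlim_at_split)
    then show ?thesis unfolding 3 DERIV_def by (simp add: flat_def)
  qed
qed

lemma flat_smooth: "smooth_on UNIV (flat p)"
proof -
  have "Ck_on k UNIV (flat p)" for k
  proof (induction k arbitrary: p)
    case 0
    show ?case using DERIV_isCont[OF flat_has_derivative] by (simp add: continuous_at_imp_continuous_on)
  next
    case (Suc k)
    have "partial 1 (flat p) = flat ([:0, 0, 1:] * (p - pderiv p))"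
      by (rule ext) (rule partial_real[OF flat_has_derivative])
    moreover have "flat p differentiable (at x)" for x
      using flat_has_derivative real_differentiable_def by blast
    ultimately show ?case using Suc by simp
  qed
  then show ?thesis by (simp add: smooth_on_def)
qed

lemma smooth_on_affine: "smooth_on S (\<lambda>x::real. c * x + d)"
proof (rule smooth_on_real_iff[THEN iffD2, OF conjI])
  have *: "((\<lambda>x. c * x + d) has_real_derivative c) (at x)" for x
    by (auto intro!: derivative_eq_intros)
  then show "\<forall>p\<in>S. (\<lambda>x. c * x + d) differentiable at p" using real_differentiable_def by blast
  have "partial 1 (\<lambda>x. c * x + d) = (\<lambda>_. c)" using partial_real[OF *] by auto
  then show "smooth_on S (partial 1 (\<lambda>x. c * x + d))" by (simp add: smooth_on_const)
qed

definition bump :: "real \<Rightarrow> real" where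
  "bump x = flat 1 x * flat 1 (1 - x)"

lemma bump_smooth: "smooth_on UNIV bump"
proof -
  have "smooth_on UNIV (\<lambda>x. flat 1 (-1 * x + 1))"
    by (rule smooth_on_compose[OF _ _ flat_smooth smooth_on_affine]) auto
  then have "smooth_on UNIV (\<lambda>x. flat 1 (1 - x))" by simp
  then show ?thesis unfolding bump_def[abs_def]
    using smooth_on_mult[OF open_UNIV flat_smooth] by blast
qed

lemma bump_pos: "0 < x \<Longrightarrow> x < 1 \<Longrightarrow> 0 < bump x"
  and bump_zero: "x \<le> 0 \<or> 1 \<le> x \<Longrightarrow> bump x = 0"
  by (auto simp: bump_def flat_def)

lemma bump_nonneg: "0 \<le> bump x"
  by (simp add: bump_def flat_def)

lemma smooth_antiderivative:
  assumes "smooth_on UNIV q"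
  obtains F :: "real \<Rightarrow> real" where "\<And>x. (F has_real_derivative q x) (at x)" "smooth_on UNIV F"
proof -
  have "\<exists>F. \<forall>x::real. -\<infinity> < ereal x \<longrightarrow> ereal x < \<infinity> \<longrightarrow> (F has_vector_derivative q x) (at x)"
    using smooth_on_continuous[OF assms]
    by (intro einterval_antiderivative) (auto simp: continuous_on_eq_continuous_at)
  then obtain F where F: "\<And>x. (F has_real_derivative q x) (at x)"
    by (auto simp: has_real_derivative_iff_has_vector_derivative)
  then have "partial 1 F = q" using partial_real by blast
  moreover have "\<forall>x. F differentiable at x" using F real_differentiable_def by blast
  ultimately have "smooth_on UNIV F" using assms smooth_on_real_iff[of UNIV F] by simp
  with F that show thesis by blast
qed

text \<open>
  The normalised primitive of the bump: it is constant where the bump vanishes and strictly larger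
  on the right of the unit interval than on the left.
\<close>

lemma smooth_step_exists:
  obtains st :: "real \<Rightarrow> real" where "smooth_on UNIV st" "\<And>x. 0 \<le> st x" "\<And>x. st x \<le> 1"
    "\<And>x. x \<le> 0 \<Longrightarrow> st x = 0" "\<And>x. x \<ge> 1 \<Longrightarrow> st x = 1"
proof -
  obtain F where F: "\<And>x. (F has_real_derivative bump x) (at x)" "smooth_on UNIV F"
    using smooth_antiderivative[OF bump_smooth] by metis
  have "F 0 < F 1"
  proof (rule DERIV_pos_imp_increasing_open[of 0 1 F])
    show "\<exists>y. (F has_real_derivative y) (at x) \<and> 0 < y" if "0 < x" "x < 1" for x
      using F(1)[of x] bump_pos that by blast
    show "continuous_on {0..1} F" using smooth_on_continuous[OF F(2)] continuous_on_subset by blast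
  qed simp
  have mono: "F x \<le> F y" if "x \<le> y" for x y
    using F(1) bump_nonneg by (intro DERIV_nonneg_imp_nondecreasing[OF that]) blast
  have "\<exists>c. \<forall>x\<in>{..0}. F x = c"
  proof (rule has_field_derivative_zero_constant)
    show "(F has_real_derivative 0) (at x within {..0})" if "x \<in> {..0}" for x
      using F(1)[of x] bump_zero[of x] that by (simp add: has_field_derivative_at_within)
  qed simp
  then have 0: "F x = F 0" if "x \<le> 0" for x using that by (metis atMost_iff order_refl)
  have "\<exists>c. \<forall>x\<in>{1..}. F x = c"
  proof (rule has_field_derivative_zero_constant)
    show "(F has_real_derivative 0) (at x within {1..})" if "x \<in> {1..}" for x
      using F(1)[of x] bump_zero[of x] that by (simp add: has_field_derivative_at_within)
  qed simp
  then have 1: "F x = F 1" if "x \<ge> 1" for x using that by (metis atLeast_iff order_refl)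
  define st where "st x = (1 / (F 1 - F 0)) * (F x - F 0)" for x
  show thesis
  proof (rule that[of st])
    show "smooth_on UNIV st" unfolding st_def[abs_def]
      by (rule smooth_on_cmult[OF open_UNIV smooth_on_diff[OF open_UNIV F(2) smooth_on_const]])
    have "F 0 \<le> F x" for x using mono[of 0 x] 0[of x] by (cases "x \<le> 0") auto
    then show "0 \<le> st x" for x using \<open>F 0 < F 1\<close> by (simp add: st_def)
    have "F x \<le> F 1" for x using mono[of x 1] 1[of x] by (cases "x \<le> 1") auto
    then show "st x \<le> 1" for x using \<open>F 0 < F 1\<close> by (simp add: st_def divide_le_eq_1)
    show "st x = 0" if "x \<le> 0" for x using 0[OF that] by (simp add: st_def)
    show "st x = 1" if "x \<ge> 1" for x using 1[OF that] \<open>F 0 < F 1\<close> by (simp add: st_def)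
  qed
qed

definition smooth_step :: "real \<Rightarrow> real" where
  "smooth_step = (SOME st. smooth_on UNIV st \<and> (\<forall>x. 0 \<le> st x \<and> st x \<le> 1) \<and>
     (\<forall>x\<le>0. st x = 0) \<and> (\<forall>x\<ge>1. st x = 1))"

lemma
  shows smooth_step_smooth: "smooth_on UNIV smooth_step"
    and smooth_step_range: "0 \<le> smooth_step x" "smooth_step x \<le> 1"
    and smooth_step_0: "x \<le> 0 \<Longrightarrow> smooth_step x = 0"
    and smooth_step_1: "x \<ge> 1 \<Longrightarrow> smooth_step x = 1"
proof -
  have "\<exists>st :: real \<Rightarrow> real. smooth_on UNIV st \<and> (\<forall>x. 0 \<le> st x \<and> st x \<le> 1) \<and>
     (\<forall>x\<le>0. st x = 0) \<and> (\<forall>x\<ge>1. st x = 1)"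
  proof -
    obtain st :: "real \<Rightarrow> real" where "smooth_on UNIV st" "\<And>x. 0 \<le> st x" "\<And>x. st x \<le> 1"
      "\<And>x. x \<le> 0 \<Longrightarrow> st x = 0" "\<And>x. x \<ge> 1 \<Longrightarrow> st x = 1"
      using smooth_step_exists by blast
    then show ?thesis by (intro exI[of _ st]) simp
  qed
  then have "smooth_on UNIV smooth_step \<and> (\<forall>x. 0 \<le> smooth_step x \<and> smooth_step x \<le> 1) \<and>
     (\<forall>x\<le>0. smooth_step x = 0) \<and> (\<forall>x\<ge>1. smooth_step x = 1)"
    unfolding smooth_step_def by (rule someI_ex)
  then show "smooth_on UNIV smooth_step" "0 \<le> smooth_step x" "smooth_step x \<le> 1"
    "x \<le> 0 \<Longrightarrow> smooth_step x = 0" "x \<ge> 1 \<Longrightarrow> smooth_step x = 1"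
    by blast+
qed

text \<open>
  A rising step times a falling one.  As \<open>k\<close> grows, this tends to the indicator of the open interval
  from inside, which turns identities for test functions into identities for intervals.
\<close>

definition cutoff :: "real \<Rightarrow> real \<Rightarrow> real \<Rightarrow> real \<Rightarrow> real" where
  "cutoff a b k x = smooth_step (k * (x - a) - 1) * smooth_step (k * (b - x) - 1)"

lemma cutoff_range: "0 \<le> cutoff a b k x" "cutoff a b k x \<le> 1"
  by (simp_all add: cutoff_def smooth_step_range mult_le_one)

lemma cutoff_eq_1: "k > 0 \<Longrightarrow> a + 2 / k \<le> x \<Longrightarrow> x \<le> b - 2 / k \<Longrightarrow> cutoff a b k x = 1"
  unfolding cutoff_def using smooth_step_1[of "k * (x - a) - 1"] smooth_step_1[of "k * (b - x) - 1"]
  by (simp add: field_simps)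

lemma cutoff_eq_0: "k > 0 \<Longrightarrow> x < a + 1 / k \<or> b - 1 / k < x \<Longrightarrow> cutoff a b k x = 0"
  unfolding cutoff_def using smooth_step_0[of "k * (x - a) - 1"] smooth_step_0[of "k * (b - x) - 1"]
  by (auto simp: field_simps)

lemma cutoff_test:
  assumes "k > 0" shows "cutoff a b k \<in> test_functions {a<..<b}"
proof (rule test_functionsI[of _ "{a + 1/k .. b - 1/k}"])
  have "smooth_on UNIV (\<lambda>x. smooth_step (k * x + (- k * a - 1)))"
    "smooth_on UNIV (\<lambda>x. smooth_step ((- k) * x + (k * b - 1)))"
    by (rule smooth_on_compose[OF _ _ smooth_step_smooth smooth_on_affine]; simp)+
  then have "smooth_on UNIV (\<lambda>x. smooth_step (k * x + (- k * a - 1)) * smooth_step ((- k) * x + (k * b - 1)))"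
    by (rule smooth_on_mult[OF open_UNIV])
  then show "smooth_on UNIV (cutoff a b k)"
    unfolding cutoff_def[abs_def] by (simp add: algebra_simps)
  show "{a + 1/k .. b - 1/k} \<subseteq> {a<..<b}"
  proof -
    have "0 < 1 / k" using assms by simp
    then show ?thesis unfolding subset_iff atLeastAtMost_iff greaterThanLessThan_iff by linarith
  qed
  show "cutoff a b k x = 0" if "x \<notin> {a + 1/k .. b - 1/k}" for x
    using that assms by (intro cutoff_eq_0) auto
qed simp

lemma cutoff_tendsto_indicator:
  "(\<lambda>n. cutoff a b (real (Suc n)) x) \<longlonglongrightarrow> indicator {a<..<b} x"
proof (cases "a < x \<and> x < b")
  case True
  define d where "d = min (x - a) (b - x)"
  have "d > 0" using True by (simp add: d_def)
  have "((\<lambda>n. 2 / real (Suc n)) \<longlonglongrightarrow> 0)"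
    using LIMSEQ_inverse_real_of_nat[THEN tendsto_mult_left[of _ _ _ 2]] by (simp add: field_simps)
  then have "eventually (\<lambda>n. 2 / real (Suc n) < d) sequentially"
    using \<open>d > 0\<close> by (rule order_tendstoD)
  then have "eventually (\<lambda>n. indicator {a<..<b} x = cutoff a b (real (Suc n)) x) sequentially"
  proof eventually_elim
    case (elim n)
    then have "cutoff a b (real (Suc n)) x = 1" by (intro cutoff_eq_1) (auto simp: d_def)
    then show ?case using True by simp
  qed
  then show ?thesis by (rule Lim_transform_eventually[OF tendsto_const])
next
  case False
  then have "cutoff a b (real (Suc n)) x = 0" for n
  proof (intro cutoff_eq_0)
    have "0 < 1 / real (Suc n)" by simp
    then show "x < a + 1 / real (Suc n) \<or> b - 1 / real (Suc n) < x" using False by linarith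
  qed simp
  then show ?thesis using False by simp
qed

section \<open>Measures and functions determined by test functions\<close>

text \<open>
  Both sides are finite signed measures of \<open>S\<close>, so the sets on which they agree form a Dynkin
  system, and the boxes are an intersection-stable generator.  The measure \<open>L\<close> is a parameter because
  the lemma is used both for Lebesgue measure and for the image of time under a curve.
\<close>

lemma signed_measure_eqI_box:
  fixes M N L :: "'a::euclidean_space measure" and h :: "'a \<Rightarrow> real"
  assumes "finite_measure M" "finite_measure N" and sets: "sets M = sets borel" "sets N = sets borel" "sets L = sets borel"
    and U: "emeasure M (- box u v) = 0" "emeasure N (- box u v) = 0" "\<And>z. z \<notin> box u v \<Longrightarrow> h z = 0"
    and h: "integrable L h"
    and eq: "\<And>\<alpha> \<beta>. box \<alpha> \<beta> \<subseteq> box u v \<Longrightarrow>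
        measure M (box \<alpha> \<beta>) - measure N (box \<alpha> \<beta>) = (LINT z:box \<alpha> \<beta>|L. h z)"
    and S: "S \<in> sets borel"
  shows "measure M S - measure N S = (LINT z:S|L. h z)"
proof -
  interpret M: finite_measure M by fact
  interpret N: finite_measure N by fact
  have [measurable_cong]: "sets M = sets borel" "sets N = sets borel" "sets L = sets borel" by fact+
  have sp: "space M = UNIV" "space N = UNIV" using sets_eq_imp_space_eq[OF sets(1)] sets_eq_imp_space_eq[OF sets(2)] by auto
  let ?U = "box u v"
  have cut: "measure M X = measure M (X \<inter> ?U)" "measure N X = measure N (X \<inter> ?U)"
    "(LINT z:X|L. h z) = (LINT z:X \<inter> ?U|L. h z)" if "X \<in> sets borel" for X
  proof -
    have "AE z in M. z \<in> ?U" "AE z in N. z \<in> ?U"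
      using U(1,2) sp by (auto intro!: AE_I[where N="- ?U"] simp: sets)
    then show "measure M X = measure M (X \<inter> ?U)" "measure N X = measure N (X \<inter> ?U)"
      using that by (auto intro!: measure_eq_AE simp: sets)
    show "(LINT z:X|L. h z) = (LINT z:X \<inter> ?U|L. h z)"
      unfolding set_lebesgue_integral_def
      by (rule Bochner_Integration.integral_cong) (auto simp: indicator_def U(3))
  qed
  have box: "measure M X - measure N X = (LINT z:X|L. h z)" if Xr: "X \<in> range (\<lambda>(a, b). box a b)" for X
  proof -
    obtain \<alpha> \<beta> where X: "X = box \<alpha> \<beta>" using Xr by auto
    obtain \<gamma> \<delta> where XU: "X \<inter> ?U = box \<gamma> \<delta>" unfolding X box_Int_box by blast
    show ?thesis
      using eq[of \<gamma> \<delta>] XU cut[of X] X by auto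
  qed
  have int: "set_integrable L X h" if "X \<in> sets borel" for X
    unfolding set_integrable_def using h that by (intro integrable_mult_indicator) (auto simp: sets)
  have S': "S \<in> sigma_sets UNIV (range (\<lambda>(a, b). box a b))"
    using S unfolding borel_eq_box by simp
  have ss: "X \<in> sets borel" if "X \<in> sigma_sets UNIV (range (\<lambda>(a, b). box a b))" for X :: "'a set"
    using that unfolding borel_eq_box by simp
  have stable: "Int_stable (range (\<lambda>(a, b). box a b :: 'a set))"
    unfolding Int_stable_def by (auto simp: box_Int_box)
  have UNIV: "measure M UNIV - measure N UNIV = (LINT z:UNIV|L. h z)"
    using cut[of UNIV] box[of ?U] by auto
  show ?thesis
    using stable top_greatest[of "range (\<lambda>(a, b). box a b :: 'a set)", folded Pow_UNIV] S'
  proof (induction S rule: sigma_sets_induct_disjoint)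
    case (basic A)
    then show ?case by (rule box)
  next
    case empty
    show ?case by (simp add: set_lebesgue_integral_def)
  next
    case (compl A)
    then have A: "A \<in> sets borel" by (intro ss)
    have "measure M (UNIV - A) = measure M UNIV - measure M A"
      "measure N (UNIV - A) = measure N UNIV - measure N A"
      using M.finite_measure_compl[of A] N.finite_measure_compl[of A] A by (auto simp: sets sp)
    moreover have "(LINT z:UNIV|L. h z) = (LINT z:A|L. h z) + (LINT z:UNIV - A|L. h z)"
      using set_integral_Un[of A "UNIV - A" L h] int A by (auto simp: sets)
    ultimately show ?case using UNIV compl by linarith
  next
    case (union A)
    have A: "A i \<in> sets borel" for i using union by (intro ss) auto
    have "(\<lambda>i. measure M (A i)) sums measure M (\<Union>i. A i)" "(\<lambda>i. measure N (A i)) sums measure N (\<Union>i. A i)"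
      using M.finite_measure_UNION[of A] N.finite_measure_UNION[of A] A union by (auto simp: sets)
    from sums_diff[OF this] have "(\<lambda>i. LINT z:A i|L. h z) sums (measure M (\<Union>i. A i) - measure N (\<Union>i. A i))"
      by (simp only: union(3))
    moreover have "(LINT z:(\<Union>i. A i)|L. h z) = (\<Sum>i. LINT z:A i|L. h z)"
      using A union(1) int[of "\<Union>i. A i"]
      by (intro lebesgue_integral_countable_add) (auto simp: disjoint_family_on_def sets)
    ultimately show ?case by (simp add: sums_unique)
  qed
qed

lemma AE_zero_if_set_integrals_zero:
  fixes h :: "'a::euclidean_space \<Rightarrow> real"
  assumes h: "integrable lborel h" and 0: "\<And>S. S \<in> sets borel \<Longrightarrow> (LINT z:S|lborel. h z) = 0"
  shows "AE z in lborel. h z = 0"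
proof -
  have [measurable]: "h \<in> borel_measurable borel" using h by auto
  have *: "AE z in lborel. indicator {z. 0 < s * h z} z * (s * h z) = 0" for s
  proof (subst integral_nonneg_eq_0_iff_AE[symmetric])
    have [measurable]: "{z. 0 < s * h z} \<in> sets borel" by measurable
    have "integrable lborel (\<lambda>z. indicator {z. 0 < s * h z} z *\<^sub>R (s * h z))"
      by (intro integrable_mult_indicator) (use h in auto)
    then show "integrable lborel (\<lambda>z. indicator {z. 0 < s * h z} z * (s * h z))" by simp
    have "(\<integral>z. indicator {z. 0 < s * h z} z * (s * h z) \<partial>lborel) = s * (LINT z:{z. 0 < s * h z}|lborel. h z)"
      unfolding set_lebesgue_integral_def by (simp add: mult.left_commute)
    then show "(\<integral>z. indicator {z. 0 < s * h z} z * (s * h z) \<partial>lborel) = 0" using 0 by simp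
  qed (auto simp: indicator_def)
  from *[of 1] *[of "-1"] show ?thesis by eventually_elim (auto simp: indicator_def split: if_splits)
qed

lemma cutoff_integral_tendsto:
  fixes h :: "'a \<Rightarrow> real"
  assumes X[measurable]: "X \<in> borel_measurable M" and h: "integrable M h"
  shows "(\<lambda>n. \<integral>z. cutoff a b (real (Suc n)) (X z) * h z \<partial>M) \<longlonglongrightarrow> (\<integral>z. indicator {a<..<b} (X z) * h z \<partial>M)"
proof (rule integral_dominated_convergence[where w="\<lambda>t. \<bar>h t\<bar>"])
  show "(\<lambda>t. indicat_real {a<..<b} (X t) * h t) \<in> borel_measurable M" using h by measurable
  have [measurable]: "cutoff a b (real (Suc n)) \<in> borel_measurable borel" for n
    by (rule test_functions_borel[OF cutoff_test]) simp
  show "(\<lambda>t. cutoff a b (real (Suc n)) (X t) * h t) \<in> borel_measurable M" for n using h by measurable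
  show "AE t in M. (\<lambda>n. cutoff a b (real (Suc n)) (X t) * h t) \<longlonglongrightarrow> indicat_real {a<..<b} (X t) * h t"
    by (intro AE_I2 tendsto_mult tendsto_const cutoff_tendsto_indicator)
  show "AE t in M. norm (cutoff a b (real (Suc n)) (X t) * h t) \<le> \<bar>h t\<bar>" for n
    using cutoff_range[of a b "real (Suc n)"] by (auto simp: abs_mult mult_left_le_one_le)
qed (use h in auto)

lemma cutoff_prod_integral_tendsto:
  fixes M :: "(real \<times> real) measure"
  assumes sets: "sets M = sets borel" and h: "integrable M h"
  shows "(\<lambda>n. \<integral>z. cutoff a b (real (Suc n)) (fst z) * cutoff c d (real (Suc n)) (snd z) * h z \<partial>M)
    \<longlonglongrightarrow> (LINT z:{a<..<b} \<times> {c<..<d}|M. h z)"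
  unfolding set_lebesgue_integral_def
proof (rule integral_dominated_convergence[where w="\<lambda>t. \<bar>h t\<bar>"])
  have [measurable_cong]: "sets M = sets borel" by fact
  have [measurable]: "{a<..<b} \<times> {c<..<d} \<in> sets borel" by (simp add: borel_Times)
  show "(\<lambda>z. indicat_real ({a<..<b} \<times> {c<..<d}) z *\<^sub>R h z) \<in> borel_measurable M" using h by measurable
  have [measurable]: "cutoff a b (real (Suc n)) \<in> borel_measurable borel" for n a b
    by (rule test_functions_borel[OF cutoff_test]) simp
  have fs[measurable]: "fst \<in> borel_measurable (borel :: (real \<times> real) measure)" "snd \<in> borel_measurable (borel :: (real \<times> real) measure)"
    by (auto intro!: borel_measurable_continuous_onI continuous_intros)
  show "(\<lambda>z. cutoff a b (real (Suc n)) (fst z) * cutoff c d (real (Suc n)) (snd z) * h z) \<in> borel_measurable M" for n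
    using h by measurable
  have *: "indicat_real ({a<..<b} \<times> {c<..<d}) z = indicator {a<..<b} (fst z) * indicator {c<..<d} (snd z)" for z
    by (cases z) (auto simp: indicator_def)
  show "AE z in M. (\<lambda>n. cutoff a b (real (Suc n)) (fst z) * cutoff c d (real (Suc n)) (snd z) * h z)
     \<longlonglongrightarrow> indicat_real ({a<..<b} \<times> {c<..<d}) z *\<^sub>R h z"
    unfolding * real_scaleR_def by (intro AE_I2 tendsto_mult tendsto_const cutoff_tendsto_indicator)
  show "AE z in M. norm (cutoff a b (real (Suc n)) (fst z) * cutoff c d (real (Suc n)) (snd z) * h z) \<le> \<bar>h z\<bar>" for n
    using cutoff_range[of _ _ "real (Suc n)"] by (auto simp: abs_mult mult_left_le_one_le mult_le_one)
qed (use h in auto)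

text \<open>
  Cut-offs tend boundedly to the indicator of an interval; so the identity for test functions passes to
  intervals.
\<close>

lemma signed_measure_eqI_test:
  fixes M N :: "real measure"
  assumes fin: "finite_measure M" "finite_measure N" and sets: "sets M = sets borel" "sets N = sets borel"
    and U: "emeasure M (- {a<..<b}) = 0" "emeasure N (- {a<..<b}) = 0" "\<And>z. z \<notin> {a<..<b} \<Longrightarrow> h z = 0"
    and h: "integrable lborel h"
    and eq: "\<And>q. q \<in> test_functions {a<..<b} \<Longrightarrow> (\<integral>t. q t \<partial>M) - (\<integral>t. q t \<partial>N) = (\<integral>t. q t * h t \<partial>lborel)"
    and S: "S \<in> sets borel"
  shows "measure M S - measure N S = (LINT z:S|lborel. h z)"
proof (rule signed_measure_eqI_box[OF fin sets sets_lborel _ _ _ h _ S])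
  interpret M: finite_measure M by fact
  interpret N: finite_measure N by fact
  show "emeasure M (- box a b) = 0" "emeasure N (- box a b) = 0" "\<And>z. z \<notin> box a b \<Longrightarrow> h z = 0"
    using U by simp_all
  fix \<alpha> \<beta> assume sub: "box \<alpha> \<beta> \<subseteq> box a b"
  have "cutoff \<alpha> \<beta> (real (Suc n)) \<in> test_functions {a<..<b}" for n
    by (rule test_functions_mono[OF cutoff_test]) (use sub in auto)
  from eq[OF this] have eq': "(\<integral>t. cutoff \<alpha> \<beta> (real (Suc n)) t * 1 \<partial>M) - (\<integral>t. cutoff \<alpha> \<beta> (real (Suc n)) t * 1 \<partial>N)
    = (\<integral>t. cutoff \<alpha> \<beta> (real (Suc n)) t * h t \<partial>lborel)" for n by simp
  have [measurable_cong]: "sets M = sets borel" "sets N = sets borel" by fact+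
  have "(\<integral>t. indicator {\<alpha><..<\<beta>} t * 1 \<partial>M) - (\<integral>t. indicator {\<alpha><..<\<beta>} t * 1 \<partial>N) = (\<integral>t. indicator {\<alpha><..<\<beta>} t * h t \<partial>lborel)"
    by (rule LIMSEQ_unique[OF tendsto_diff[OF cutoff_integral_tendsto cutoff_integral_tendsto]
        cutoff_integral_tendsto[of "\<lambda>t. t" lborel h \<alpha> \<beta>, folded eq']]) (use h in auto)
  then show "measure M (box \<alpha> \<beta>) - measure N (box \<alpha> \<beta>) = (LINT z:box \<alpha> \<beta>|lborel. h z)"
    by (simp add: sets set_lebesgue_integral_def)
qed

lemma signed_measure_eqI_test_prod:
  fixes M N L :: "(real \<times> real) measure"
  assumes fin: "finite_measure M" "finite_measure N" and sets: "sets M = sets borel" "sets N = sets borel" "sets L = sets borel"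
    and U: "emeasure M (- ({a<..<b} \<times> {c<..<d})) = 0" "emeasure N (- ({a<..<b} \<times> {c<..<d})) = 0"
      "\<And>z. z \<notin> {a<..<b} \<times> {c<..<d} \<Longrightarrow> h z = 0"
    and h: "integrable L h"
    and eq: "\<And>p q. p \<in> test_functions {a<..<b} \<Longrightarrow> q \<in> test_functions {c<..<d} \<Longrightarrow>
      (\<integral>z. p (fst z) * q (snd z) \<partial>M) - (\<integral>z. p (fst z) * q (snd z) \<partial>N) = (\<integral>z. p (fst z) * q (snd z) * h z \<partial>L)"
    and S: "S \<in> sets borel"
  shows "measure M S - measure N S = (LINT z:S|L. h z)"
proof (rule signed_measure_eqI_box[OF fin sets _ _ _ h _ S])
  interpret M: finite_measure M by fact
  interpret N: finite_measure N by fact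
  have box: "box (\<alpha>, \<gamma>) (\<beta>, \<delta>) = {\<alpha><..<\<beta>} \<times> {\<gamma><..<\<delta>}" for \<alpha> \<beta> \<gamma> \<delta> :: real
    by (auto simp: box_def Basis_prod_def)
  show "emeasure M (- box (a, c) (b, d)) = 0" "emeasure N (- box (a, c) (b, d)) = 0"
    "\<And>z. z \<notin> box (a, c) (b, d) \<Longrightarrow> h z = 0"
    using U by (simp_all add: box)
  fix x y :: "real \<times> real" assume sub: "box x y \<subseteq> box (a, c) (b, d)"
  obtain \<alpha> \<gamma> \<beta> \<delta> where xy: "x = (\<alpha>, \<gamma>)" "y = (\<beta>, \<delta>)" by (metis surj_pair)
  show "measure M (box x y) - measure N (box x y) = (LINT z:box x y|L. h z)"
  proof (cases "box x y = {}")
    case True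
    then show ?thesis by (simp add: set_lebesgue_integral_def)
  next
    case False
    then have sub': "{\<alpha><..<\<beta>} \<subseteq> {a<..<b}" "{\<gamma><..<\<delta>} \<subseteq> {c<..<d}"
      using sub unfolding xy box by (auto simp: times_subset_iff)
    let ?p = "\<lambda>n. cutoff \<alpha> \<beta> (real (Suc n))" and ?q = "\<lambda>n. cutoff \<gamma> \<delta> (real (Suc n))"
    have "?p n \<in> test_functions {a<..<b}" "?q n \<in> test_functions {c<..<d}" for n
      using sub' by (auto intro!: test_functions_mono[OF cutoff_test])
    from eq[OF this] have eq': "(\<integral>z. ?p n (fst z) * ?q n (snd z) * 1 \<partial>M) - (\<integral>z. ?p n (fst z) * ?q n (snd z) * 1 \<partial>N)
      = (\<integral>z. ?p n (fst z) * ?q n (snd z) * h z \<partial>L)" for n by simp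
    have "(LINT t:{\<alpha><..<\<beta>} \<times> {\<gamma><..<\<delta>}|M. 1) - (LINT t:{\<alpha><..<\<beta>} \<times> {\<gamma><..<\<delta>}|N. 1)
        = (LINT t:{\<alpha><..<\<beta>} \<times> {\<gamma><..<\<delta>}|L. h t)"
      by (rule LIMSEQ_unique[OF tendsto_diff[OF cutoff_prod_integral_tendsto cutoff_prod_integral_tendsto]
          cutoff_prod_integral_tendsto[of L h \<alpha> \<beta> \<gamma> \<delta>, folded eq']]) (use sets h in auto)
    then show ?thesis unfolding xy box
      by (simp add: sets set_lebesgue_integral_def borel_Times)
  qed
qed

lemma finite_null_measure: "finite_measure (null_measure M)"
  by standard simp

text \<open>
  For the null measures, \<open>signed_measure_eqI_test\<close> says that \<open>h\<close> has integral zero over every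
  Borel set.
\<close>

lemma fundamental_lemma:
  fixes h :: "real \<Rightarrow> real"
  assumes h: "set_integrable lborel {a<..<b} h"
    and 0: "\<And>q. q \<in> test_functions {a<..<b} \<Longrightarrow> (\<integral>t. q t * h t \<partial>lborel) = 0"
  shows "AE t in lborel. t \<in> {a<..<b} \<longrightarrow> h t = 0"
proof -
  let ?h = "\<lambda>t. indicator {a<..<b} t * h t"
  have h': "integrable lborel ?h" using h by (simp add: set_integrable_def)
  have q: "(\<integral>t. q t * ?h t \<partial>lborel) = 0" if "q \<in> test_functions {a<..<b}" for q
  proof -
    have "(\<lambda>t. q t * ?h t) = (\<lambda>t. q t * h t)"
      using test_functions_outside[OF that] by (auto simp: indicator_def fun_eq_iff)
    then show ?thesis using 0[OF that] by metis
  qed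
  have "AE t in lborel. ?h t = 0"
  proof (rule AE_zero_if_set_integrals_zero[OF h'])
    fix S :: "real set" assume "S \<in> sets borel"
    from signed_measure_eqI_test[OF finite_null_measure finite_null_measure _ _ _ _ _ h' _ this, of lborel lborel a b]
    show "(LINT z:S|lborel. ?h z) = 0" using q by (auto simp: measure_def)
  qed
  then show ?thesis by eventually_elim (auto simp: indicator_def)
qed

lemma fundamental_lemma_prod:
  fixes h :: "real \<times> real \<Rightarrow> real"
  assumes h: "integrable lborel h" and U: "\<And>z. z \<notin> {a<..<b} \<times> {c<..<d} \<Longrightarrow> h z = 0"
    and 0: "\<And>p q. p \<in> test_functions {a<..<b} \<Longrightarrow> q \<in> test_functions {c<..<d} \<Longrightarrow>
      (\<integral>z. p (fst z) * q (snd z) * h z \<partial>lborel) = 0"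
  shows "AE z in lborel. h z = 0"
proof (rule AE_zero_if_set_integrals_zero[OF h])
  fix S :: "(real \<times> real) set" assume "S \<in> sets borel"
  from signed_measure_eqI_test_prod[OF finite_null_measure finite_null_measure _ _ _ _ _ U h _ this, of lborel lborel]
  show "(LINT z:S|lborel. h z) = 0" using 0 by (auto simp: measure_def)
qed

section \<open>Functions that do not depend on the first variable\<close>

lemma fst_snd_borel [measurable]:
  "fst \<in> borel_measurable (borel :: (real \<times> real) measure)"
  "snd \<in> borel_measurable (borel :: (real \<times> real) measure)"
  by (auto intro!: borel_measurable_continuous_onI continuous_intros)

text \<open>
  A primitive of \<open>q\<close> is constant on either side of the support; the two constants agree because
  \<open>q\<close> has mean zero.
\<close>

lemma test_antiderivative:
  assumes q: "q \<in> test_functions {a<..<b}" and "a < b" and 0: "(\<integral>t. q t \<partial>lborel) = 0"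
  obtains p where "p \<in> test_functions {a<..<b}" "deriv p = q"
proof -
  obtain l r where lr: "a < l" "l < r" "r < b" "\<And>x. x \<notin> {l..r} \<Longrightarrow> q x = 0"
    using test_functions_real_support[OF q \<open>a < b\<close>] by metis
  obtain F where F: "\<And>x. (F has_real_derivative q x) (at x)" "smooth_on UNIV F"
    using smooth_antiderivative[OF test_functions_smooth[OF q]] by metis
  define l' r' where "l' = (a + l) / 2" and "r' = (r + b) / 2"
  have lr': "a < l'" "l' < l" "r < r'" "r' < b" using lr by (auto simp: l'_def r'_def)
  have FTC: "(\<integral>t. indicator {x..y} t *\<^sub>R q t \<partial>lborel) = F y - F x" if "x \<le> y" for x y
    using that F(1) smooth_on_continuous[OF test_functions_smooth[OF q]]
    by (intro integral_FTC_atLeastAtMost)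
      (auto simp: has_real_derivative_iff_has_vector_derivative intro: has_vector_derivative_at_within continuous_on_subset)
  have left: "F x = F l'" if "x < l'" for x
  proof -
    have "(\<lambda>t. indicator {x..l'} t *\<^sub>R q t) = (\<lambda>t. 0)" using lr(4) lr' by (auto simp: fun_eq_iff indicator_def)
    with FTC[of x l'] that show ?thesis by simp
  qed
  have right: "F x = F l'" if "x > r'" for x
  proof -
    have "(\<lambda>t. indicator {l'..x} t *\<^sub>R q t) = q"
    proof
      show "indicator {l'..x} t *\<^sub>R q t = q t" for t
        using lr(4)[of t] lr' lr(2) that by (cases "t \<in> {l..r}") (auto simp: indicator_def)
    qed
    with FTC[of l' x] that lr lr' 0 show ?thesis by simp
  qed
  show thesis
  proof (rule that[of "\<lambda>x. F x - F l'"])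
    show "(\<lambda>x. F x - F l') \<in> test_functions {a<..<b}"
    proof (rule test_functionsI[of _ "{l'..r'}"])
      show "smooth_on UNIV (\<lambda>x. F x - F l')" by (rule smooth_on_diff[OF open_UNIV F(2) smooth_on_const])
      show "F x - F l' = 0" if "x \<notin> {l'..r'}" for x
        using left[of x] right[of x] that by (cases "x < l'") auto
    qed (use lr' in auto)
    show "deriv (\<lambda>x. F x - F l') = q"
      by (rule ext, rule DERIV_imp_deriv) (auto intro!: derivative_eq_intros F(1))
  qed
qed

text \<open>
  This expresses \<open>p\<close> through its derivative.  Combined with Fubini it rewrites the integral of \<open>p\<close>
  against a measure in terms of the mass that lies to the left of a point.
\<close>

lemma test_function_tail_integral:
  assumes p: "p \<in> test_functions {a<..<b}"
  shows "(\<integral>y. indicator {x..} y * deriv p y \<partial>lborel) = - p (x::real)"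
proof -
  define R where "R = max x b + 1"
  have "(\<integral>t. indicator {x..R} t *\<^sub>R deriv p t \<partial>lborel) = p R - p x"
    using test_functions_deriv(3)[OF p] smooth_on_continuous[OF test_functions_smooth[OF test_functions_deriv(2)[OF p]]]
    by (intro integral_FTC_atLeastAtMost)
      (auto simp: R_def has_real_derivative_iff_has_vector_derivative intro: has_vector_derivative_at_within continuous_on_subset)
  moreover have "p R = 0" by (rule test_functions_outside[OF p]) (auto simp: R_def)
  moreover have "(\<lambda>t. indicator {x..R} t *\<^sub>R deriv p t) = (\<lambda>t. indicator {x..} t * deriv p t)"
  proof
    fix t
    have "deriv p t = 0" if "t > R"
      using that by (intro test_functions_outside[OF test_functions_deriv(2)[OF p]]) (auto simp: R_def)
    then show "indicator {x..R} t *\<^sub>R deriv p t = indicator {x..} t * deriv p t"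
      by (auto simp: indicator_def)
  qed
  ultimately show ?thesis by simp
qed

lemma integrable_indicator_Ioo [simp]: "integrable lborel (indicator {a<..<b} :: real \<Rightarrow> real)"
  by (intro integrable_real_indicator emeasure_bounded_finite) auto

lemma unit_mass_test_function:
  assumes "a < b"
  obtains \<psi> where "\<psi> \<in> test_functions {a<..<b::real}" "(\<integral>t. \<psi> t \<partial>lborel) = 1"
proof -
  have "\<exists>\<psi> \<in> test_functions {a<..<b}. (\<integral>t. \<psi> t \<partial>lborel) \<noteq> 0"
  proof (rule ccontr)
    assume *: "\<not> (\<exists>\<psi> \<in> test_functions {a<..<b}. (\<integral>t. \<psi> t \<partial>lborel) \<noteq> 0)"
    have "AE t in lborel. t \<in> {a<..<b} \<longrightarrow> (1::real) = 0"
      by (rule fundamental_lemma) (use * in \<open>auto simp: set_integrable_def\<close>)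
    then have "emeasure lborel {a<..<b} = 0" by (subst (asm) AE_iff_measurable[of "{a<..<b}"]) auto
    then show False using assms by simp
  qed
  then obtain \<psi> where \<psi>: "\<psi> \<in> test_functions {a<..<b}" "(\<integral>t. \<psi> t \<partial>lborel) \<noteq> 0" by blast
  show thesis
    by (rule that[OF test_functions_cmult[OF \<psi>(1), of "1 / (\<integral>t. \<psi> t \<partial>lborel)"]]) (use \<psi>(2) in simp)
qed

lemma integrable_prod_mult:
  fixes f g :: "real \<Rightarrow> real"
  assumes f: "integrable lborel f" and g: "integrable lborel g"
  shows "integrable lborel (\<lambda>z::real\<times>real. f (fst z) * g (snd z))" (is ?i)
    and "(\<integral>z. f (fst z) * g (snd z) \<partial>(lborel :: (real\<times>real) measure)) = (\<integral>x. f x \<partial>lborel) * (\<integral>x. g x \<partial>lborel)"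
proof -
  have [measurable]: "f \<in> borel_measurable borel" "g \<in> borel_measurable borel" using f g by auto
  have *: "integrable (lborel \<Otimes>\<^sub>M lborel) (\<lambda>z::real\<times>real. f (fst z) * g (snd z))"
    using f g by (intro lborel_pair.Fubini_integrable) (auto simp: abs_mult)
  then show ?i by (simp add: lborel_prod)
  show "(\<integral>z. f (fst z) * g (snd z) \<partial>(lborel :: (real\<times>real) measure)) = (\<integral>x. f x \<partial>lborel) * (\<integral>x. g x \<partial>lborel)"
    using lborel_pair.integral_fst'[OF *] by (simp add: lborel_prod)
qed

lemma integrable_test_prod_mult:
  fixes M :: "(real \<times> real) measure"
  assumes "p \<in> test_functions U" "q \<in> test_functions V" "integrable M f" "sets M = sets borel"
  shows "integrable M (\<lambda>z. p (fst z) * q (snd z) * f z)"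
proof -
  obtain B where B: "\<And>x. \<bar>p x\<bar> \<le> B" "B \<ge> 0" using test_functions_bounded[OF assms(1)] by metis
  obtain C where C: "\<And>x. \<bar>q x\<bar> \<le> C" "C \<ge> 0" using test_functions_bounded[OF assms(2)] by metis
  have [measurable_cong]: "sets M = sets borel" by fact
  have [measurable]: "p \<in> borel_measurable borel" "q \<in> borel_measurable borel" "f \<in> borel_measurable M"
    using test_functions_borel assms by auto
  show ?thesis
  proof (rule Bochner_Integration.integrable_bound[of M "\<lambda>x. (B * C) * f x"])
    have "\<bar>p x\<bar> * \<bar>q y\<bar> * \<bar>f z\<bar> \<le> B * C * \<bar>f z\<bar>" for x y z
      using B C by (intro mult_right_mono mult_mono) auto
    then show "AE x in M. norm (p (fst x) * q (snd x) * f x) \<le> norm (B * C * f x)"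
      using B C by (auto simp: abs_mult)
  qed (use assms in auto)
qed

text \<open>
  A test function \<open>\<psi>\<close> minus \<open>(\<integral>\<psi>) \<psi>0\<close>, where \<open>\<psi>0\<close> has mass one, is the derivative of a test function.  Hence
  \<open>v\<close>, tested against \<open>\<psi>\<close> in the first variable, depends on the mass of \<open>\<psi>\<close> only, and the average of \<open>v\<close>
  against \<open>\<psi>0\<close> must be the function \<open>g\<close>.
\<close>

lemma AE_independent_of_first:
  fixes v :: "real \<times> real \<Rightarrow> real"
  assumes "a < b" and v: "integrable lborel v" and U: "\<And>z. z \<notin> {a<..<b} \<times> {c<..<d} \<Longrightarrow> v z = 0"
    and 0: "\<And>p q. p \<in> test_functions {a<..<b} \<Longrightarrow> q \<in> test_functions {c<..<d} \<Longrightarrow>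
      (\<integral>z. deriv p (fst z) * q (snd z) * v z \<partial>lborel) = 0"
  obtains g where "integrable lborel g" "AE z in lborel. z \<in> {a<..<b} \<times> {c<..<d} \<longrightarrow> v z = g (snd z)"
proof -
  obtain \<psi>0 where \<psi>0: "\<psi>0 \<in> test_functions {a<..<b}" "(\<integral>t. \<psi>0 t \<partial>lborel) = 1"
    using unit_mass_test_function[OF \<open>a < b\<close>] by metis
  have [measurable]: "v \<in> borel_measurable borel" using v by auto
  have B: "{a<..<b} \<times> {c<..<d} \<in> sets (borel :: (real\<times>real) measure)" by (simp add: borel_Times)
  obtain K where K: "\<And>x. \<bar>\<psi>0 x\<bar> \<le> K" "K \<ge> 0" using test_functions_bounded[OF \<psi>0(1)] by metis
  have [measurable]: "\<psi>0 \<in> borel_measurable borel" using test_functions_borel[OF \<psi>0(1)] .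
  have i0: "integrable lborel (\<lambda>z. \<psi>0 (fst z) * v z)"
    by (rule Bochner_Integration.integrable_bound[of _ "\<lambda>z. K * v z"])
      (use v K in \<open>auto simp: abs_mult intro!: mult_right_mono\<close>)
  define g where "g t = (\<integral>y. \<psi>0 y * v (y, t) \<partial>lborel)" for t
  have i0': "integrable (lborel \<Otimes>\<^sub>M lborel) (\<lambda>(y, t). \<psi>0 y * v (y, t))"
    using i0 by (simp add: lborel_prod case_prod_beta')
  have g: "integrable lborel g" unfolding g_def using lborel_pair.integrable_snd[OF i0'] .
  define h where "h z = v z - indicator {a<..<b} (fst z) * (indicator {c<..<d} (snd z) * g (snd z))" for z
  have cg: "integrable lborel (\<lambda>t. indicator {c<..<d} t * g t)"
    using integrable_mult_indicator[OF _ g, of "{c<..<d}"] by simp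
  have ig: "integrable lborel (\<lambda>z::real\<times>real. indicator {a<..<b} (fst z) * (indicator {c<..<d} (snd z) * g (snd z)))"
    by (rule integrable_prod_mult(1)[OF integrable_indicator_Ioo cg])
  have "AE z in lborel. h z = 0"
  proof (rule fundamental_lemma_prod[of _ a b c d])
    show "integrable lborel h" unfolding h_def by (rule Bochner_Integration.integrable_diff[OF v ig])
    show "h z = 0" if "z \<notin> {a<..<b} \<times> {c<..<d}" for z
      using U[OF that] that by (cases z) (auto simp: h_def indicator_def)
    fix p q assume p: "p \<in> test_functions {a<..<b}" and q: "q \<in> test_functions {c<..<d}"
    let ?P = "\<integral>t. p t \<partial>lborel"
    have "(\<lambda>t. p t - ?P * \<psi>0 t) \<in> test_functions {a<..<b}"
      by (intro test_functions_diff test_functions_cmult p \<psi>0)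
    moreover have "(\<integral>t. p t - ?P * \<psi>0 t \<partial>lborel) = 0"
      using integrable_test[OF p] integrable_test[OF \<psi>0(1)] \<psi>0(2) by simp
    ultimately obtain P where P: "P \<in> test_functions {a<..<b}" "deriv P = (\<lambda>t. p t - ?P * \<psi>0 t)"
      using test_antiderivative[OF _ \<open>a < b\<close>] by metis
    have ipv: "integrable lborel (\<lambda>z. p (fst z) * q (snd z) * v z)"
      and i0v: "integrable lborel (\<lambda>z. \<psi>0 (fst z) * q (snd z) * v z)"
      using integrable_test_prod_mult[OF p q v] integrable_test_prod_mult[OF \<psi>0(1) q v] by simp_all
    have "0 = (\<integral>z. p (fst z) * q (snd z) * v z - ?P * (\<psi>0 (fst z) * q (snd z) * v z) \<partial>lborel)"
      using 0[OF P(1) q] unfolding P(2) by (simp add: algebra_simps)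
    also have "\<dots> = (\<integral>z. p (fst z) * q (snd z) * v z \<partial>lborel) - ?P * (\<integral>z. \<psi>0 (fst z) * q (snd z) * v z \<partial>lborel)"
      using ipv i0v by simp
    also have "(\<integral>z. \<psi>0 (fst z) * q (snd z) * v z \<partial>lborel) = (\<integral>t. q t * g t \<partial>lborel)"
    proof -
      have "integrable (lborel \<Otimes>\<^sub>M lborel) (\<lambda>(y, t). \<psi>0 y * q t * v (y, t))"
        using i0v by (simp add: lborel_prod case_prod_beta')
      from lborel_pair.integral_snd[OF this] show ?thesis
        by (simp add: lborel_prod case_prod_beta' g_def mult_ac flip: integral_mult_right_zero)
    qed
    also have "?P * (\<integral>t. q t * g t \<partial>lborel) = (\<integral>z. p (fst z) * (q (snd z) * g (snd z)) \<partial>(lborel :: (real\<times>real) measure))"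
      using integrable_prod_mult(2)[OF integrable_test[OF p] integrable_test_mult[OF q g]] by (simp add: mult.commute)
    also have "(\<lambda>z. p (fst z) * (q (snd z) * g (snd z))) =
        (\<lambda>z. p (fst z) * q (snd z) * (indicator {a<..<b} (fst z) * (indicator {c<..<d} (snd z) * g (snd z))))"
      using test_functions_outside[OF p] test_functions_outside[OF q] by (auto simp: fun_eq_iff indicator_def)
    also have "(\<integral>z. p (fst z) * q (snd z) * v z \<partial>lborel) - integral\<^sup>L lborel \<dots> = (\<integral>z. p (fst z) * q (snd z) * h z \<partial>lborel)"
      unfolding h_def right_diff_distrib
      by (rule Bochner_Integration.integral_diff[symmetric, OF ipv]) (rule integrable_test_prod_mult[OF p q ig], simp)
    finally show "(\<integral>z. p (fst z) * q (snd z) * h z \<partial>lborel) = 0" by simp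
  qed
  then have "AE z in lborel. z \<in> {a<..<b} \<times> {c<..<d} \<longrightarrow> v z = g (snd z)"
    by eventually_elim (auto simp: h_def indicator_def)
  with g show thesis by (rule that)
qed

section \<open>Measures as derivatives of their cumulative densities\<close>

lemma weighted_marginal:
  fixes M :: "(real \<times> real) measure" and k :: "real \<Rightarrow> real"
  assumes fin: "finite_measure M" and sets: "sets M = sets borel"
    and k[measurable]: "k \<in> borel_measurable borel" and k01: "\<And>x. 0 \<le> k x" "\<And>x. k x \<le> 1"
  defines "N \<equiv> distr (density M (\<lambda>z. ennreal (k (fst z)))) borel snd"
  shows "finite_measure N" "sets N = sets borel" "space N = UNIV"
    and "\<And>q. q \<in> borel_measurable borel \<Longrightarrow> (\<integral>t. q t \<partial>N) = (\<integral>z. k (fst z) * q (snd z) \<partial>M)"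
    and "\<And>S. S \<in> sets borel \<Longrightarrow> measure N S = (\<integral>z. k (fst z) * indicator S (snd z) \<partial>M)"
proof -
  interpret M: finite_measure M by fact
  have [measurable_cong]: "sets M = sets borel" by fact
  have [measurable]: "snd \<in> M \<rightarrow>\<^sub>M borel" "fst \<in> M \<rightarrow>\<^sub>M borel" by measurable
  show sN: "sets N = sets borel" "space N = UNIV" by (simp_all add: N_def)
  have "emeasure N UNIV = (\<integral>\<^sup>+ z. ennreal (k (fst z)) \<partial>M)"
    unfolding N_def by (subst emeasure_distr) (auto simp: emeasure_density intro!: nn_integral_cong)
  also have "\<dots> \<le> (\<integral>\<^sup>+ z. 1 \<partial>M)" by (intro nn_integral_mono) (simp add: k01)
  also have "\<dots> < \<infinity>" by (simp add: less_top[symmetric])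
  finally show fN: "finite_measure N" by (intro finite_measureI) (simp add: sN)
  show int: "(\<integral>t. q t \<partial>N) = (\<integral>z. k (fst z) * q (snd z) \<partial>M)" if [measurable]: "q \<in> borel_measurable borel" for q
    unfolding N_def by (subst integral_distr, measurable, subst integral_density) (auto simp: k01)
  show "measure N S = (\<integral>z. k (fst z) * indicator S (snd z) \<partial>M)" if [measurable]: "S \<in> sets borel" for S
    using int[of "indicator S"] by (simp add: sN)
qed

lemma slice_marginal:
  fixes M :: "(real \<times> real) measure"
  assumes fin: "finite_measure M" and sets: "sets M = sets borel" and X: "X \<in> sets borel"
  defines "N \<equiv> distr (density M (\<lambda>z. ennreal (indicat_real X (fst z)))) borel snd"
  shows "finite_measure N" "sets N = sets borel" "space N = UNIV"
    and "S \<in> sets borel \<Longrightarrow> emeasure N S = emeasure M (X \<times> S)"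
    and "q \<in> borel_measurable borel \<Longrightarrow> (\<integral>t. q t \<partial>N) = (\<integral>z. indicat_real X (fst z) * q (snd z) \<partial>M)"
proof -
  note N = weighted_marginal[OF fin sets, of "indicat_real X", folded N_def]
  show "finite_measure N" "sets N = sets borel" "space N = UNIV"
    "q \<in> borel_measurable borel \<Longrightarrow> (\<integral>t. q t \<partial>N) = (\<integral>z. indicat_real X (fst z) * q (snd z) \<partial>M)"
    using X by (intro N; simp)+
  show "emeasure N S = emeasure M (X \<times> S)" if "S \<in> sets borel"
  proof -
    have "(\<lambda>z. indicat_real X (fst z) * indicator S (snd z)) = indicat_real (X \<times> S)"
      by (auto simp: indicator_def fun_eq_iff)
    then have "measure N S = measure M (X \<times> S)"
      using N(5)[of S] X that sets_eq_imp_space_eq[OF sets] by simp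
    then show ?thesis
      using \<open>finite_measure N\<close> fin by (simp add: finite_measure.emeasure_eq_measure)
  qed
qed

text \<open>
  For each \<open>y\<close> the part of \<open>M\<close> on the left of \<open>y\<close> has an absolutely continuous second marginal, whose
  density is determined only up to a null set that depends on \<open>y\<close>.  The infimum over the rational
  \<open>q > y\<close> selects versions which are measurable in both variables and monotone in \<open>y\<close> for every \<open>t\<close>.
  They still are densities, for every \<open>y\<close>, because the mass on the left of \<open>q\<close> decreases to the mass on
  the left of \<open>y\<close>.
\<close>

lemma cumulative_density:
  fixes M :: "(real \<times> real) measure"
  assumes fin: "finite_measure M" and sets: "sets M = sets borel"
    and ac: "\<And>S. S \<in> null_sets lborel \<Longrightarrow> S \<in> sets borel \<Longrightarrow> emeasure M (UNIV \<times> S) = 0"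
  obtains f h where "f \<in> borel_measurable borel" "integrable lborel h"
    "\<And>y t. 0 \<le> f (y, t)" "\<And>y t. f (y, t) \<le> h t" "\<And>t. mono (\<lambda>y. f (y, t))"
    "\<And>y q. q \<in> borel_measurable borel \<Longrightarrow>
       (\<integral>z. indicat_real {..y} (fst z) * q (snd z) \<partial>M) = (\<integral>t. f (y, t) * q t \<partial>lborel)"
proof -
  interpret M: finite_measure M by fact
  define N where "N X = distr (density M (\<lambda>z. ennreal (indicat_real X (fst z)))) borel snd" for X :: "real set"
  note N = slice_marginal[OF fin sets, folded N_def]
  define r where "r X = RN_deriv lborel (N X)" for X
  have acN: "absolutely_continuous lborel (N X)" if "X \<in> sets borel" for X
    unfolding absolutely_continuous_def
  proof
    fix S :: "real set" assume S: "S \<in> null_sets lborel"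
    then have "S \<in> sets borel" by auto
    have "emeasure M (X \<times> S) \<le> emeasure M (UNIV \<times> S)"
      by (rule emeasure_mono) (use \<open>S \<in> sets borel\<close> in \<open>auto simp: sets borel_Times\<close>)
    then have "emeasure (N X) S = 0" using N(4)[OF that \<open>S \<in> sets borel\<close>] ac[OF S \<open>S \<in> sets borel\<close>] by simp
    then show "S \<in> null_sets (N X)" using \<open>S \<in> sets borel\<close> N(2)[OF that] by auto
  qed
  have dens: "density lborel (r X) = N X" if "X \<in> sets borel" for X
    unfolding r_def using acN[OF that] N(2)[OF that] by (intro sigma_finite_measure.density_RN_deriv[OF sigma_finite_lborel]) auto
  have [measurable]: "r X \<in> borel_measurable borel" for X
    unfolding r_def using borel_measurable_RN_deriv[of lborel "N X"] by simp
  have nn: "(\<integral>\<^sup>+ t. r X t \<partial>lborel) = emeasure M (X \<times> UNIV)" if "X \<in> sets borel" for X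
    using N(4)[OF that, of UNIV] dens[OF that, symmetric] by (simp add: emeasure_density)
  have fin_r: "AE t in lborel. r X t \<noteq> \<infinity>" if "X \<in> sets borel" for X
    by (rule nn_integral_noteq_infinite) (auto simp: nn[OF that])
  have mono_r: "AE t in lborel. r X t \<le> r Y t" if "X \<in> sets borel" "Y \<in> sets borel" "X \<subseteq> Y" for X Y
  proof -
    have "density lborel (\<lambda>t. r X t + r (Y - X) t) = N Y"
    proof (rule measure_eqI)
      fix S assume "S \<in> sets (density lborel (\<lambda>t. r X t + r (Y - X) t))"
      then have [measurable]: "S \<in> sets borel" by simp
      have "emeasure (density lborel (\<lambda>t. r X t + r (Y - X) t)) S =
          emeasure (density lborel (r X)) S + emeasure (density lborel (r (Y - X))) S"
        by (simp add: emeasure_density nn_integral_add[symmetric] distrib_right)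
      also have "\<dots> = emeasure M (X \<times> S) + emeasure M ((Y - X) \<times> S)"
        using that by (simp add: dens N)
      also have "\<dots> = emeasure M (Y \<times> S)"
        using that by (subst plus_emeasure) (auto simp: sets borel_Times intro!: arg_cong[where f="emeasure M"])
      finally show "emeasure (density lborel (\<lambda>t. r X t + r (Y - X) t)) S = emeasure (N Y) S"
        using that by (simp add: N)
    qed (use N that in auto)
    then have "AE t in lborel. r X t + r (Y - X) t = r Y t"
      unfolding r_def[of Y] by (intro sigma_finite_measure.RN_deriv_unique[OF sigma_finite_lborel]) auto
    then show ?thesis by eventually_elim (metis add_increasing2 order_refl zero_le)
  qed
  define R where "R X t = enn2real (r X t)" for X t
  have [measurable]: "R X \<in> borel_measurable borel" for X unfolding R_def[abs_def] by measurable
  have R0: "0 \<le> R X t" for X t by (simp add: R_def)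
  have R_int: "integrable lborel (R X)" "(\<integral>t. R X t \<partial>lborel) = measure M (X \<times> UNIV)"
    if "X \<in> sets borel" for X
  proof -
    have "(\<integral>\<^sup>+ t. ennreal (R X t) \<partial>lborel) = (\<integral>\<^sup>+ t. r X t \<partial>lborel)"
      by (rule nn_integral_cong_AE) (use fin_r[OF that] in \<open>eventually_elim, simp add: R_def less_top\<close>)
    then have *: "(\<integral>\<^sup>+ t. ennreal (R X t) \<partial>lborel) = ennreal (measure M (X \<times> UNIV))"
      using nn[OF that] by (simp add: M.emeasure_eq_measure)
    show "integrable lborel (R X)"
      by (rule integrableI_nonneg) (use * R0 in auto)
    show "(\<integral>t. R X t \<partial>lborel) = measure M (X \<times> UNIV)"
      using * by (subst integral_eq_nn_integral) (use R0 in auto)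
  qed
  have mono_R: "AE t in lborel. R X t \<le> R Y t" if "X \<in> sets borel" "Y \<in> sets borel" "X \<subseteq> Y" for X Y
    using mono_r[OF that] fin_r[OF that(2)]
    by eventually_elim (auto simp: R_def less_top intro!: enn2real_mono)
  define h where "h = R UNIV"
  \<comment> \<open>With \<open>h t\<close> as the value for \<open>q \<le> y\<close>, all rationals are admissible in the infimum: it is then monotone
    in \<open>y\<close>, bounded and measurable without any exceptional set.\<close>
  define s where "s q y t = (if y < q then min (R {..q} t) (h t) else h t)" for q y t
  define f where "f = (\<lambda>(y, t). INF q\<in>\<rat>. s q y t)"
  have s: "0 \<le> s q y t" "s q y t \<le> h t" for q y t by (auto simp: s_def R0 h_def)
  have bdd: "bdd_below ((\<lambda>q. s q y t) ` \<rat>)" for y t using s(1) by (auto intro!: bdd_belowI[of _ 0])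
  have ne: "\<rat> \<noteq> ({} :: real set)" using Rats_0 by blast
  have f0: "0 \<le> f (y, t)" for y t unfolding f_def using s(1) ne by (auto intro!: cINF_greatest)
  have fs: "f (y, t) \<le> s q y t" if "q \<in> \<rat>" for y t q
    unfolding f_def using bdd that by (auto intro!: cINF_lower)
  have fh: "f (y, t) \<le> h t" for y t using fs[OF Rats_0] s(2) order_trans by blast
  have f_mono: "mono (\<lambda>y. f (y, t))" for t
  proof
    fix y y' :: real assume "y \<le> y'"
    then have "s q y t \<le> s q y' t" for q by (auto simp: s_def)
    then show "f (y, t) \<le> f (y', t)" unfolding f_def using ne bdd by (auto intro!: cINF_mono)
  qed
  have f_borel[measurable]: "f \<in> borel_measurable borel"
  proof -
    have "(\<lambda>z::real\<times>real. INF q\<in>\<rat>. s q (fst z) (snd z)) \<in> borel_measurable borel"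
    proof (rule borel_measurable_cINF)
      show "(\<lambda>z. s q (fst z) (snd z)) \<in> borel_measurable borel" for q
        unfolding s_def h_def by measurable
    qed (use bdd countable_rat in auto)
    then show ?thesis by (simp add: f_def case_prod_beta')
  qed
  have fR: "AE t in lborel. f (y, t) = R {..y} t" for y
  proof -
    have "AE t in lborel. \<forall>q\<in>\<rat>. y < q \<longrightarrow> R {..y} t \<le> R {..q} t"
      unfolding AE_ball_countable[OF countable_rat] by (auto intro!: mono_R)
    moreover have "AE t in lborel. R {..y} t \<le> h t" unfolding h_def by (intro mono_R) auto
    ultimately have ge: "AE t in lborel. R {..y} t \<le> f (y, t)"
    proof eventually_elim
      case (elim t)
      then have "R {..y} t \<le> s q y t" if "q \<in> \<rat>" for q using that by (auto simp: s_def)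
      then show ?case unfolding f_def prod.case by (rule cINF_greatest[OF ne])
    qed
    have i: "integrable lborel (\<lambda>t. f (y, t))"
      by (rule Bochner_Integration.integrable_bound[OF R_int(1)[of UNIV]])
        (use fh f0 in \<open>auto simp: h_def R0\<close>)
    \<comment> \<open>The reverse inequality is obtained from total masses, by right continuity in \<open>y\<close>.\<close>
    have le: "(\<integral>t. f (y, t) \<partial>lborel) \<le> measure M ({..q} \<times> UNIV)" if "q \<in> \<rat>" "y < q" for q
      unfolding R_int(2)[of "{..q}", simplified, symmetric]
      by (rule integral_mono[OF i R_int(1)]) (use fs[OF that(1), of y] that(2) in \<open>auto simp: s_def\<close>)
    have "(\<integral>t. f (y, t) \<partial>lborel) \<le> measure M ({..y} \<times> UNIV)"
    proof (rule LIMSEQ_le_const)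
      have "(\<lambda>n. measure M ({..y + 1 / real (Suc n)} \<times> UNIV)) \<longlonglongrightarrow> measure M (\<Inter>n. {..y + 1 / real (Suc n)} \<times> UNIV)"
        by (rule M.finite_Lim_measure_decseq)
          (auto simp: sets borel_Times decseq_def frac_le intro: order_trans[OF _ add_left_mono])
      moreover have "(\<Inter>n. {..y + 1 / real (Suc n)} \<times> UNIV) = {..y} \<times> (UNIV :: real set)"
      proof -
        have "x \<le> y" if "\<forall>n. x \<le> y + 1 / real (Suc n)" for x
          using that by (metis LIMSEQ_inverse_real_of_nat_add LIMSEQ_le_const inverse_eq_divide)
        then show ?thesis by (auto intro: add_increasing2)
      qed
      ultimately show "(\<lambda>n. measure M ({..y + 1 / real (Suc n)} \<times> UNIV)) \<longlonglongrightarrow> measure M ({..y} \<times> UNIV)" by simp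
      have "(\<integral>t. f (y, t) \<partial>lborel) \<le> measure M ({..y + 1 / real (Suc n)} \<times> UNIV)" for n
      proof -
        obtain q where q: "q \<in> \<rat>" "y < q" "q < y + 1 / real (Suc n)"
          using Rats_dense_in_real[of y "y + 1 / real (Suc n)"] by auto
        have "measure M ({..q} \<times> UNIV) \<le> measure M ({..y + 1 / real (Suc n)} \<times> UNIV)"
          using q by (intro M.finite_measure_mono) (auto simp: sets borel_Times)
        then show ?thesis using le[OF q(1,2)] by linarith
      qed
      then show "\<exists>N. \<forall>n\<ge>N. (\<integral>t. f (y, t) \<partial>lborel) \<le> measure M ({..y + 1 / real (Suc n)} \<times> UNIV)" by blast
    qed
    moreover have "(\<integral>t. R {..y} t \<partial>lborel) \<le> (\<integral>t. f (y, t) \<partial>lborel)"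
      by (rule integral_mono_AE[OF R_int(1) i ge]) simp
    ultimately have "(\<integral>t. f (y, t) - R {..y} t \<partial>lborel) = 0"
      using i R_int[of "{..y}"] by simp
    then have "AE t in lborel. f (y, t) - R {..y} t = 0"
      using i R_int[of "{..y}"] ge by (subst (asm) integral_nonneg_eq_0_iff_AE) auto
    then show ?thesis by eventually_elim simp
  qed
  show thesis
  proof (rule that[of f h])
    show "integrable lborel h" unfolding h_def by (rule R_int) simp
    fix y :: real and q :: "real \<Rightarrow> real" assume [measurable]: "q \<in> borel_measurable borel"
    have Y: "{..y} \<in> sets borel" by simp
    have "AE t in lborel. r {..y} t = ennreal (f (y, t))"
      using fR[of y] fin_r[OF Y] by eventually_elim (simp add: R_def less_top)
    then have "density lborel (r {..y}) = density lborel (\<lambda>t. ennreal (f (y, t)))"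
      by (intro density_cong) auto
    then have "N {..y} = density lborel (\<lambda>t. ennreal (f (y, t)))" using dens[OF Y] by simp
    then have "(\<integral>t. q t \<partial>N {..y}) = (\<integral>t. f (y, t) *\<^sub>R q t \<partial>lborel)"
      using f0 by (simp add: integral_density)
    then show "(\<integral>z. indicat_real {..y} (fst z) * q (snd z) \<partial>M) = (\<integral>t. f (y, t) * q t \<partial>lborel)"
      using N(5)[OF Y, of q] by simp
  qed (use f0 fh f_mono f_borel in auto)
qed

text \<open>
  Insert \<open>p x = - \<integral> indicator {x..} y * deriv p y\<close> and exchange the integrals: in the sense of
  distributions, \<open>M\<close> is the derivative of \<open>f\<close> with respect to the first variable.
\<close>

lemma cumulative_density_test:
  fixes M :: "(real \<times> real) measure"
  assumes fin: "finite_measure M" and sets: "sets M = sets borel"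
    and f: "f \<in> borel_measurable borel" "\<And>y t. 0 \<le> f (y, t)" "\<And>y t. f (y, t) \<le> h t"
    and h: "integrable lborel h"
    and cum: "\<And>y q. q \<in> borel_measurable borel \<Longrightarrow>
       (\<integral>z. indicat_real {..y} (fst z) * q (snd z) \<partial>M) = (\<integral>t. f (y, t) * q t \<partial>lborel)"
    and p: "p \<in> test_functions {a<..<b}" and q: "q \<in> test_functions {c<..<d}"
  shows "integrable lborel (\<lambda>z. deriv p (fst z) * q (snd z) * f z)"
    and "(\<integral>z. p (fst z) * q (snd z) \<partial>M) = - (\<integral>z. deriv p (fst z) * q (snd z) * f z \<partial>lborel)"
proof -
  interpret M: finite_measure M by fact
  interpret P: pair_sigma_finite M "lborel :: real measure" by standard
  have [measurable_cong]: "sets M = sets borel" by fact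
  note p' = test_functions_deriv[OF p]
  have [measurable]: "p \<in> borel_measurable borel" "q \<in> borel_measurable borel" "deriv p \<in> borel_measurable borel"
    "f \<in> borel_measurable borel" "h \<in> borel_measurable borel"
    using test_functions_borel[OF p] test_functions_borel[OF q] test_functions_borel[OF p'(2)] f h by auto
  obtain C where C: "\<And>x. \<bar>q x\<bar> \<le> C" "C \<ge> 0" using test_functions_bounded[OF q] by metis
  have ip: "integrable lborel (\<lambda>y. C * \<bar>deriv p y\<bar>)" using integrable_test[OF p'(2)] by simp
  show i: "integrable lborel (\<lambda>z. deriv p (fst z) * q (snd z) * f z)"
  proof (rule Bochner_Integration.integrable_bound[OF integrable_prod_mult(1)[OF ip h]])
    have "\<bar>deriv p y\<bar> * \<bar>q t\<bar> * \<bar>f (y, t)\<bar> \<le> \<bar>deriv p y\<bar> * C * h t" for y t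
      using C f by (intro mult_mono) auto
    moreover have "0 \<le> h t" for t using f(2,3) order_trans by blast
    ultimately show "AE z in lborel. norm (deriv p (fst z) * q (snd z) * f z) \<le> norm (C * \<bar>deriv p (fst z)\<bar> * h (snd z))"
      using C by (auto simp: abs_mult mult_ac)
  qed simp
  define G where "G z y = indicat_real {..y} (fst z) * (deriv p y * q (snd z))" for z :: "real \<times> real" and y
  have [measurable]: "(\<lambda>(z, y). indicat_real {..y} (fst z)) \<in> borel_measurable (M \<Otimes>\<^sub>M lborel)"
  proof -
    have *: "(\<lambda>(z :: real \<times> real, y). indicat_real {..y} (fst z)) = (\<lambda>x. if fst (fst x) \<le> snd x then 1 else 0)"
      by (auto simp: fun_eq_iff indicator_def)
    show ?thesis unfolding * by measurable
  qed
  have Gm: "case_prod G \<in> borel_measurable (M \<Otimes>\<^sub>M lborel)" unfolding G_def by measurable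
  have iC: "integrable (M \<Otimes>\<^sub>M lborel) (\<lambda>(z, y). C * \<bar>deriv p y\<bar>)"
    using ip by (intro P.Fubini_integrable) auto
  have iG: "integrable (M \<Otimes>\<^sub>M lborel) (case_prod G)"
  proof (rule Bochner_Integration.integrable_bound[OF iC Gm])
    have "\<bar>deriv p y\<bar> * \<bar>q t\<bar> \<le> C * \<bar>deriv p y\<bar>" for y t
      using mult_left_mono[OF C(1), of "\<bar>deriv p y\<bar>" t] by (simp add: mult.commute)
    then show "AE x in M \<Otimes>\<^sub>M lborel. norm (case_prod G x) \<le> norm (case x of (z, y) \<Rightarrow> C * \<bar>deriv p y\<bar>)"
      using C(2) by (auto simp: G_def abs_mult indicator_def)
  qed
  have "(\<integral>z. \<integral>y. G z y \<partial>lborel \<partial>M) = (\<integral>z. - (p (fst z) * q (snd z)) \<partial>M)"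
  proof (rule Bochner_Integration.integral_cong)
    fix z :: "real \<times> real"
    have "(\<integral>y. G z y \<partial>lborel) = (\<integral>y. q (snd z) * (indicator {fst z..} y * deriv p y) \<partial>lborel)"
      by (rule Bochner_Integration.integral_cong) (auto simp: G_def indicator_def)
    then show "(\<integral>y. G z y \<partial>lborel) = - (p (fst z) * q (snd z))"
      using test_function_tail_integral[OF p, of "fst z"] by simp
  qed simp
  moreover have "(\<integral>y. \<integral>z. G z y \<partial>M \<partial>lborel) = (\<integral>z. deriv p (fst z) * q (snd z) * f z \<partial>lborel)"
  proof -
    have "(\<integral>z. G z y \<partial>M) = (\<integral>t. deriv p y * q t * f (y, t) \<partial>lborel)" for y
      using cum[of "\<lambda>t. deriv p y * q t" y] by (simp add: G_def mult_ac)
    moreover have "(\<integral>y. \<integral>t. deriv p y * q t * f (y, t) \<partial>lborel \<partial>lborel) = (\<integral>z. deriv p (fst z) * q (snd z) * f z \<partial>lborel)"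
      using lborel_pair.integral_fst'[of "\<lambda>z. deriv p (fst z) * q (snd z) * f z"] i by (simp add: lborel_prod)
    ultimately show ?thesis by simp
  qed
  ultimately show "(\<integral>z. p (fst z) * q (snd z) \<partial>M) = - (\<integral>z. deriv p (fst z) * q (snd z) * f z \<partial>lborel)"
    using P.Fubini_integral[OF iG] by simp
qed

section \<open>Slices of functions whose spatial derivative is a measure\<close>

text \<open>
  For a fixed \<open>p\<close> the weak identity says that the second marginals of \<open>M1\<close> and \<open>M2\<close>, weighted by \<open>p\<close>,
  differ by an absolutely continuous measure.  So they agree on null sets of times, and \<open>p\<close> may tend
  to the indicator of an interval.
\<close>

lemma x_derivative_marginals_agree:
  fixes w :: "real \<times> real \<Rightarrow> real" and M1 M2 :: "(real \<times> real) measure"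
  assumes w: "integrable lborel w" "\<And>z. z \<notin> {a<..<b} \<times> {c<..<d} \<Longrightarrow> w z = 0"
    and fin: "finite_measure M1" "finite_measure M2"
    and sets: "sets M1 = sets borel" "sets M2 = sets borel"
    and conc: "emeasure M1 (- ({a<..<b} \<times> {c<..<d})) = 0" "emeasure M2 (- ({a<..<b} \<times> {c<..<d})) = 0"
    and weak: "\<And>p q. p \<in> test_functions {a<..<b} \<Longrightarrow> q \<in> test_functions {c<..<d} \<Longrightarrow>
      (\<integral>z. deriv p (fst z) * q (snd z) * w z \<partial>lborel) =
      (\<integral>z. p (fst z) * q (snd z) \<partial>M2) - (\<integral>z. p (fst z) * q (snd z) \<partial>M1)"
    and S: "S \<in> null_sets lborel" "S \<in> sets borel" and sub: "{\<alpha><..<\<beta>} \<subseteq> {a<..<b}"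
  shows "measure M1 ({\<alpha><..<\<beta>} \<times> S) = measure M2 ({\<alpha><..<\<beta>} \<times> S)"
proof -
  interpret M1: finite_measure M1 by fact
  interpret M2: finite_measure M2 by fact
  have [measurable_cong]: "sets M1 = sets borel" "sets M2 = sets borel" by fact+
  have sp: "space M1 = UNIV" "space M2 = UNIV"
    using sets_eq_imp_space_eq[OF sets(1)] sets_eq_imp_space_eq[OF sets(2)] by auto
  have [measurable]: "S \<in> sets borel" "w \<in> borel_measurable borel" using S w by auto
  have eq: "(\<integral>z. p (fst z) * indicator S (snd z) \<partial>M1) = (\<integral>z. p (fst z) * indicator S (snd z) \<partial>M2)"
    if p: "p \<in> test_functions {a<..<b}" and p01: "\<And>x. 0 \<le> p x" "\<And>x. p x \<le> 1" for p
  proof -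
    have [measurable]: "p \<in> borel_measurable borel" using test_functions_borel[OF p] .
    note N1 = weighted_marginal[of M1 p, OF fin(1) sets(1) test_functions_borel[OF p] p01]
    note N2 = weighted_marginal[of M2 p, OF fin(2) sets(2) test_functions_borel[OF p] p01]
    let ?N1 = "distr (density M1 (\<lambda>z. ennreal (p (fst z)))) borel snd"
    let ?N2 = "distr (density M2 (\<lambda>z. ennreal (p (fst z)))) borel snd"
    interpret N1: finite_measure ?N1 by (rule N1)
    interpret N2: finite_measure ?N2 by (rule N2)
    obtain C where C: "\<And>x. \<bar>deriv p x\<bar> \<le> C" "C \<ge> 0"
      using test_functions_bounded[OF test_functions_deriv(2)[OF p]] by metis
    have [measurable]: "deriv p \<in> borel_measurable borel"
      using test_functions_borel[OF test_functions_deriv(2)[OF p]] .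
    define h where "h t = (\<integral>y. - (deriv p y * w (y, t)) \<partial>lborel)" for t
    have iw: "integrable (lborel \<Otimes>\<^sub>M lborel) (\<lambda>(y, t). - (deriv p y * w (y, t)))"
    proof -
      have "integrable lborel (\<lambda>z. - (deriv p (fst z) * w z))"
        by (rule Bochner_Integration.integrable_bound[of _ "\<lambda>z. C * w z"])
          (use w C in \<open>auto simp: abs_mult intro!: mult_right_mono\<close>)
      then show ?thesis by (simp add: lborel_prod case_prod_beta')
    qed
    have h: "integrable lborel h" unfolding h_def using lborel_pair.integrable_snd[OF iw] .
    have "measure ?N1 S - measure ?N2 S = (LINT t:S|lborel. h t)"
    proof (rule signed_measure_eqI_test[of _ _ c d, OF _ _ _ _ _ _ _ h _ S(2)])
      show "finite_measure ?N1" "finite_measure ?N2" by (rule N1) (rule N2)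
      have "AE z in M1. z \<in> {a<..<b} \<times> {c<..<d}" "AE z in M2. z \<in> {a<..<b} \<times> {c<..<d}"
        using conc borel_comp[OF borel_Times[of "{a<..<b}" "{c<..<d}"]]
        by (auto intro!: AE_I[where N="- ({a<..<b} \<times> {c<..<d})"] simp: sets sp)
      then have "AE z in M1. p (fst z) * indicator (- {c<..<d}) (snd z) = 0" "AE z in M2. p (fst z) * indicator (- {c<..<d}) (snd z) = 0"
        by (auto elim!: eventually_mono)
      then have "measure ?N1 (- {c<..<d}) = 0" "measure ?N2 (- {c<..<d}) = 0"
        using N1(5)[of "- {c<..<d}"] N2(5)[of "- {c<..<d}"] by (simp_all add: integral_eq_zero_AE)
      then show "emeasure ?N1 (- {c<..<d}) = 0" "emeasure ?N2 (- {c<..<d}) = 0"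
        by (simp_all add: N1.emeasure_eq_measure N2.emeasure_eq_measure)
      show "h t = 0" if "t \<notin> {c<..<d}" for t unfolding h_def using w(2) that by simp
      fix q assume q: "q \<in> test_functions {c<..<d}"
      have [measurable]: "q \<in> borel_measurable borel" using test_functions_borel[OF q] .
      have "(\<integral>t. q t \<partial>?N1) - (\<integral>t. q t \<partial>?N2) = - (\<integral>z. deriv p (fst z) * q (snd z) * w z \<partial>lborel)"
        unfolding weak[OF p q] using N1(4)[of q] N2(4)[of q] by simp
      also have "\<dots> = (\<integral>z. (case z of (y, t) \<Rightarrow> - (deriv p y * q t * w (y, t))) \<partial>(lborel \<Otimes>\<^sub>M lborel))"
        by (simp add: lborel_prod case_prod_beta')
      also have "\<dots> = (\<integral>t. \<integral>y. - (deriv p y * q t * w (y, t)) \<partial>lborel \<partial>lborel)"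
      proof (rule lborel_pair.integral_snd[symmetric])
        show "integrable (lborel \<Otimes>\<^sub>M lborel) (\<lambda>(y, t). - (deriv p y * q t * w (y, t)))"
          using integrable_test_prod_mult[OF test_functions_deriv(2)[OF p] q w(1)] by (simp add: lborel_prod case_prod_beta')
      qed
      also have "\<dots> = (\<integral>t. q t * h t \<partial>lborel)"
      proof (rule Bochner_Integration.integral_cong)
        fix t
        have "(\<integral>y. - (deriv p y * q t * w (y, t)) \<partial>lborel) = (\<integral>y. q t * - (deriv p y * w (y, t)) \<partial>lborel)"
          by (simp add: mult_ac)
        also have "\<dots> = q t * h t" unfolding h_def by (rule integral_mult_right_zero)
        finally show "(\<integral>y. - (deriv p y * q t * w (y, t)) \<partial>lborel) = q t * h t" .
      qed simp
      finally show "(\<integral>t. q t \<partial>?N1) - (\<integral>t. q t \<partial>?N2) = (\<integral>t. q t * h t \<partial>lborel)" .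
    qed simp_all
    also have "(LINT t:S|lborel. h t) = 0"
      unfolding set_lebesgue_integral_def
      by (rule integral_eq_zero_AE) (use AE_not_in[OF S(1)] in \<open>eventually_elim, auto\<close>)
    finally show ?thesis using N1(5)[of S] N2(5)[of S] S(2) by simp
  qed
  have eq': "(\<integral>z. cutoff \<alpha> \<beta> (real (Suc n)) (fst z) * indicator S (snd z) \<partial>M1) =
    (\<integral>z. cutoff \<alpha> \<beta> (real (Suc n)) (fst z) * indicator S (snd z) \<partial>M2)" for n
    by (rule eq[OF test_functions_mono[OF cutoff_test sub] cutoff_range]) simp
  have iS: "integrable M1 (\<lambda>z. indicat_real S (snd z))" "integrable M2 (\<lambda>z. indicat_real S (snd z))"
    by (auto intro!: M1.integrable_const_bound[of _ 1] M2.integrable_const_bound[of _ 1])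
  have "(\<integral>z. indicator {\<alpha><..<\<beta>} (fst z) * indicator S (snd z) \<partial>M1) = (\<integral>z. indicator {\<alpha><..<\<beta>} (fst z) * indicat_real S (snd z) \<partial>M2)"
    by (rule LIMSEQ_unique[OF cutoff_integral_tendsto[OF _ iS(1), of fst \<alpha> \<beta>, unfolded eq'] cutoff_integral_tendsto[OF _ iS(2)]])
      measurable
  moreover have "(\<lambda>z. indicator {\<alpha><..<\<beta>} (fst z) * indicator S (snd z)) = indicat_real ({\<alpha><..<\<beta>} \<times> S)"
    by (auto simp: indicator_def fun_eq_iff)
  ultimately show ?thesis by (simp add: sp)
qed

text \<open>
  The horizontal lines at a null set of times carry no mass of the derivative: on their union the
  mutually singular measures \<open>M1\<close> and \<open>M2\<close> coincide, hence both vanish.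
\<close>

lemma x_derivative_marginal_null:
  fixes M1 M2 :: "(real \<times> real) measure"
  assumes fin: "finite_measure M1" "finite_measure M2"
    and sets: "sets M1 = sets borel" "sets M2 = sets borel"
    and conc: "emeasure M1 (- ({a<..<b} \<times> {c<..<d})) = 0" "emeasure M2 (- ({a<..<b} \<times> {c<..<d})) = 0"
    and singular: "A \<in> sets borel" "emeasure M1 (- A) = 0" "emeasure M2 A = 0"
    and agree: "\<And>S \<alpha> \<beta>. S \<in> null_sets lborel \<Longrightarrow> S \<in> sets borel \<Longrightarrow> {\<alpha><..<\<beta>} \<subseteq> {a<..<b} \<Longrightarrow>
      measure M1 ({\<alpha><..<\<beta>} \<times> S) = measure M2 ({\<alpha><..<\<beta>} \<times> S)"
    and S: "S \<in> null_sets lborel" "S \<in> sets borel"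
  shows "emeasure M1 (UNIV \<times> S) = 0" "emeasure M2 (UNIV \<times> S) = 0"
proof -
  interpret M1: finite_measure M1 by fact
  interpret M2: finite_measure M2 by fact
  let ?T = "(UNIV :: real set) \<times> S"
  have T[simp]: "?T \<in> sets borel" using S(2) by (simp add: borel_Times)
  define K1 K2 where "K1 = density M1 (indicator ?T)" and "K2 = density M2 (indicator ?T)"
  have K: "emeasure K1 X = emeasure M1 (?T \<inter> X)" "emeasure K2 X = emeasure M2 (?T \<inter> X)" if "X \<in> sets borel" for X
    using that by (simp_all add: K1_def K2_def emeasure_restricted sets)
  have sK: "sets K1 = sets borel" "sets K2 = sets borel" by (simp_all add: K1_def K2_def sets)
  have spK: "space K1 = UNIV" "space K2 = UNIV"
    using sets_eq_imp_space_eq[OF sK(1)] sets_eq_imp_space_eq[OF sK(2)] by auto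
  have fK: "finite_measure K1" "finite_measure K2"
    using K[of UNIV] by (auto intro!: finite_measureI simp: spK)
  have Km: "measure K1 X = measure M1 (?T \<inter> X)" "measure K2 X = measure M2 (?T \<inter> X)" if "X \<in> sets borel" for X
    using K[OF that] by (simp_all add: measure_def)
  have box: "box (\<alpha>, \<gamma>) (\<beta>, \<delta>) = {\<alpha><..<\<beta>} \<times> {\<gamma><..<\<delta>}" for \<alpha> \<beta> \<gamma> \<delta> :: real
    by (auto simp: box_def Basis_prod_def)
  have B: "{a<..<b} \<times> {c<..<d} \<in> sets borel" by (simp add: borel_Times)
  have eq: "measure K1 X = measure K2 X" if X: "X \<in> sets borel" for X
  proof -
    have "measure K1 X - measure K2 X = (LINT z:X|lborel. 0)"
    proof (rule signed_measure_eqI_box[OF fK sK sets_lborel _ _ _ _ _ X, of "(a, c)" "(b, d)"])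
      have "emeasure K1 (- ({a<..<b} \<times> {c<..<d})) \<le> emeasure M1 (- ({a<..<b} \<times> {c<..<d}))"
        "emeasure K2 (- ({a<..<b} \<times> {c<..<d})) \<le> emeasure M2 (- ({a<..<b} \<times> {c<..<d}))"
        using B by (auto simp: K sets intro!: emeasure_mono)
      then show "emeasure K1 (- box (a, c) (b, d)) = 0" "emeasure K2 (- box (a, c) (b, d)) = 0"
        using conc by (simp_all add: box)
      fix x y :: "real \<times> real" assume sub: "box x y \<subseteq> box (a, c) (b, d)"
      obtain \<alpha> \<gamma> \<beta> \<delta> where xy: "x = (\<alpha>, \<gamma>)" "y = (\<beta>, \<delta>)" by (metis surj_pair)
      have "measure K1 (box x y) = measure K2 (box x y)"
      proof (cases "box x y = {}")
        case False
        then have "{\<alpha><..<\<beta>} \<subseteq> {a<..<b}" using sub unfolding xy box by (auto simp: times_subset_iff)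
        moreover have "S \<inter> {\<gamma><..<\<delta>} \<in> null_sets lborel" "S \<inter> {\<gamma><..<\<delta>} \<in> sets borel"
          using S null_set_Int2[OF S(1), of "{\<gamma><..<\<delta>}"] by auto
        ultimately have "measure M1 ({\<alpha><..<\<beta>} \<times> (S \<inter> {\<gamma><..<\<delta>})) = measure M2 ({\<alpha><..<\<beta>} \<times> (S \<inter> {\<gamma><..<\<delta>}))"
          using agree by blast
        moreover have "?T \<inter> ({\<alpha><..<\<beta>} \<times> {\<gamma><..<\<delta>}) = {\<alpha><..<\<beta>} \<times> (S \<inter> {\<gamma><..<\<delta>})" by auto
        ultimately show ?thesis unfolding xy box by (simp add: Km borel_Times)
      qed simp
      then show "measure K1 (box x y) - measure K2 (box x y) = (LINT z:box x y|lborel. 0)" by simp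
    qed simp_all
    then show ?thesis by simp
  qed
  have A: "- A \<in> sets borel" using singular(1) by auto
  have "emeasure K2 A \<le> emeasure M2 A" "emeasure K1 (- A) \<le> emeasure M1 (- A)"
    using singular(1) A by (auto simp: K sets intro!: emeasure_mono)
  then have 0: "emeasure K2 A = 0" "emeasure K1 (- A) = 0" using singular by simp_all
  then have "emeasure K1 A = 0" "emeasure K2 (- A) = 0"
    using eq[OF singular(1)] eq[OF A] fK by (simp_all add: finite_measure.emeasure_eq_measure)
  then have "emeasure K1 (A \<union> - A) \<le> 0" "emeasure K2 (A \<union> - A) \<le> 0"
    using 0 singular(1) A emeasure_subadditive[of A K1 "- A"] emeasure_subadditive[of A K2 "- A"] sK by simp_all
  then show "emeasure M1 (UNIV \<times> S) = 0" "emeasure M2 (UNIV \<times> S) = 0"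
    using K[of UNIV] by simp_all
qed

text \<open>
  The cumulative densities of \<open>M1\<close> and \<open>M2\<close> are functions with these \<open>x\<close>-derivatives.  Therefore \<open>w\<close> minus
  their difference has \<open>x\<close>-derivative zero and is a function of \<open>t\<close> alone.  This is the slicing property
  of functions of bounded variation, together with a bound that is integrable in \<open>t\<close>.
\<close>

lemma x_derivative_slices:
  fixes w :: "real \<times> real \<Rightarrow> real" and M1 M2 :: "(real \<times> real) measure"
  assumes "a < b"
    and w: "integrable lborel w" "\<And>z. z \<notin> {a<..<b} \<times> {c<..<d} \<Longrightarrow> w z = 0"
    and fin: "finite_measure M1" "finite_measure M2"
    and sets: "sets M1 = sets borel" "sets M2 = sets borel"
    and conc: "emeasure M1 (- ({a<..<b} \<times> {c<..<d})) = 0" "emeasure M2 (- ({a<..<b} \<times> {c<..<d})) = 0"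
    and singular: "A \<in> sets borel" "emeasure M1 (- A) = 0" "emeasure M2 A = 0"
    and weak: "\<And>p q. p \<in> test_functions {a<..<b} \<Longrightarrow> q \<in> test_functions {c<..<d} \<Longrightarrow>
      (\<integral>z. deriv p (fst z) * q (snd z) * w z \<partial>lborel) =
      (\<integral>z. p (fst z) * q (snd z) \<partial>M2) - (\<integral>z. p (fst z) * q (snd z) \<partial>M1)"
  obtains f1 f2 g h where "\<And>t. mono (\<lambda>y. f1 (y, t) :: real)" "\<And>t. mono (\<lambda>y. f2 (y, t) :: real)"
    "integrable lborel g" "integrable lborel h" "\<And>z. \<bar>f1 z\<bar> + \<bar>f2 z\<bar> \<le> h (snd z)"
    "AE z in lborel. z \<in> {a<..<b} \<times> {c<..<d} \<longrightarrow> w z = g (snd z) + f1 z - f2 z"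
proof -
  have agree: "measure M1 ({\<alpha><..<\<beta>} \<times> S) = measure M2 ({\<alpha><..<\<beta>} \<times> S)"
    if "S \<in> null_sets lborel" "S \<in> sets borel" "{\<alpha><..<\<beta>} \<subseteq> {a<..<b}" for S \<alpha> \<beta>
    by (rule x_derivative_marginals_agree[OF w fin sets conc _ that]) (auto intro: weak)
  have null: "emeasure M1 (UNIV \<times> S) = 0" "emeasure M2 (UNIV \<times> S) = 0"
    if "S \<in> null_sets lborel" "S \<in> sets borel" for S
    by (rule x_derivative_marginal_null[OF fin sets conc singular _ that], rule agree; assumption)+
  obtain f1 h1 where f1: "f1 \<in> borel_measurable borel" "integrable lborel h1"
    "\<And>y t. 0 \<le> f1 (y, t)" "\<And>y t. f1 (y, t) \<le> h1 t" "\<And>t. mono (\<lambda>y. f1 (y, t))"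
    "\<And>y q. q \<in> borel_measurable borel \<Longrightarrow>
       (\<integral>z. indicat_real {..y} (fst z) * q (snd z) \<partial>M1) = (\<integral>t. f1 (y, t) * q t \<partial>lborel)"
    by (rule cumulative_density[OF fin(1) sets(1) null(1)]) auto
  obtain f2 h2 where f2: "f2 \<in> borel_measurable borel" "integrable lborel h2"
    "\<And>y t. 0 \<le> f2 (y, t)" "\<And>y t. f2 (y, t) \<le> h2 t" "\<And>t. mono (\<lambda>y. f2 (y, t))"
    "\<And>y q. q \<in> borel_measurable borel \<Longrightarrow>
       (\<integral>z. indicat_real {..y} (fst z) * q (snd z) \<partial>M2) = (\<integral>t. f2 (y, t) * q t \<partial>lborel)"
    by (rule cumulative_density[OF fin(2) sets(2) null(2)]) auto
  note t1 = cumulative_density_test[where a=a and b=b and c=c and d=d, OF fin(1) sets(1) f1(1,3,4,2), OF f1(6)]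
  note t2 = cumulative_density_test[where a=a and b=b and c=c and d=d, OF fin(2) sets(2) f2(1,3,4,2), OF f2(6)]
  have [measurable]: "f1 \<in> borel_measurable borel" "f2 \<in> borel_measurable borel"
    "h1 \<in> borel_measurable borel" "h2 \<in> borel_measurable borel" using f1 f2 by auto
  let ?B = "{a<..<b} \<times> {c<..<d}"
  have [measurable]: "?B \<in> sets borel" by (simp add: borel_Times)
  define v where "v z = w z + indicator ?B z * (f2 z - f1 z)" for z
  have iv: "integrable lborel v"
    unfolding v_def
  proof (rule Bochner_Integration.integrable_add[OF w(1)])
    have "integrable lborel (\<lambda>t. h1 t + h2 t)" using f1 f2 by simp
    from integrable_prod_mult(1)[OF integrable_indicator_Ioo[of a b] this]
    show "integrable lborel (\<lambda>z. indicat_real ?B z * (f2 z - f1 z))"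
    proof (rule Bochner_Integration.integrable_bound)
      have "\<bar>f2 (y, t) - f1 (y, t)\<bar> \<le> \<bar>h1 t + h2 t\<bar>" for y t
        using f1(3,4)[of y t] f2(3,4)[of y t] by linarith
      then show "AE z in lborel. norm (indicat_real ?B z * (f2 z - f1 z)) \<le>
         norm (indicat_real {a<..<b} (fst z) * (h1 (snd z) + h2 (snd z)))"
        by (auto simp: indicator_def)
    qed measurable
  qed
  have v0: "v z = 0" if "z \<notin> ?B" for z using w(2)[OF that] that by (simp add: v_def)
  have "(\<integral>z. deriv p (fst z) * q (snd z) * v z \<partial>lborel) = 0"
    if p: "p \<in> test_functions {a<..<b}" and q: "q \<in> test_functions {c<..<d}" for p q
  proof -
    have "deriv p (fst z) * q (snd z) * v z = deriv p (fst z) * q (snd z) * w z +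
        deriv p (fst z) * q (snd z) * f2 z - deriv p (fst z) * q (snd z) * f1 z" for z
      using test_functions_outside[OF test_functions_deriv(2)[OF p], of "fst z"] test_functions_outside[OF q, of "snd z"]
      by (cases z) (auto simp: v_def indicator_def algebra_simps)
    moreover have "integrable lborel (\<lambda>z. deriv p (fst z) * q (snd z) * w z)"
      using integrable_test_prod_mult[OF test_functions_deriv(2)[OF p] q w(1)] by simp
    ultimately show ?thesis
      using t1[OF _ p q] t2[OF _ p q] weak[OF p q] by simp
  qed
  then obtain g where g: "integrable lborel g" "AE z in lborel. z \<in> ?B \<longrightarrow> v z = g (snd z)"
    using AE_independent_of_first[OF \<open>a < b\<close> iv, of c d] v0 by blast
  show thesis
  proof (rule that[of f1 f2 g "\<lambda>t. h1 t + h2 t"])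
    show "\<bar>f1 z\<bar> + \<bar>f2 z\<bar> \<le> h1 (snd z) + h2 (snd z)" for z
      using f1(3,4)[of "fst z" "snd z"] f2(3,4)[of "fst z" "snd z"] by simp
    show "AE z in lborel. z \<in> ?B \<longrightarrow> w z = g (snd z) + f1 z - f2 z"
      using g(2) by eventually_elim (auto simp: v_def)
  qed (use f1 f2 g in auto)
qed

section \<open>Spatial derivatives on the half plane\<close>

lemma smooth_on_fst_snd:
  assumes "smooth_on UNIV (p :: real \<Rightarrow> real)"
  shows "smooth_on UNIV (\<lambda>z::real\<times>real. p (fst z))" "smooth_on UNIV (\<lambda>z::real\<times>real. p (snd z))"
  by (rule smooth_on_compose[OF open_UNIV _ assms smooth_on_linear]; simp add: bounded_linear_fst bounded_linear_snd)+

lemma test_functions_prod: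
  assumes p: "p \<in> test_functions U" and q: "q \<in> test_functions V"
  shows "(\<lambda>z. p (fst z) * q (snd z)) \<in> test_functions ((U :: real set) \<times> (V :: real set))"
    and "partial (1, 0) (\<lambda>z. p (fst z) * q (snd z)) z = deriv p (fst z) * q (snd z)"
    and "partial (0, 1) (\<lambda>z. p (fst z) * q (snd z)) z = p (fst z) * deriv q (snd z)"
proof -
  obtain K where K: "compact K" "K \<subseteq> U" "\<And>x. x \<notin> K \<Longrightarrow> p x = 0"
    using test_functions_support[OF p] by metis
  obtain L where L: "compact L" "L \<subseteq> V" "\<And>x. x \<notin> L \<Longrightarrow> q x = 0"
    using test_functions_support[OF q] by metis
  show "(\<lambda>z. p (fst z) * q (snd z)) \<in> test_functions (U \<times> V)"
  proof (rule test_functionsI[of _ "K \<times> L"])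
    show "smooth_on UNIV (\<lambda>z. p (fst z) * q (snd z))"
      by (rule smooth_on_mult[OF open_UNIV smooth_on_fst_snd(1) smooth_on_fst_snd(2)])
        (rule test_functions_smooth[OF p], rule test_functions_smooth[OF q])
    show "p (fst z) * q (snd z) = 0" if "z \<notin> K \<times> L" for z
      using K(3) L(3) that by (cases z) auto
  qed (use K L in \<open>auto intro: compact_Times\<close>)
  have D: "((\<lambda>z. p (fst z) * q (snd z)) has_derivative
      (\<lambda>h. p (fst z) * (deriv q (snd z) * snd h) + deriv p (fst z) * fst h * q (snd z))) (at z)"
  proof (rule has_derivative_mult)
    have "(p has_derivative (*) (deriv p (fst z))) (at (fst z))" "(q has_derivative (*) (deriv q (snd z))) (at (snd z))"
      using test_functions_deriv(3)[OF p] test_functions_deriv(3)[OF q] by (auto simp: has_field_derivative_def)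
    then show "((\<lambda>z. p (fst z)) has_derivative (\<lambda>h. deriv p (fst z) * fst h)) (at z)"
      "((\<lambda>z. q (snd z)) has_derivative (\<lambda>h. deriv q (snd z) * snd h)) (at z)"
      by (auto intro!: has_derivative_compose[of fst fst z UNIV p] has_derivative_compose[of snd snd z UNIV q] derivative_intros)
  qed
  show "partial (1, 0) (\<lambda>z. p (fst z) * q (snd z)) z = deriv p (fst z) * q (snd z)"
    "partial (0, 1) (\<lambda>z. p (fst z) * q (snd z)) z = p (fst z) * deriv q (snd z)"
    using partial_eq[OF D] by simp_all
qed

lemma box_in_half_plane:
  fixes a b c d :: real
  assumes "0 < c" shows "{a..b} \<times> {c..d} \<subseteq> half_plane" "compact ({a..b} \<times> {c..d})" "{a<..<b} \<times> {c<..<d} \<subseteq> half_plane"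
  using assms by (auto simp: half_plane_def compact_Times)

text \<open>
  A box whose closure lies in the half plane has finite mass for a signed Radon measure; restriction
  to the box therefore leaves the difference of two finite, mutually singular measures.
\<close>

lemma x_derivative_on_box:
  fixes a b c d :: real
  assumes "0 < c" and w: "locally_integrable half_plane w"
    and deriv: "has_distr_deriv half_plane (1, 0) w \<mu>"
  defines "B \<equiv> {a<..<b} \<times> {c<..<d}"
  obtains M1 M2 A where "finite_measure M1" "finite_measure M2" "sets M1 = sets borel" "sets M2 = sets borel"
    "emeasure M1 (- B) = 0" "emeasure M2 (- B) = 0"
    "A \<in> sets borel" "emeasure M1 (- A) = 0" "emeasure M2 A = 0"
    "\<And>p q. p \<in> test_functions {a<..<b} \<Longrightarrow> q \<in> test_functions {c<..<d} \<Longrightarrow>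
      (\<integral>z. deriv p (fst z) * q (snd z) * (indicator B z * w z) \<partial>lborel) =
      (\<integral>z. p (fst z) * q (snd z) \<partial>M2) - (\<integral>z. p (fst z) * q (snd z) \<partial>M1)"
    "\<And>f. f \<in> borel_measurable borel \<Longrightarrow> (\<And>z. z \<notin> B \<Longrightarrow> f z = 0) \<Longrightarrow>
      signed_integrable half_plane \<mu> f \<longleftrightarrow> integrable M1 f \<and> integrable M2 f"
    "\<And>f. f \<in> borel_measurable borel \<Longrightarrow> (\<And>z. z \<notin> B \<Longrightarrow> f z = 0) \<Longrightarrow>
      signed_integral half_plane \<mu> f = (\<integral>z. f z \<partial>M1) - (\<integral>z. f z \<partial>M2)"
proof -
  have B[measurable]: "B \<in> sets borel" by (simp add: borel_Times B_def)
  have sub: "B \<subseteq> half_plane" "B \<subseteq> {a..b} \<times> {c..d}" using \<open>0 < c\<close> by (auto simp: half_plane_def B_def)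
  obtain m1 m2 where \<mu>: "\<mu> = (m1, m2)" by (metis surj_pair)
  have rad: "sets m = sets borel" "emeasure m ({a..b} \<times> {c..d}) < \<infinity>" if "m \<in> {m1, m2}" for m
    using deriv that box_in_half_plane[OF \<open>0 < c\<close>, of a b d]
    unfolding has_distr_deriv_def signed_radon_def \<mu> by auto
  obtain A where A: "A \<in> sets borel" "emeasure m1 (- A) = 0" "emeasure m2 A = 0"
    using deriv unfolding has_distr_deriv_def signed_radon_def \<mu> by auto
  define M where "M m = density m (indicator B)" for m :: "(real \<times> real) measure"
  have sM: "sets (M m) = sets borel" if "m \<in> {m1, m2}" for m using rad(1)[OF that] by (simp add: M_def)
  have spM: "space (M m) = UNIV" if "m \<in> {m1, m2}" for m using sets_eq_imp_space_eq[OF sM[OF that]] by simp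
  have eM: "emeasure (M m) X = emeasure m (B \<inter> X)" if "m \<in> {m1, m2}" "X \<in> sets borel" for m X
    using that B rad(1)[OF that(1)] unfolding M_def by (intro emeasure_restricted) auto
  have cB: "{a..b} \<times> {c..d} \<in> sets borel" by (simp add: borel_Times)
  have fM: "finite_measure (M m)" if "m \<in> {m1, m2}" for m
  proof (rule finite_measureI)
    have "emeasure m B \<le> emeasure m ({a..b} \<times> {c..d})"
      using sub cB rad(1)[OF that] by (intro emeasure_mono) auto
    then show "emeasure (M m) (space (M m)) \<noteq> \<infinity>"
      using rad(2)[OF that] eM[OF that, of UNIV] spM[OF that] by (auto simp: top_unique)
  qed
  have conc: "emeasure (M m) (- B) = 0" if "m \<in> {m1, m2}" for m
    using eM[OF that borel_comp[OF B]] by simp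
  have le: "emeasure (M m) X \<le> emeasure m X" if "m \<in> {m1, m2}" "X \<in> sets borel" for m X
    using that rad(1)[OF that(1)] by (auto simp: eM intro!: emeasure_mono)
  have int_M: "integrable (M m) f \<longleftrightarrow> set_integrable m half_plane f" "(\<integral>z. f z \<partial>M m) = (LINT z:half_plane|m. f z)"
    if m: "m \<in> {m1, m2}" and f[measurable]: "f \<in> borel_measurable borel" and f0: "\<And>z. z \<notin> B \<Longrightarrow> f z = 0"
    for m and f :: "real \<times> real \<Rightarrow> real"
  proof -
    have [measurable_cong]: "sets m = sets borel" using rad(1)[OF m] .
    have M: "M m = density m (\<lambda>z. ennreal (indicat_real B z))"
      unfolding M_def by (rule arg_cong[where f="density m"]) (auto simp: fun_eq_iff indicator_def)
    have *: "(\<lambda>z. indicat_real B z *\<^sub>R f z) = (\<lambda>z. indicat_real half_plane z *\<^sub>R f z)"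
      using f0 sub by (auto simp: indicator_def fun_eq_iff)
    show "integrable (M m) f \<longleftrightarrow> set_integrable m half_plane f"
      unfolding M set_integrable_def *[symmetric] by (rule integrable_density) auto
    show "(\<integral>z. f z \<partial>M m) = (LINT z:half_plane|m. f z)"
      unfolding M set_lebesgue_integral_def *[symmetric] by (rule integral_density) auto
  qed
  have weak: "(\<integral>z. deriv p (fst z) * q (snd z) * (indicator B z * w z) \<partial>lborel) =
      (\<integral>z. p (fst z) * q (snd z) \<partial>M m2) - (\<integral>z. p (fst z) * q (snd z) \<partial>M m1)"
    if p: "p \<in> test_functions {a<..<b}" and q: "q \<in> test_functions {c<..<d}" for p q
  proof -
    note \<theta> = test_functions_prod[OF p q, folded B_def]
    have "(LINT z:half_plane|lborel. w z * partial (1, 0) (\<lambda>z. p (fst z) * q (snd z)) z) =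
        - signed_integral half_plane \<mu> (\<lambda>z. p (fst z) * q (snd z))"
      using deriv test_functions_mono[OF \<theta>(1) sub(1)] unfolding has_distr_deriv_def by blast
    also have "signed_integral half_plane \<mu> (\<lambda>z. p (fst z) * q (snd z)) =
      (\<integral>z. p (fst z) * q (snd z) \<partial>M m1) - (\<integral>z. p (fst z) * q (snd z) \<partial>M m2)"
      using int_M(2)[OF _ test_functions_borel[OF \<theta>(1)] test_functions_outside[OF \<theta>(1)]]
      by (simp add: signed_integral_def \<mu>)
    also have "(LINT z:half_plane|lborel. w z * partial (1, 0) (\<lambda>z. p (fst z) * q (snd z)) z) =
      (\<integral>z. deriv p (fst z) * q (snd z) * (indicator B z * w z) \<partial>lborel)"
      unfolding set_lebesgue_integral_def
    proof (rule Bochner_Integration.integral_cong)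
      fix z
      show "indicat_real half_plane z *\<^sub>R (w z * partial (1, 0) (\<lambda>z. p (fst z) * q (snd z)) z) =
        deriv p (fst z) * q (snd z) * (indicator B z * w z)"
        using test_functions_outside[OF test_functions_deriv(2)[OF p], of "fst z"]
          test_functions_outside[OF q, of "snd z"] sub \<open>0 < c\<close>
        unfolding \<theta>(2) by (cases z) (auto simp: indicator_def half_plane_def B_def)
    qed simp
    finally show ?thesis by simp
  qed
  show thesis
  proof (rule that[of "M m1" "M m2" A])
    show "A \<in> sets borel" by fact
    show "emeasure (M m1) (- A) = 0" "emeasure (M m2) A = 0"
      using le[of m1 "- A"] le[of m2 A] A by (auto intro: borel_comp)
    show "finite_measure (M m1)" "finite_measure (M m2)" "sets (M m1) = sets borel" "sets (M m2) = sets borel"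
      "emeasure (M m1) (- B) = 0" "emeasure (M m2) (- B) = 0"
      by (rule fM sM conc, simp)+
    fix f :: "real \<times> real \<Rightarrow> real" assume f: "f \<in> borel_measurable borel" "\<And>z. z \<notin> B \<Longrightarrow> f z = 0"
    show "signed_integrable half_plane \<mu> f \<longleftrightarrow> integrable (M m1) f \<and> integrable (M m2) f"
      "signed_integral half_plane \<mu> f = (\<integral>z. f z \<partial>M m1) - (\<integral>z. f z \<partial>M m2)"
      using int_M[OF _ f, of m1] int_M[OF _ f, of m2] by (simp_all add: signed_integrable_def signed_integral_def \<mu>)
  qed (rule weak)
qed

lemma locally_integrable_box:
  assumes "0 < c" "locally_integrable half_plane w"
  shows "integrable lborel (\<lambda>z. indicat_real ({a<..<b} \<times> {c<..<d}) z * w z)"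
proof -
  have "set_integrable lborel ({a..b} \<times> {c..d}) w"
    using assms(2) box_in_half_plane[OF \<open>0 < c\<close>, of a b d] unfolding locally_integrable_def by auto
  then have "set_integrable lborel ({a<..<b} \<times> {c<..<d}) w"
    by (rule set_integrable_subset) (auto simp: borel_Times)
  then show ?thesis by (simp add: set_integrable_def)
qed

lemma x_derivative_slices_half_plane:
  assumes "a < b" "0 < c" and w: "locally_integrable half_plane w"
    and deriv: "has_distr_deriv half_plane (1, 0) w \<mu>"
  obtains f1 f2 g h where "\<And>t. mono (\<lambda>y. f1 (y, t) :: real)" "\<And>t. mono (\<lambda>y. f2 (y, t) :: real)"
    "integrable lborel g" "integrable lborel h" "\<And>z. \<bar>f1 z\<bar> + \<bar>f2 z\<bar> \<le> h (snd z)"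
    "AE z in lborel. z \<in> {a<..<b} \<times> {c<..<d} \<longrightarrow> w z = g (snd z) + f1 z - f2 z"
proof -
  let ?B = "{a<..<b} \<times> {c<..<d}"
  show thesis
  proof (rule x_derivative_on_box[OF \<open>0 < c\<close> w deriv, of a b d])
    fix M1 M2 A
    assume M: "finite_measure M1" "finite_measure M2" "sets M1 = sets borel" "sets M2 = sets borel"
      "emeasure M1 (- ?B) = 0" "emeasure M2 (- ?B) = 0"
      "A \<in> sets borel" "emeasure M1 (- A) = 0" "emeasure M2 A = 0"
      and weak: "\<And>p q. p \<in> test_functions {a<..<b} \<Longrightarrow> q \<in> test_functions {c<..<d} \<Longrightarrow>
        (\<integral>z. deriv p (fst z) * q (snd z) * (indicator ?B z * w z) \<partial>lborel) =
        (\<integral>z. p (fst z) * q (snd z) \<partial>M2) - (\<integral>z. p (fst z) * q (snd z) \<partial>M1)"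
    show thesis
    proof (rule x_derivative_slices[OF \<open>a < b\<close> locally_integrable_box[OF \<open>0 < c\<close> w] _ M])
      show "indicat_real ?B z * w z = 0" if "z \<notin> ?B" for z using that by simp
      show "(\<integral>z. deriv p (fst z) * q (snd z) * (indicator ?B z * w z) \<partial>lborel) =
        (\<integral>z. p (fst z) * q (snd z) \<partial>M2) - (\<integral>z. p (fst z) * q (snd z) \<partial>M1)"
        if "p \<in> test_functions {a<..<b}" "q \<in> test_functions {c<..<d}" for p q by (rule weak[OF that])
      fix f1 f2 g h
      assume *: "\<And>t. mono (\<lambda>y. f1 (y, t) :: real)" "\<And>t. mono (\<lambda>y. f2 (y, t) :: real)"
        "integrable lborel g" "integrable lborel h" "\<And>z. \<bar>f1 z\<bar> + \<bar>f2 z\<bar> \<le> h (snd z)"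
        "AE z in lborel. z \<in> ?B \<longrightarrow> indicat_real ?B z * w z = g (snd z) + f1 z - f2 z"
      from *(6) have "AE z in lborel. z \<in> ?B \<longrightarrow> w z = g (snd z) + f1 z - f2 z"
        by eventually_elim auto
      with *(1-5) show thesis by (rule that)
    qed
  qed
qed

section \<open>Essential one-sided limits\<close>

lemma eventually_ess_at_left:
  "eventually P (ess_at_left x) \<longleftrightarrow> (\<exists>b<x. AE y in lborel. b < y \<and> y < x \<longrightarrow> P y)"
proof
  assume "eventually P (ess_at_left x)"
  then obtain Q R where QR: "eventually Q (at_left x)" "AE y in lborel. R y" "\<And>y. Q y \<and> R y \<Longrightarrow> P y"
    unfolding ess_at_left_def eventually_inf by auto
  from QR(1) obtain b where b: "b < x" "\<And>y. b < y \<Longrightarrow> y < x \<Longrightarrow> Q y"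
    unfolding eventually_at_left_field by auto
  from QR(2) have "AE y in lborel. b < y \<and> y < x \<longrightarrow> P y"
    by eventually_elim (use b QR(3) in auto)
  with b(1) show "\<exists>b<x. AE y in lborel. b < y \<and> y < x \<longrightarrow> P y" by blast
next
  assume "\<exists>b<x. AE y in lborel. b < y \<and> y < x \<longrightarrow> P y"
  then obtain b where b: "b < x" "AE y in lborel. b < y \<and> y < x \<longrightarrow> P y" by blast
  have "eventually (\<lambda>y. b < y \<and> y < x) (at_left x)"
    unfolding eventually_at_left_field using b(1) by auto
  with b(2) show "eventually P (ess_at_left x)"
    unfolding ess_at_left_def eventually_inf by blast
qed

lemma eventually_ess_at_right:
  "eventually P (ess_at_right x) \<longleftrightarrow> (\<exists>b>x. AE y in lborel. x < y \<and> y < b \<longrightarrow> P y)"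
proof
  assume "eventually P (ess_at_right x)"
  then obtain Q R where QR: "eventually Q (at_right x)" "AE y in lborel. R y" "\<And>y. Q y \<and> R y \<Longrightarrow> P y"
    unfolding ess_at_right_def eventually_inf by auto
  from QR(1) obtain b where b: "x < b" "\<And>y. x < y \<Longrightarrow> y < b \<Longrightarrow> Q y"
    unfolding eventually_at_right_field by auto
  from QR(2) have "AE y in lborel. x < y \<and> y < b \<longrightarrow> P y"
    by eventually_elim (use b QR(3) in auto)
  with b(1) show "\<exists>b>x. AE y in lborel. x < y \<and> y < b \<longrightarrow> P y" by blast
next
  assume "\<exists>b>x. AE y in lborel. x < y \<and> y < b \<longrightarrow> P y"
  then obtain b where b: "x < b" "AE y in lborel. x < y \<and> y < b \<longrightarrow> P y" by blast
  have "eventually (\<lambda>y. x < y \<and> y < b) (at_right x)"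
    unfolding eventually_at_right_field using b(1) by auto
  with b(2) show "eventually P (ess_at_right x)"
    unfolding ess_at_right_def eventually_inf by blast
qed

lemma not_AE_Ioo: "a < b \<Longrightarrow> \<not> (AE y in lborel. \<not> (a < y \<and> y < (b::real)))"
proof
  assume "a < b" "AE y in lborel. \<not> (a < y \<and> y < b)"
  then have "emeasure lborel {a<..<b} = 0" by (subst (asm) AE_iff_measurable[of "{a<..<b}"]) auto
  then show False using \<open>a < b\<close> by simp
qed

lemma ess_at_not_bot: "ess_at_left x \<noteq> bot" "ess_at_right x \<noteq> bot"
  unfolding trivial_limit_def eventually_ess_at_left eventually_ess_at_right
  using not_AE_Ioo by auto

lemma mono_has_ess_limits:
  fixes f :: "real \<Rightarrow> real"
  assumes "mono f"
  shows "\<exists>l. (f \<longlongrightarrow> l) (ess_at_left x)" "\<exists>l. (f \<longlongrightarrow> l) (ess_at_right x)"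
proof -
  have R: "\<exists>l. (f \<longlongrightarrow> l) (at_right x)" if "mono f" for f :: "real \<Rightarrow> real" and x
    using Lim_right_bound[of UNIV x f "f x"] monoD[OF that] by auto
  then show "\<exists>l. (f \<longlongrightarrow> l) (ess_at_right x)"
    unfolding ess_at_right_def using tendsto_mono[OF inf_le1] assms by blast
  have "mono (\<lambda>y. - f (- y))" using assms by (auto simp: mono_def)
  from R[OF this, of "- x"] obtain l where "((\<lambda>y. - f (- y)) \<longlongrightarrow> l) (at_right (- x))" by blast
  from tendsto_minus[OF this] have "(f \<longlongrightarrow> - l) (at_left x)"
    unfolding at_left_minus[of x] filterlim_filtermap by simp
  then show "\<exists>l. (f \<longlongrightarrow> l) (ess_at_left x)"
    unfolding ess_at_left_def using tendsto_mono[OF inf_le1] by blast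
qed

lemma AE_prod_sections:
  assumes "AE z in (lborel :: (real \<times> real) measure). P z"
  shows "AE t in lborel. AE y in lborel. P (y, t)"
proof -
  have "AE z in (lborel \<Otimes>\<^sub>M lborel :: (real \<times> real) measure). P z" using assms by (subst lborel_prod)
  then have "AE z in distr (lborel \<Otimes>\<^sub>M lborel) (lborel \<Otimes>\<^sub>M lborel) (\<lambda>(x, y). (y, x)). P z"
    using lborel_pair.distr_pair_swap by metis
  from AE_distrD[OF _ this] have "AE z in (lborel \<Otimes>\<^sub>M lborel :: (real \<times> real) measure). P (snd z, fst z)"
    by (simp add: case_prod_beta')
  from lborel_pair.AE_pair[OF this] show ?thesis by simp
qed

text \<open>
  The two consequences of slicing that matter for traces.  Monotone functions have one-sided limits, and
  changing them on a null set does not affect essential limits.  The bound \<open>H\<close> is what makes dominated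
  convergence in \<open>t\<close> possible, although \<open>w\<close> itself may be unbounded.
\<close>

lemma x_derivative_measure_regularity:
  assumes "a < b" "0 < c" and w: "locally_integrable half_plane w"
    and deriv: "has_distr_deriv half_plane (1, 0) w \<mu>"
  obtains H where "integrable lborel H"
    "AE t in lborel. t \<in> {c<..<d} \<longrightarrow> (AE y in lborel. y \<in> {a<..<b} \<longrightarrow> \<bar>w (y, t)\<bar> \<le> H t)"
    "AE t in lborel. t \<in> {c<..<d} \<longrightarrow> (\<forall>x\<in>{a<..<b}. (\<exists>l. has_left_value w x t l) \<and> (\<exists>r. has_right_value w x t r))"
proof -
  obtain f1 f2 g h where *: "\<And>t. mono (\<lambda>y. f1 (y, t) :: real)" "\<And>t. mono (\<lambda>y. f2 (y, t) :: real)"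
    "integrable lborel g" "integrable lborel h" "\<And>z. \<bar>f1 z\<bar> + \<bar>f2 z\<bar> \<le> h (snd z)"
    "AE z in lborel. z \<in> {a<..<b} \<times> {c<..<d} \<longrightarrow> w z = g (snd z) + f1 z - f2 z"
    using x_derivative_slices_half_plane[OF assms, of d] by blast
  have w: "AE t in lborel. AE y in lborel. (y, t) \<in> {a<..<b} \<times> {c<..<d} \<longrightarrow> w (y, t) = g t + f1 (y, t) - f2 (y, t)"
    using AE_prod_sections[OF *(6)] by simp
  show thesis
  proof (rule that[of "\<lambda>t. \<bar>g t\<bar> + h t"])
    show "integrable lborel (\<lambda>t. \<bar>g t\<bar> + h t)" using *(3,4) by simp
    show "AE t in lborel. t \<in> {c<..<d} \<longrightarrow> (AE y in lborel. y \<in> {a<..<b} \<longrightarrow> \<bar>w (y, t)\<bar> \<le> \<bar>g t\<bar> + h t)"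
      using w
    proof eventually_elim
      case (elim t)
      show ?case
      proof
        assume t: "t \<in> {c<..<d}"
        from elim show "AE y in lborel. y \<in> {a<..<b} \<longrightarrow> \<bar>w (y, t)\<bar> \<le> \<bar>g t\<bar> + h t"
        proof eventually_elim
          case (elim y)
          then show ?case using t *(5)[of "(y, t)"] by auto
        qed
      qed
    qed
    show "AE t in lborel. t \<in> {c<..<d} \<longrightarrow> (\<forall>x\<in>{a<..<b}. (\<exists>l. has_left_value w x t l) \<and> (\<exists>r. has_right_value w x t r))"
      using w
    proof eventually_elim
      case (elim t)
      show ?case
      proof (intro impI ballI)
        fix x assume t: "t \<in> {c<..<d}" and x: "x \<in> {a<..<b}"
        have AE: "AE y in lborel. y \<in> {a<..<b} \<longrightarrow> w (y, t) = g t + f1 (y, t) - f2 (y, t)"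
          using elim by eventually_elim (use t in auto)
        have evl: "eventually (\<lambda>y. w (y, t) = g t + f1 (y, t) - f2 (y, t)) (ess_at_left x)"
          unfolding eventually_ess_at_left
          by (rule exI[of _ a]) (use x AE in \<open>auto elim!: eventually_mono\<close>)
        have evr: "eventually (\<lambda>y. w (y, t) = g t + f1 (y, t) - f2 (y, t)) (ess_at_right x)"
          unfolding eventually_ess_at_right
          by (rule exI[of _ b]) (use x AE in \<open>auto elim!: eventually_mono\<close>)
        obtain l1 l2 r1 r2 where
          "((\<lambda>y. f1 (y, t)) \<longlongrightarrow> l1) (ess_at_left x)" "((\<lambda>y. f2 (y, t)) \<longlongrightarrow> l2) (ess_at_left x)"
          "((\<lambda>y. f1 (y, t)) \<longlongrightarrow> r1) (ess_at_right x)" "((\<lambda>y. f2 (y, t)) \<longlongrightarrow> r2) (ess_at_right x)"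
          using mono_has_ess_limits[OF *(1), of t x] mono_has_ess_limits[OF *(2), of t x] by blast
        then have "((\<lambda>y. g t + f1 (y, t) - f2 (y, t)) \<longlongrightarrow> g t + l1 - l2) (ess_at_left x)"
          "((\<lambda>y. g t + f1 (y, t) - f2 (y, t)) \<longlongrightarrow> g t + r1 - r2) (ess_at_right x)"
          by (auto intro!: tendsto_intros)
        then show "(\<exists>l. has_left_value w x t l) \<and> (\<exists>r. has_right_value w x t r)"
          unfolding has_left_value_def has_right_value_def tendsto_cong[OF evl] tendsto_cong[OF evr] by blast
      qed
    qed
  qed
qed

section \<open>Test functions concentrating on a curve\<close>

lemma scaled_test_function:
  assumes A: "A \<in> test_functions {-1<..<1}" and k: "k \<ge> 1"
  shows "(\<lambda>x. A (k * (x - x0))) \<in> test_functions {x0 - 1 / k<..<x0 + 1 / k}"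
    and "deriv (\<lambda>x. A (k * (x - x0))) = (\<lambda>x. k * deriv A (k * (x - x0)))"
    and "(\<integral>x. \<bar>k * deriv A (k * (x - x0))\<bar> \<partial>lborel) = (\<integral>x. \<bar>deriv A x\<bar> \<partial>lborel)"
proof -
  obtain l r where lr: "-1 < l" "l < r" "r < 1" "\<And>x. x \<notin> {l..r} \<Longrightarrow> A x = 0"
    using test_functions_real_support[OF A] by auto
  have sm: "smooth_on UNIV (\<lambda>x. A (k * x + (- k * x0)))"
    by (rule smooth_on_compose[OF open_UNIV _ test_functions_smooth[OF A] smooth_on_affine]) simp
  show "(\<lambda>x. A (k * (x - x0))) \<in> test_functions {x0 - 1 / k<..<x0 + 1 / k}"
  proof (rule test_functionsI[of _ "{x0 + l / k..x0 + r / k}"])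
    show "smooth_on UNIV (\<lambda>x. A (k * (x - x0)))" using sm by (simp add: algebra_simps)
    show "{x0 + l / k..x0 + r / k} \<subseteq> {x0 - 1 / k<..<x0 + 1 / k}"
    proof -
      have "- (1 / k) < l / k" "r / k < 1 / k"
        using divide_strict_right_mono[OF lr(1), of k] divide_strict_right_mono[OF lr(3), of k] k by auto
      then show ?thesis unfolding subset_iff atLeastAtMost_iff greaterThanLessThan_iff by linarith
    qed
    show "A (k * (x - x0)) = 0" if "x \<notin> {x0 + l / k..x0 + r / k}" for x
    proof (rule lr(4))
      show "k * (x - x0) \<notin> {l..r}" using that k by (auto simp: field_simps)
    qed
  qed simp
  show "deriv (\<lambda>x. A (k * (x - x0))) = (\<lambda>x. k * deriv A (k * (x - x0)))"
  proof
    fix x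
    have "((\<lambda>x. A (k * (x - x0))) has_real_derivative deriv A (k * (x - x0)) * k) (at x)"
      by (rule DERIV_chain2[where f=A, OF test_functions_deriv(3)[OF A]]) (auto intro!: derivative_eq_intros)
    then show "deriv (\<lambda>x. A (k * (x - x0))) x = k * deriv A (k * (x - x0))"
      by (simp add: DERIV_imp_deriv mult.commute)
  qed
  show "(\<integral>x. \<bar>k * deriv A (k * (x - x0))\<bar> \<partial>lborel) = (\<integral>x. \<bar>deriv A x\<bar> \<partial>lborel)"
    by (subst lborel_integral_real_affine[where c="1/k" and t=x0]) (use k in \<open>auto simp: abs_mult\<close>)
qed

text \<open>
  The kernel \<open>n * deriv A (n * (x - x0))\<close> concentrates at \<open>x0\<close> and its \<open>L\<close>-norm for the exponent one does not
  depend on \<open>n\<close>.  It has integral \<open>A 0\<close> over the left half line and \<open>- A 0\<close> over the right one, so it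
  extracts the jump of \<open>f\<close>.
\<close>

lemma jump_of_blow_up:
  fixes f :: "real \<Rightarrow> real"
  assumes A: "A \<in> test_functions {-1<..<1}" and x0: "x0 \<in> {a<..<b}"
    and f: "set_integrable lborel {a<..<b} f"
    and lim: "(f \<longlongrightarrow> l) (ess_at_left x0)" "(f \<longlongrightarrow> r) (ess_at_right x0)"
  shows "(\<lambda>n. \<integral>x. (indicator {a<..<b} x * f x) * (real (Suc n) * deriv A (real (Suc n) * (x - x0))) \<partial>lborel)
    \<longlonglongrightarrow> (l - r) * A 0"
proof -
  define T where "T n x = real (Suc n) * deriv A (real (Suc n) * (x - x0))" for n x
  define N where "N = (\<integral>x. \<bar>deriv A x\<bar> \<partial>lborel)"
  let ?B = "\<lambda>n x. A (real (Suc n) * (x - x0))"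
  have B: "?B n \<in> test_functions {x0 - 1 / real (Suc n)<..<x0 + 1 / real (Suc n)}" "deriv (?B n) = T n" for n
    using scaled_test_function[OF A, of "real (Suc n)" x0] by (auto simp: T_def)
  have T: "T n \<in> test_functions {x0 - 1 / real (Suc n)<..<x0 + 1 / real (Suc n)}" for n
    using test_functions_deriv(2)[OF B(1), of n] unfolding B(2) .
  have [measurable]: "T n \<in> borel_measurable borel" for n using test_functions_borel[OF T] .
  have iT: "integrable lborel (T n)" for n using integrable_test[OF T] .
  have N: "(\<integral>x. \<bar>T n x\<bar> \<partial>lborel) = N" for n
    unfolding T_def N_def by (rule scaled_test_function(3)[OF A]) simp
  have N0: "0 \<le> N" unfolding N_def by (rule integral_nonneg_AE) simp
  have tail: "(\<integral>x. indicator {y..} x * T n x \<partial>lborel) = - ?B n y" for n y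
    using test_function_tail_integral[OF B(1), of y n] unfolding B(2) .
  define s where "s x = (if x < x0 then l else r)" for x :: real
  have [measurable]: "s \<in> borel_measurable borel" unfolding s_def by measurable
  have isT: "integrable lborel (\<lambda>x. s x * T n x)" for n
    by (rule Bochner_Integration.integrable_bound[of _ "\<lambda>x. (\<bar>l\<bar> + \<bar>r\<bar>) * T n x"])
      (use iT in \<open>auto simp: s_def abs_mult intro!: mult_right_mono\<close>)
  have sT: "(\<integral>x. s x * T n x \<partial>lborel) = (l - r) * A 0" for n
  proof -
    have iI: "integrable lborel (\<lambda>x. indicator {y..} x * T n x)" for y
      using integrable_mult_indicator[OF _ iT, of "{y..}"] by simp
    have "s x * T n x = l * (indicator {x0 - 1..} x * T n x) + (r - l) * (indicator {x0..} x * T n x)" for x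
    proof -
      have "T n x = 0" if "x < x0 - 1"
      proof (rule test_functions_outside[OF T])
        have "1 / real (Suc n) \<le> 1" by simp
        then show "x \<notin> {x0 - 1 / real (Suc n)<..<x0 + 1 / real (Suc n)}"
          using that unfolding greaterThanLessThan_iff by linarith
      qed
      then show ?thesis by (auto simp: s_def indicator_def algebra_simps)
    qed
    then have "(\<integral>x. s x * T n x \<partial>lborel) = l * - ?B n (x0 - 1) + (r - l) * - ?B n x0"
      using iI tail by simp
    moreover have "?B n (x0 - 1) = 0"
      by (rule test_functions_outside[OF B(1)]) simp
    ultimately show ?thesis by (simp add: algebra_simps)
  qed
  have ifT: "integrable lborel (\<lambda>x. (indicator {a<..<b} x * f x) * T n x)" for n
    by (rule integrable_test_mult[OF T]) (use f in \<open>simp_all add: set_integrable_def\<close>)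
  have "(\<lambda>n. \<integral>x. (indicator {a<..<b} x * f x) * T n x \<partial>lborel) \<longlonglongrightarrow> (l - r) * A 0"
  proof (rule LIMSEQ_I)
    fix e' :: real assume "e' > 0"
    define e where "e = e' / (N + 1)"
    have e: "e > 0" "e * N < e'" using \<open>e' > 0\<close> N0 by (auto simp: e_def field_simps)
    obtain b1 where b1: "b1 < x0" "AE y in lborel. b1 < y \<and> y < x0 \<longrightarrow> dist (f y) l < e"
      using tendstoD[OF lim(1) e(1)] unfolding eventually_ess_at_left by auto
    obtain b2 where b2: "x0 < b2" "AE y in lborel. x0 < y \<and> y < b2 \<longrightarrow> dist (f y) r < e"
      using tendstoD[OF lim(2) e(1)] unfolding eventually_ess_at_right by auto
    define d where "d = Min {x0 - b1, b2 - x0, x0 - a, b - x0}"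
    have "d > 0" using b1 b2 x0 by (auto simp: d_def)
    have d: "d \<le> x0 - b1" "d \<le> b2 - x0" "d \<le> x0 - a" "d \<le> b - x0" unfolding d_def by auto
    obtain no where no: "1 / real (Suc no) < d" using \<open>d > 0\<close> nat_approx_posE by blast
    show "\<exists>no. \<forall>n\<ge>no. norm ((\<integral>x. (indicator {a<..<b} x * f x) * T n x \<partial>lborel) - (l - r) * A 0) < e'"
    proof (intro exI[of _ no] allI impI)
      fix n assume "n \<ge> no"
      then have "1 / real (Suc n) \<le> 1 / real (Suc no)" by (simp add: frac_le)
      then have nd: "1 / real (Suc n) < d" using no by linarith
      have T0: "T n x = 0" if "\<bar>x - x0\<bar> \<ge> d" for x
      proof (rule test_functions_outside[OF T])
        show "x \<notin> {x0 - 1 / real (Suc n)<..<x0 + 1 / real (Suc n)}"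
          using that nd unfolding greaterThanLessThan_iff by linarith
      qed
      have AE: "AE x in lborel. norm ((indicator {a<..<b} x * f x) * T n x - s x * T n x) \<le> e * \<bar>T n x\<bar>"
        using b1(2) b2(2) AE_lborel_singleton[of x0]
      proof eventually_elim
        case (elim x)
        show ?case
        proof (cases "\<bar>x - x0\<bar> \<ge> d")
          case True
          then show ?thesis using T0 by simp
        next
          case False
          then have "x \<in> {a<..<b}" "x < x0 \<longrightarrow> b1 < x" "x > x0 \<longrightarrow> x < b2" using d by auto
          then have "\<bar>f x - s x\<bar> \<le> e" using elim by (auto simp: s_def dist_real_def)
          then have "\<bar>f x - s x\<bar> * \<bar>T n x\<bar> \<le> e * \<bar>T n x\<bar>" by (intro mult_right_mono) auto
          then show ?thesis using \<open>x \<in> {a<..<b}\<close> by (simp add: left_diff_distrib[symmetric] abs_mult)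
        qed
      qed
      have "(\<integral>x. (indicator {a<..<b} x * f x) * T n x \<partial>lborel) - (l - r) * A 0 =
        (\<integral>x. (indicator {a<..<b} x * f x) * T n x - s x * T n x \<partial>lborel)"
        using ifT isT sT by simp
      also have "norm \<dots> \<le> (\<integral>x. norm ((indicator {a<..<b} x * f x) * T n x - s x * T n x) \<partial>lborel)"
        by (rule integral_norm_bound)
      also have "\<dots> \<le> (\<integral>x. e * \<bar>T n x\<bar> \<partial>lborel)"
        by (rule integral_mono_AE[OF _ _ AE]) (use ifT isT iT in auto)
      also have "\<dots> = e * N" using N by simp
      finally show "norm ((\<integral>x. (indicator {a<..<b} x * f x) * T n x \<partial>lborel) - (l - r) * A 0) < e'"
        using e by linarith
    qed
  qed
  then show ?thesis unfolding T_def .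
qed

lemma smooth_real_deriv:
  fixes \<phi> :: "real \<Rightarrow> real"
  assumes "smooth_on S \<phi>" "open S"
  shows "t \<in> S \<Longrightarrow> (\<phi> has_real_derivative deriv \<phi> t) (at t)" "continuous_on S (deriv \<phi>)"
proof -
  show "t \<in> S \<Longrightarrow> (\<phi> has_real_derivative deriv \<phi> t) (at t)"
    using smooth_on_differentiable[OF assms(1)] by (simp add: DERIV_deriv_iff_real_differentiable)
  have "continuous_on S (partial 1 \<phi>)" using smooth_on_continuous[OF smooth_on_partial[OF assms(1)]] by simp
  then show "continuous_on S (deriv \<phi>)"
    using partial_eq_deriv smooth_on_differentiable[OF assms(1)] by (simp cong: continuous_on_cong)
qed

lemma open_half_plane: "open half_plane"
  unfolding half_plane_def by (intro open_Times) auto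

text \<open>
  The function \<open>\<phi>\<close> is smooth for positive times only.  Smoothness on the whole plane comes from gluing
  the half plane with the region before the support of \<open>q\<close>, where the product vanishes.
\<close>

lemma curve_test_function:
  assumes \<phi>: "smooth_on {0<..} \<phi>" and A: "A \<in> test_functions UNIV"
    and q: "q \<in> test_functions {c<..<d}" and "0 < c" "c < d"
  defines "\<theta> \<equiv> \<lambda>z. A (fst z - \<phi> (snd z)) * q (snd z)"
  shows "\<theta> \<in> test_functions half_plane"
    and "z \<in> half_plane \<Longrightarrow> partial (1, 0) \<theta> z = deriv A (fst z - \<phi> (snd z)) * q (snd z)"
    and "z \<in> half_plane \<Longrightarrow> partial (0, 1) \<theta> z =
      A (fst z - \<phi> (snd z)) * deriv q (snd z) - deriv \<phi> (snd z) * deriv A (fst z - \<phi> (snd z)) * q (snd z)"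
proof -
  obtain l r where lr: "c < l" "l < r" "r < d" "\<And>x. x \<notin> {l..r} \<Longrightarrow> q x = 0"
    using test_functions_real_support[OF q \<open>c < d\<close>] by metis
  obtain K where K: "compact K" "\<And>x. x \<notin> K \<Longrightarrow> A x = 0"
    using test_functions_support[OF A] by metis
  obtain R where R: "\<And>x. x \<in> K \<Longrightarrow> \<bar>x\<bar> \<le> R"
    using compact_imp_bounded[OF K(1)] by (auto simp: bounded_iff)
  have "continuous_on {l..r} \<phi>"
    using smooth_on_continuous[OF \<phi>] by (rule continuous_on_subset) (use lr \<open>0 < c\<close> in auto)
  then have "bounded (\<phi> ` {l..r})" by (intro compact_imp_bounded compact_continuous_image) auto
  then obtain B where "\<forall>x\<in>{l..r}. \<bar>\<phi> x\<bar> \<le> B" by (auto simp: bounded_iff)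
  then have B: "\<bar>\<phi> t\<bar> \<le> B" if "t \<in> {l..r}" for t using that by blast
  show "\<theta> \<in> test_functions half_plane"
  proof (rule test_functionsI[of _ "{- (R + B)..R + B} \<times> {l..r}"])
    have 1: "smooth_on half_plane (\<lambda>z. \<phi> (snd z))"
      by (rule smooth_on_compose[OF open_half_plane _ \<phi> smooth_on_linear])
        (auto simp: half_plane_def bounded_linear_snd)
    have 2: "smooth_on half_plane (\<lambda>z. fst z - \<phi> (snd z))"
      by (rule smooth_on_diff[OF open_half_plane smooth_on_linear 1]) (simp add: bounded_linear_fst)
    have 3: "smooth_on half_plane (\<lambda>z. A (fst z - \<phi> (snd z)))"
      by (rule smooth_on_compose[OF open_half_plane _ test_functions_smooth[OF A] 2]) simp
    have 4: "smooth_on half_plane (\<lambda>z. q (snd z))"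
      using smooth_on_subset[OF smooth_on_fst_snd(2)[OF test_functions_smooth[OF q]]] by simp
    have 5: "smooth_on half_plane \<theta>"
      unfolding \<theta>_def by (rule smooth_on_mult[OF open_half_plane 3 4])
    let ?W = "(UNIV :: real set) \<times> {..<l}"
    have W: "open ?W" by (intro open_Times) auto
    have "smooth_on ?W \<theta> \<longleftrightarrow> smooth_on ?W (\<lambda>_. 0)"
      by (rule smooth_on_cong[OF W]) (use lr(4) in \<open>auto simp: \<theta>_def\<close>)
    then have "smooth_on ?W \<theta>" using smooth_on_const by blast
    from smooth_on_Un[OF open_half_plane W 5 this]
    show "smooth_on UNIV \<theta>"
    proof (rule smooth_on_subset)
      show "UNIV \<subseteq> half_plane \<union> ?W" using lr(1) \<open>0 < c\<close> by (auto simp: half_plane_def)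
    qed
    show "compact ({- (R + B)..R + B} \<times> {l..r})" by (intro compact_Times) auto
    show "{- (R + B)..R + B} \<times> {l..r} \<subseteq> half_plane" using lr \<open>0 < c\<close> by (auto simp: half_plane_def)
    fix z assume z: "z \<notin> {- (R + B)..R + B} \<times> {l..r}"
    show "\<theta> z = 0"
    proof (cases "snd z \<in> {l..r}")
      case True
      have "fst z - \<phi> (snd z) \<notin> K"
        using R[of "fst z - \<phi> (snd z)"] B[OF True] True z by (cases z) auto
      then show ?thesis using K(2) by (simp add: \<theta>_def)
    next
      case False
      then show ?thesis using lr(4) by (simp add: \<theta>_def)
    qed
  qed
  assume z: "z \<in> half_plane"
  have D\<phi>: "(\<phi> has_derivative (*) (deriv \<phi> (snd z))) (at (snd z))"
    using smooth_real_deriv(1)[OF \<phi>, of "snd z"] z by (auto simp: half_plane_def has_field_derivative_def)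
  have DA: "(A has_derivative (*) (deriv A x)) (at x)" for x
    using test_functions_deriv(3)[OF A] by (auto simp: has_field_derivative_def)
  have Dq: "(q has_derivative (*) (deriv q x)) (at x)" for x
    using test_functions_deriv(3)[OF q] by (auto simp: has_field_derivative_def)
  have 1: "((\<lambda>z. fst z - \<phi> (snd z)) has_derivative (\<lambda>h. fst h - deriv \<phi> (snd z) * snd h)) (at z)"
    by (intro has_derivative_diff has_derivative_compose[of snd snd z UNIV \<phi>, OF _ D\<phi>] derivative_intros)
  have "(\<theta> has_derivative (\<lambda>h. A (fst z - \<phi> (snd z)) * (deriv q (snd z) * snd h) +
      deriv A (fst z - \<phi> (snd z)) * (fst h - deriv \<phi> (snd z) * snd h) * q (snd z))) (at z)"
    unfolding \<theta>_def
    by (intro has_derivative_mult has_derivative_compose[OF 1 DA]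
        has_derivative_compose[of snd snd z UNIV q, OF _ Dq] derivative_intros)
  from partial_eq[OF this, of "(1, 0)"] partial_eq[OF this, of "(0, 1)"] show
    "partial (1, 0) \<theta> z = deriv A (fst z - \<phi> (snd z)) * q (snd z)"
    "partial (0, 1) \<theta> z = A (fst z - \<phi> (snd z)) * deriv q (snd z) -
      deriv \<phi> (snd z) * deriv A (fst z - \<phi> (snd z)) * q (snd z)"
    by (simp_all add: algebra_simps)
qed

section \<open>The jump relation for a conservation law\<close>

text \<open>
  The inner quantifier ranges over the first variable, since a curve \<open>x = \<phi> t\<close> is negligible for the
  reason that it meets each horizontal line in one point.
\<close>

lemma AE_prod_sectionsI:
  assumes P: "{z. P z} \<in> sets (borel :: (real \<times> real) measure)" and AE: "AE t in lborel. AE y in lborel. P (y, t)"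
  shows "AE z in (lborel :: (real \<times> real) measure). P z"
proof -
  have swap[measurable]: "(\<lambda>(x, y). (y, x)) \<in> (lborel \<Otimes>\<^sub>M lborel :: (real\<times>real) measure) \<rightarrow>\<^sub>M (lborel \<Otimes>\<^sub>M lborel)"
    by measurable
  have S: "{z \<in> space (lborel \<Otimes>\<^sub>M lborel). P z} \<in> sets (lborel \<Otimes>\<^sub>M lborel :: (real\<times>real) measure)"
  proof -
    have *: "sets (lborel \<Otimes>\<^sub>M lborel) = sets (borel :: (real\<times>real) measure)" by (subst lborel_prod) simp
    show ?thesis unfolding * using P by (simp add: space_pair_measure)
  qed
  have "{x \<in> space (lborel \<Otimes>\<^sub>M lborel). P (case x of (x, y) \<Rightarrow> (y, x))} \<in> sets (lborel \<Otimes>\<^sub>M lborel :: (real\<times>real) measure)"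
    using measurable_sets[OF swap S] by (simp add: vimage_def Int_def space_pair_measure conj_commute)
  then have "AE x in (lborel \<Otimes>\<^sub>M lborel). P (case x of (x, y) \<Rightarrow> (y, x))"
    by (rule lborel_pair.AE_pair_measure) (use AE in simp)
  then have "AE z in distr (lborel \<Otimes>\<^sub>M lborel) (lborel \<Otimes>\<^sub>M lborel) (\<lambda>(x, y). (y, x)). P z"
    using AE_distr_iff[OF swap S] by simp
  then have "AE z in (lborel \<Otimes>\<^sub>M lborel). P z" using lborel_pair.distr_pair_swap by metis
  then show ?thesis by (subst (asm) lborel_prod)
qed

text \<open>
  Test the conservation law \<open>u\<^sub>t + G\<^sub>x = 0\<close> with \<open>A (n * (x - \<phi> t)) * q t\<close> and let \<open>n\<close> tend to infinity.  The
  derivatives of the first factor produce the kernel of the blow-up lemma, which turns \<open>G - \<phi>\<^sub>t u\<close> into its jump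
  on almost every horizontal line; the term with \<open>deriv q\<close> vanishes in the limit.  Passing to the limit under the
  integral over \<open>t\<close> needs a bound of \<open>G\<close>, which contains the square of \<open>u\<close>, by an integrable function of \<open>t\<close>.
  Traces of \<open>u\<close> need not be square integrable, but \<open>G\<^sub>x = - u\<^sub>t\<close> is itself a measure, so that
  the slicing bound applies to \<open>G\<close> directly.
\<close>

lemma interface_jump_relation_strip:
  fixes \<phi> :: "real \<Rightarrow> real" and u G :: "real \<times> real \<Rightarrow> real"
  assumes \<phi>: "smooth_on {0<..} \<phi>" and cd: "0 < c" "c < d"
    and u: "locally_integrable half_plane u" "has_distr_deriv half_plane (1, 0) u \<mu>"
    and G: "locally_integrable half_plane G" "has_distr_deriv half_plane (1, 0) G \<nu>"
    and weak: "\<And>\<theta>. \<theta> \<in> test_functions half_plane \<Longrightarrow>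
      (LINT p:half_plane|lborel. u p * partial (0, 1) \<theta> p + G p * partial (1, 0) \<theta> p) = 0"
  shows "AE t in lborel. t \<in> {c<..<d} \<longrightarrow> (\<exists>l r l' r'. has_left_value u (\<phi> t) t l \<and> has_right_value u (\<phi> t) t r \<and>
     has_left_value G (\<phi> t) t l' \<and> has_right_value G (\<phi> t) t r' \<and> l' - r' = deriv \<phi> t * (l - r))"
proof -
  have sub: "{c..d} \<subseteq> {0<..}" using cd by auto
  have "continuous_on {c..d} \<phi>" "continuous_on {c..d} (deriv \<phi>)"
    using smooth_on_continuous[OF \<phi>] smooth_real_deriv(2)[OF \<phi>] sub by (auto intro: continuous_on_subset)
  then have bnd: "bounded (\<phi> ` {c..d})" "bounded (deriv \<phi> ` {c..d})"
    by (auto intro!: compact_imp_bounded compact_continuous_image)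
  obtain B where "\<forall>t\<in>{c..d}. \<bar>\<phi> t\<bar> \<le> B" using bnd(1) by (auto simp: bounded_iff)
  then have B: "\<bar>\<phi> t\<bar> \<le> B" if "t \<in> {c<..<d}" for t using that by auto
  obtain C where "\<forall>t\<in>{c..d}. \<bar>deriv \<phi> t\<bar> \<le> C" using bnd(2) by (auto simp: bounded_iff)
  then have C: "\<bar>deriv \<phi> t\<bar> \<le> C" if "t \<in> {c<..<d}" for t using that by auto
  have "(c + d) / 2 \<in> {c<..<d}" using cd by (auto simp: field_simps)
  from B[OF this] C[OF this] have BC0: "0 \<le> B" "0 \<le> C" by linarith+
  \<comment> \<open>Nothing is known about \<open>\<phi>\<close> outside the positive times; cutting it off makes it a Borel function.\<close>
  define \<phi>0 d\<phi> where "\<phi>0 t = indicator {c<..<d} t * \<phi> t" and "d\<phi> t = indicator {c<..<d} t * deriv \<phi> t" for t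
  have sub': "{c<..<d} \<subseteq> {0<..}" using cd by auto
  have "continuous_on {c<..<d} \<phi>" "continuous_on {c<..<d} (deriv \<phi>)"
    using smooth_on_continuous[OF \<phi>] smooth_real_deriv(2)[OF \<phi>] sub' by (auto intro: continuous_on_subset)
  then have [measurable]: "\<phi>0 \<in> borel_measurable borel" "d\<phi> \<in> borel_measurable borel"
    using borel_measurable_continuous_on_indicator[of "{c<..<d}" \<phi>]
      borel_measurable_continuous_on_indicator[of "{c<..<d}" "deriv \<phi>"]
    by (auto simp: \<phi>0_def[abs_def] d\<phi>_def[abs_def])
  have d\<phi>_le: "\<bar>d\<phi> t\<bar> \<le> C" for t using C BC0 by (auto simp: d\<phi>_def indicator_def)
  define a b where "a = - B - 2" and "b = B + 2"
  have "a < b" using BC0 by (simp add: a_def b_def)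
  have \<phi>ab: "\<phi> t \<in> {a<..<b}" if "t \<in> {c<..<d}" for t using B[OF that] by (auto simp: a_def b_def)
  let ?B = "{a<..<b} \<times> {c<..<d}"
  have [measurable]: "?B \<in> sets borel" by (simp add: borel_Times)
  have Bsub: "?B \<subseteq> {a..b} \<times> {c..d}" "?B \<subseteq> half_plane" using cd by (auto simp: half_plane_def)
  obtain H1 where H1: "integrable lborel H1"
    "AE t in lborel. t \<in> {c<..<d} \<longrightarrow> (AE y in lborel. y \<in> {a<..<b} \<longrightarrow> \<bar>u (y, t)\<bar> \<le> H1 t)"
    "AE t in lborel. t \<in> {c<..<d} \<longrightarrow> (\<forall>x\<in>{a<..<b}. (\<exists>l. has_left_value u x t l) \<and> (\<exists>r. has_right_value u x t r))"
    using x_derivative_measure_regularity[OF \<open>a < b\<close> cd(1) u, of d] by blast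
  obtain H2 where H2: "integrable lborel H2"
    "AE t in lborel. t \<in> {c<..<d} \<longrightarrow> (AE y in lborel. y \<in> {a<..<b} \<longrightarrow> \<bar>G (y, t)\<bar> \<le> H2 t)"
    "AE t in lborel. t \<in> {c<..<d} \<longrightarrow> (\<forall>x\<in>{a<..<b}. (\<exists>l. has_left_value G x t l) \<and> (\<exists>r. has_right_value G x t r))"
    using x_derivative_measure_regularity[OF \<open>a < b\<close> cd(1) G, of d] by blast
  note iBox = locally_integrable_box[OF cd(1), of _ a b d]
  define U where "U z = indicat_real ?B z * u z" for z
  define F where "F z = indicat_real ?B z * G z - d\<phi> (snd z) * U z" for z
  have iU: "integrable lborel U" unfolding U_def by (rule iBox[OF u(1)])
  have [measurable]: "U \<in> borel_measurable borel" using iU by auto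
  have idU: "integrable lborel (\<lambda>z. d\<phi> (snd z) * U z)"
    by (rule Bochner_Integration.integrable_bound[of _ "\<lambda>z. C * U z"])
      (use iU d\<phi>_le BC0 in \<open>auto simp: abs_mult intro!: mult_right_mono\<close>)
  have iF: "integrable lborel F"
    unfolding F_def by (rule Bochner_Integration.integrable_diff[OF iBox[OF G(1)] idU])
  have [measurable]: "F \<in> borel_measurable borel" using iF by auto
  \<comment> \<open>Any test function on this interval with value 1 at 0 would do; \<open>Ak n\<close> is its concentration and \<open>T n\<close> the derivative of that.\<close>
  define A where "A = cutoff (-1) 1 2"
  have A: "A \<in> test_functions {-1<..<1}" unfolding A_def by (rule cutoff_test) simp
  have A0: "A 0 = 1" unfolding A_def by (rule cutoff_eq_1) auto
  define k where "k n = real (Suc n)" for n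
  have k: "k n \<ge> 1" for n by (simp add: k_def)
  define Ak where "Ak n x = A (k n * x)" for n x
  define T where "T n x = k n * deriv A (k n * x)" for n x
  have Ak: "Ak n \<in> test_functions {-1<..<1}" "deriv (Ak n) = T n" for n
  proof -
    have "1 / k n \<le> 1" using k[of n] by (simp add: field_simps)
    then show "Ak n \<in> test_functions {-1<..<1}"
      using scaled_test_function(1)[OF A k, of n 0] unfolding Ak_def[abs_def] by (auto elim!: test_functions_mono)
    show "deriv (Ak n) = T n"
      using scaled_test_function(2)[OF A k, of n 0] by (simp add: Ak_def[abs_def] T_def[abs_def])
  qed
  have T: "T n \<in> test_functions {-1<..<1}" for n
    using test_functions_deriv(2)[OF Ak(1), of n] unfolding Ak(2) .
  have [measurable]: "T n \<in> borel_measurable borel" "Ak n \<in> borel_measurable borel" for n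
    using test_functions_borel T Ak by auto
  have Tout: "T n x = 0" "Ak n x = 0" if "\<bar>x\<bar> \<ge> 1" for n x
    using that by (auto intro!: test_functions_outside[OF T] test_functions_outside[OF Ak(1)])
  define N where "N = (\<integral>x. \<bar>deriv A x\<bar> \<partial>lborel)"
  have N: "(\<integral>x. \<bar>T n (x - y)\<bar> \<partial>lborel) = N" for n y
    unfolding T_def N_def by (rule scaled_test_function(3)[OF A k])
  have iT: "integrable lborel (\<lambda>x. T n (x - y))" for n y
    using lborel_integrable_real_affine[OF integrable_test[OF T[of n]], where c=1 and t="- y"] by simp
  define I where "I n t = (\<integral>y. F (y, t) * T n (y - \<phi>0 t) \<partial>lborel)" for n t
  have [measurable]: "I n \<in> borel_measurable borel" for n
    unfolding I_def by measurable
  \<comment> \<open>The limit is taken pointwise, so that it is measurable; that it is the jump of the flux is known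
    almost everywhere.\<close>
  define J where "J t = lim (\<lambda>n. I n t)" for t
  have [measurable]: "J \<in> borel_measurable borel" unfolding J_def by measurable
  define D where "D t = (\<bar>H2 t\<bar> + C * \<bar>H1 t\<bar>) * N" for t
  have iD: "integrable lborel D" unfolding D_def using H1(1) H2(1) by simp
  have F_out: "F (y, t) = 0" if "t \<notin> {c<..<d} \<or> y \<notin> {a<..<b}" for y t using that by (auto simp: F_def U_def)
  have I_out: "I n t = 0" if "t \<notin> {c<..<d}" for n t unfolding I_def using F_out that by simp
  have F_in: "F (y, t) = indicator {a<..<b} y * (G (y, t) - deriv \<phi> t * u (y, t))" if "t \<in> {c<..<d}" for y t
    using that by (auto simp: F_def U_def d\<phi>_def indicator_def)
  have F_bound: "AE t in lborel. AE y in lborel. \<bar>F (y, t)\<bar> \<le> \<bar>H2 t\<bar> + C * \<bar>H1 t\<bar>"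
    using H1(2) H2(2)
  proof eventually_elim
    case (elim t)
    show ?case
    proof (cases "t \<in> {c<..<d}")
      case True
      from elim(1)[rule_format, OF True] elim(2)[rule_format, OF True] show ?thesis
      proof eventually_elim
        case (elim y)
        show ?case
        proof (cases "y \<in> {a<..<b}")
          case yab: True
          have "\<bar>deriv \<phi> t * u (y, t)\<bar> \<le> C * \<bar>H1 t\<bar>"
            unfolding abs_mult using C[OF True] elim yab BC0 by (intro mult_mono) auto
          then show ?thesis using elim yab True by (auto simp: F_in)
        qed (use F_out BC0 in auto)
      qed
    qed (use F_out BC0 in auto)
  qed
  have I_bound: "AE t in lborel. norm (I n t) \<le> D t" for n
    using F_bound
  proof eventually_elim
    case (elim t)
    have i: "integrable lborel (\<lambda>y. (\<bar>H2 t\<bar> + C * \<bar>H1 t\<bar>) * \<bar>T n (y - \<phi>0 t)\<bar>)" using iT by simp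
    have le: "AE y in lborel. norm (F (y, t) * T n (y - \<phi>0 t)) \<le> (\<bar>H2 t\<bar> + C * \<bar>H1 t\<bar>) * \<bar>T n (y - \<phi>0 t)\<bar>"
      using elim by eventually_elim (auto simp: abs_mult intro!: mult_right_mono)
    have i2: "integrable lborel (\<lambda>y. norm (F (y, t) * T n (y - \<phi>0 t)))"
      by (rule Bochner_Integration.integrable_bound[OF i]) (use le BC0 in \<open>auto elim!: eventually_mono\<close>)
    have "norm (I n t) \<le> (\<integral>y. norm (F (y, t) * T n (y - \<phi>0 t)) \<partial>lborel)"
      unfolding I_def by (rule integral_norm_bound)
    also have "\<dots> \<le> (\<integral>y. (\<bar>H2 t\<bar> + C * \<bar>H1 t\<bar>) * \<bar>T n (y - \<phi>0 t)\<bar> \<partial>lborel)"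
      by (rule integral_mono_AE[OF i2 i le])
    also have "\<dots> = D t" using N by (simp add: D_def)
    finally show ?case .
  qed
  have limits: "AE t in lborel. t \<in> {c<..<d} \<longrightarrow> (\<exists>l r l' r'. has_left_value u (\<phi> t) t l \<and> has_right_value u (\<phi> t) t r \<and>
     has_left_value G (\<phi> t) t l' \<and> has_right_value G (\<phi> t) t r' \<and>
     (\<lambda>n. I n t) \<longlonglongrightarrow> (l' - r') - deriv \<phi> t * (l - r))"
    using H1(3) H2(3) F_bound
  proof eventually_elim
    case (elim t)
    show ?case
    proof
      assume t: "t \<in> {c<..<d}"
      obtain l r l' r' where lr: "has_left_value u (\<phi> t) t l" "has_right_value u (\<phi> t) t r"
        "has_left_value G (\<phi> t) t l'" "has_right_value G (\<phi> t) t r'"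
        using elim t \<phi>ab[OF t] by blast
      define f where "f y = G (y, t) - deriv \<phi> t * u (y, t)" for y
      have L: "(f \<longlongrightarrow> l' - deriv \<phi> t * l) (ess_at_left (\<phi> t))" "(f \<longlongrightarrow> r' - deriv \<phi> t * r) (ess_at_right (\<phi> t))"
        unfolding f_def[abs_def] using lr unfolding has_left_value_def has_right_value_def by (auto intro!: tendsto_intros)
      have Ff: "F (y, t) = indicator {a<..<b} y * f y" for y using F_in[OF t] by (simp add: f_def)
      have "integrable lborel (\<lambda>y. (\<bar>H2 t\<bar> + C * \<bar>H1 t\<bar>) * indicator {a<..<b} y)" by simp
      then have "integrable lborel (\<lambda>y. F (y, t))"
      proof (rule Bochner_Integration.integrable_bound)
        show "AE y in lborel. norm (F (y, t)) \<le> norm ((\<bar>H2 t\<bar> + C * \<bar>H1 t\<bar>) * indicator {a<..<b} y)"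
          using elim(3) by eventually_elim (auto simp: Ff indicator_def)
      qed measurable
      then have f: "set_integrable lborel {a<..<b} f" unfolding set_integrable_def Ff by simp
      have "\<phi>0 t = \<phi> t" using t by (simp add: \<phi>0_def)
      then have "I n t = (\<integral>x. (indicator {a<..<b} x * f x) * (real (Suc n) * deriv A (real (Suc n) * (x - \<phi> t))) \<partial>lborel)" for n
        unfolding I_def Ff T_def k_def by simp
      then have "(\<lambda>n. I n t) \<longlonglongrightarrow> ((l' - deriv \<phi> t * l) - (r' - deriv \<phi> t * r)) * A 0"
        using jump_of_blow_up[OF A \<phi>ab[OF t] f L] by simp
      moreover have "((l' - deriv \<phi> t * l) - (r' - deriv \<phi> t * r)) * A 0 = (l' - r') - deriv \<phi> t * (l - r)"
        by (simp add: A0 algebra_simps)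
      ultimately have "(\<lambda>n. I n t) \<longlonglongrightarrow> (l' - r') - deriv \<phi> t * (l - r)" by simp
      with lr show "\<exists>l r l' r'. has_left_value u (\<phi> t) t l \<and> has_right_value u (\<phi> t) t r \<and>
         has_left_value G (\<phi> t) t l' \<and> has_right_value G (\<phi> t) t r' \<and>
         (\<lambda>n. I n t) \<longlonglongrightarrow> (l' - r') - deriv \<phi> t * (l - r)" by blast
    qed
  qed
  have IJ: "AE t in lborel. (\<lambda>n. I n t) \<longlonglongrightarrow> J t"
    using limits
  proof eventually_elim
    case (elim t)
    show ?case
    proof (cases "t \<in> {c<..<d}")
      case True
      then have "convergent (\<lambda>n. I n t)" using elim by (auto simp: convergent_def)
      then show ?thesis unfolding J_def by (simp add: convergent_LIMSEQ_iff)
    next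
      case False
      then have "(\<lambda>n. I n t) = (\<lambda>n. 0)" using I_out by auto
      then show ?thesis unfolding J_def by simp
    qed
  qed
  have iJ: "integrable lborel J"
    by (rule integrable_dominated_convergence[where s=I and w=D]) (use iD IJ I_bound in auto)
  have "AE t in lborel. t \<in> {c<..<d} \<longrightarrow> J t = 0"
  proof (rule fundamental_lemma)
    show "set_integrable lborel {c<..<d} J"
      unfolding set_integrable_def by (rule integrable_mult_indicator[OF _ iJ]) simp
    fix q assume q: "q \<in> test_functions {c<..<d}"
    have [measurable]: "q \<in> borel_measurable borel" "deriv q \<in> borel_measurable borel"
      using test_functions_borel[OF q] test_functions_borel[OF test_functions_deriv(2)[OF q]] .
    obtain Q where Q: "\<And>x. \<bar>q x\<bar> \<le> Q" "Q \<ge> 0" using test_functions_bounded[OF q] by metis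
    obtain Q' where Q': "\<And>x. \<bar>deriv q x\<bar> \<le> Q'" "Q' \<ge> 0"
      using test_functions_bounded[OF test_functions_deriv(2)[OF q]] by metis
    have 1: "(\<lambda>n. \<integral>t. q t * I n t \<partial>lborel) \<longlonglongrightarrow> (\<integral>t. q t * J t \<partial>lborel)"
    proof (rule integral_dominated_convergence[where w="\<lambda>t. Q * D t"])
      show "AE t in lborel. (\<lambda>n. q t * I n t) \<longlonglongrightarrow> q t * J t"
        using IJ by eventually_elim (rule tendsto_mult_left)
      show "AE t in lborel. norm (q t * I n t) \<le> Q * D t" for n
        using I_bound[of n] by eventually_elim (use Q in \<open>auto simp: abs_mult intro!: mult_mono\<close>)
    qed (use iD in auto)
    have eq: "(\<integral>t. q t * I n t \<partial>lborel) = - (\<integral>z. U z * Ak n (fst z - \<phi>0 (snd z)) * deriv q (snd z) \<partial>lborel)" for n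
    proof -
      define \<theta> where "\<theta> = (\<lambda>z. Ak n (fst z - \<phi> (snd z)) * q (snd z))"
      have AkU: "Ak n \<in> test_functions UNIV" using Ak(1) test_functions_mono by blast
      note \<theta> = curve_test_function[OF \<phi> AkU q cd, folded \<theta>_def]
      obtain S where S: "\<And>x. \<bar>T n x\<bar> \<le> S" "S \<ge> 0" using test_functions_bounded[OF T] by metis
      obtain S' where S': "\<And>x. \<bar>Ak n x\<bar> \<le> S'" "S' \<ge> 0" using test_functions_bounded[OF Ak(1)] by metis
      have iFT: "integrable lborel (\<lambda>z. q (snd z) * (F z * T n (fst z - \<phi>0 (snd z))))"
      proof (rule Bochner_Integration.integrable_bound[of _ "\<lambda>z. (Q * S) * F z"])
        have "\<bar>q t\<bar> * (\<bar>f\<bar> * \<bar>T n x\<bar>) \<le> Q * S * \<bar>f\<bar>" for t x f :: real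
          using mult_mono[OF Q(1) S(1), of x t] Q(2) mult_right_mono[of "\<bar>q t\<bar> * \<bar>T n x\<bar>" "Q * S" "\<bar>f\<bar>"] by (simp add: mult_ac)
        then show "AE z in lborel. norm (q (snd z) * (F z * T n (fst z - \<phi>0 (snd z)))) \<le> norm (Q * S * F z)"
          using Q S by (auto simp: abs_mult)
      qed (use iF in auto)
      have iUA: "integrable lborel (\<lambda>z. U z * Ak n (fst z - \<phi>0 (snd z)) * deriv q (snd z))"
      proof (rule Bochner_Integration.integrable_bound[of _ "\<lambda>z. (S' * Q') * U z"])
        have "\<bar>f\<bar> * \<bar>Ak n x\<bar> * \<bar>deriv q t\<bar> \<le> S' * Q' * \<bar>f\<bar>" for t x f :: real
          using mult_mono[OF S'(1) Q'(1), of t x] S'(2) mult_right_mono[of "\<bar>Ak n x\<bar> * \<bar>deriv q t\<bar>" "S' * Q'" "\<bar>f\<bar>"] by (simp add: mult_ac)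
        then show "AE z in lborel. norm (U z * Ak n (fst z - \<phi>0 (snd z)) * deriv q (snd z)) \<le> norm (S' * Q' * U z)"
          using S' Q' by (auto simp: abs_mult)
      qed (use iU in auto)
      have "0 = (LINT p:half_plane|lborel. u p * partial (0, 1) \<theta> p + G p * partial (1, 0) \<theta> p)"
        using weak[OF \<theta>(1)] by simp
      also have "\<dots> = (\<integral>z. q (snd z) * (F z * T n (fst z - \<phi>0 (snd z))) + U z * Ak n (fst z - \<phi>0 (snd z)) * deriv q (snd z) \<partial>lborel)"
        unfolding set_lebesgue_integral_def
      proof (rule Bochner_Integration.integral_cong)
        fix z :: "real \<times> real"
        obtain x t where z: "z = (x, t)" by (cases z)
        show "indicat_real half_plane z *\<^sub>R (u z * partial (0, 1) \<theta> z + G z * partial (1, 0) \<theta> z) =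
          q (snd z) * (F z * T n (fst z - \<phi>0 (snd z))) + U z * Ak n (fst z - \<phi>0 (snd z)) * deriv q (snd z)"
        proof (cases "t \<in> {c<..<d}")
          case True
          then have h: "z \<in> half_plane" "\<phi>0 t = \<phi> t" using cd by (auto simp: z half_plane_def \<phi>0_def)
          show ?thesis
          proof (cases "x \<in> {a<..<b}")
            case x: True
            then show ?thesis
              using h True unfolding \<theta>(2)[OF h(1)] \<theta>(3)[OF h(1)] Ak(2)
              by (simp add: z F_in U_def algebra_simps)
          next
            case False
            then have "\<bar>x - \<phi> t\<bar> \<ge> 1" using B[OF True] by (auto simp: a_def b_def)
            then show ?thesis
              using h True False Tout unfolding \<theta>(2)[OF h(1)] \<theta>(3)[OF h(1)] Ak(2)
              by (simp add: z F_in U_def)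
          qed
        next
          case False
          then have "q t = 0" "deriv q t = 0"
            using test_functions_outside[OF q] test_functions_outside[OF test_functions_deriv(2)[OF q]] by auto
          then show ?thesis using \<theta>(2)[of z] \<theta>(3)[of z] by (auto simp: z indicator_def)
        qed
      qed simp
      also have "\<dots> = (\<integral>z. q (snd z) * (F z * T n (fst z - \<phi>0 (snd z))) \<partial>lborel) + (\<integral>z. U z * Ak n (fst z - \<phi>0 (snd z)) * deriv q (snd z) \<partial>lborel)"
        by (rule Bochner_Integration.integral_add[OF iFT iUA])
      also have "(\<integral>z. q (snd z) * (F z * T n (fst z - \<phi>0 (snd z))) \<partial>lborel) = (\<integral>t. q t * I n t \<partial>lborel)"
      proof -
        have "integrable (lborel \<Otimes>\<^sub>M lborel) (\<lambda>(y, t). q t * (F (y, t) * T n (y - \<phi>0 t)))"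
          using iFT by (simp add: lborel_prod case_prod_beta')
        from lborel_pair.integral_snd[OF this] show ?thesis
          by (simp add: lborel_prod case_prod_beta' I_def)
      qed
      finally show ?thesis by simp
    qed
    have 2: "(\<lambda>n. \<integral>z. U z * Ak n (fst z - \<phi>0 (snd z)) * deriv q (snd z) \<partial>lborel) \<longlonglongrightarrow> (\<integral>z. 0 \<partial>(lborel :: (real\<times>real) measure))"
    proof (rule integral_dominated_convergence[where w="\<lambda>z. Q' * \<bar>U z\<bar>"])
      have "AE z in (lborel :: (real\<times>real) measure). fst z \<noteq> \<phi>0 (snd z)"
      proof (rule AE_prod_sectionsI)
        have "{z :: real\<times>real. fst z \<noteq> \<phi>0 (snd z)} = {z \<in> space borel. fst z \<noteq> \<phi>0 (snd z)}" by simp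
        also have "\<dots> \<in> sets borel" by measurable
        finally show "{z :: real\<times>real. fst z \<noteq> \<phi>0 (snd z)} \<in> sets borel" .
        show "AE t in lborel. AE y in lborel. fst (y, t) \<noteq> \<phi>0 (snd (y, t))"
          using AE_lborel_singleton by auto
      qed
      then show "AE z in lborel. (\<lambda>n. U z * Ak n (fst z - \<phi>0 (snd z)) * deriv q (snd z)) \<longlonglongrightarrow> 0"
      proof eventually_elim
        case (elim z)
        define e where "e = \<bar>fst z - \<phi>0 (snd z)\<bar>"
        have "e > 0" using elim by (simp add: e_def)
        then obtain no where no: "1 / real (Suc no) < e" using nat_approx_posE by blast
        have "Ak n (fst z - \<phi>0 (snd z)) = 0" if "n \<ge> no" for n
          unfolding Ak_def
        proof (rule test_functions_outside[OF A])
          have "1 / k n \<le> 1 / real (Suc no)" using that by (simp add: k_def frac_le)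
          then have "1 / k n < e" using no by linarith
          then have "1 < k n * e" using k[of n] by (simp add: field_simps)
          then have "1 < \<bar>k n * (fst z - \<phi>0 (snd z))\<bar>" using k[of n] by (simp add: abs_mult e_def)
          then show "k n * (fst z - \<phi>0 (snd z)) \<notin> {-1<..<1}" by auto
        qed
        then have "eventually (\<lambda>n. 0 = U z * Ak n (fst z - \<phi>0 (snd z)) * deriv q (snd z)) sequentially"
          unfolding eventually_sequentially by auto
        then show ?case by (rule Lim_transform_eventually[OF tendsto_const])
      qed
      show "AE z in lborel. norm (U z * Ak n (fst z - \<phi>0 (snd z)) * deriv q (snd z)) \<le> Q' * \<bar>U z\<bar>" for n
      proof (rule AE_I2)
        fix z
        have "\<bar>Ak n x\<bar> \<le> 1" for x using cutoff_range by (simp add: Ak_def A_def)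
        from mult_mono[OF this Q'(1), of "snd z" "fst z - \<phi>0 (snd z)"]
        have "\<bar>Ak n (fst z - \<phi>0 (snd z))\<bar> * \<bar>deriv q (snd z)\<bar> \<le> Q'" by simp
        from mult_left_mono[OF this, of "\<bar>U z\<bar>"]
        show "norm (U z * Ak n (fst z - \<phi>0 (snd z)) * deriv q (snd z)) \<le> Q' * \<bar>U z\<bar>" by (simp add: abs_mult mult_ac)
      qed
    qed (use iU in auto)
    have "(\<lambda>n. \<integral>t. q t * I n t \<partial>lborel) \<longlonglongrightarrow> 0"
      unfolding eq using tendsto_minus[OF 2] by simp
    with 1 show "(\<integral>t. q t * J t \<partial>lborel) = 0" by (rule LIMSEQ_unique)
  qed
  with limits IJ show ?thesis
  proof eventually_elim
    case (elim t)
    show ?case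
    proof
      assume t: "t \<in> {c<..<d}"
      obtain l r l' r' where lr: "has_left_value u (\<phi> t) t l" "has_right_value u (\<phi> t) t r"
        "has_left_value G (\<phi> t) t l'" "has_right_value G (\<phi> t) t r'"
        "(\<lambda>n. I n t) \<longlonglongrightarrow> (l' - r') - deriv \<phi> t * (l - r)" using elim t by blast
      have "(l' - r') - deriv \<phi> t * (l - r) = 0"
        using LIMSEQ_unique[OF lr(5) elim(2)] elim(3) t by simp
      with lr show "\<exists>l r l' r'. has_left_value u (\<phi> t) t l \<and> has_right_value u (\<phi> t) t r \<and>
        has_left_value G (\<phi> t) t l' \<and> has_right_value G (\<phi> t) t r' \<and> l' - r' = deriv \<phi> t * (l - r)"
        by (metis eq_iff_diff_eq_0)
    qed
  qed
qed

section \<open>The spatial derivative of a step across a curve\<close>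

lemma curve_measure:
  fixes \<phi>0 :: "real \<Rightarrow> real" and c d :: real
  assumes [measurable]: "\<phi>0 \<in> borel_measurable borel"
  defines "\<nu> \<equiv> distr (density lborel (\<lambda>t. ennreal (indicat_real {c<..<d} t))) borel (\<lambda>t. (\<phi>0 t, t))"
  shows "finite_measure \<nu>" "sets \<nu> = sets borel" "space \<nu> = UNIV"
    and "\<And>f. f \<in> borel_measurable borel \<Longrightarrow> (\<integral>z. f z \<partial>\<nu>) = (LINT t:{c<..<d}|lborel. f (\<phi>0 t, t) :: real)"
    and "\<And>f. f \<in> borel_measurable borel \<Longrightarrow> integrable \<nu> f \<longleftrightarrow> set_integrable lborel {c<..<d} (\<lambda>t. f (\<phi>0 t, t) :: real)"
proof -
  have [measurable]: "(\<lambda>t. (\<phi>0 t, t)) \<in> lborel \<rightarrow>\<^sub>M borel" by measurable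
  show "sets \<nu> = sets borel" and sp: "space \<nu> = UNIV" by (simp_all add: \<nu>_def)
  have "emeasure \<nu> UNIV = (\<integral>\<^sup>+t. ennreal (indicat_real {c<..<d} t) \<partial>lborel)"
    unfolding \<nu>_def by (subst emeasure_distr) (auto simp: emeasure_density intro!: nn_integral_cong)
  also have "\<dots> < \<infinity>"
    using integrable_indicator_Ioo[of c d] by (simp add: integrable_iff_bounded)
  finally show "finite_measure \<nu>" by (intro finite_measureI) (simp add: sp)
  fix f :: "real \<times> real \<Rightarrow> real" assume [measurable]: "f \<in> borel_measurable borel"
  show "(\<integral>z. f z \<partial>\<nu>) = (LINT t:{c<..<d}|lborel. f (\<phi>0 t, t))"
    unfolding \<nu>_def set_lebesgue_integral_def
    by (subst integral_distr, measurable, subst integral_density) auto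
  show "integrable \<nu> f \<longleftrightarrow> set_integrable lborel {c<..<d} (\<lambda>t. f (\<phi>0 t, t))"
    unfolding \<nu>_def set_integrable_def
    by (subst integrable_distr_eq, measurable, subst integrable_density) auto
qed

text \<open>
  If \<open>s \<ge> 0\<close> then \<open>M2\<close> is dominated by \<open>M1\<close>; mutual singularity forces \<open>M2\<close> to vanish and \<open>M1\<close> to be \<open>s\<close> times \<open>\<nu>\<close>.
  For negative \<open>s\<close> the roles are exchanged.  So integrals of Borel functions can be transferred.
\<close>

lemma singular_difference_multiple:
  fixes M1 M2 \<nu> :: "'a::euclidean_space measure" and s :: real
  assumes fin: "finite_measure M1" "finite_measure M2" "finite_measure \<nu>"
    and sets: "sets M1 = sets borel" "sets M2 = sets borel" "sets \<nu> = sets borel"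
    and singular: "A \<in> sets borel" "emeasure M1 (- A) = 0" "emeasure M2 A = 0"
    and eq: "\<And>S. S \<in> sets borel \<Longrightarrow> measure M1 S - measure M2 S = s * measure \<nu> S"
    and f: "f \<in> borel_measurable borel" "integrable M1 f" "integrable M2 f"
  shows "integrable \<nu> (\<lambda>z. s * f z)" "(\<integral>z. f z \<partial>M1) - (\<integral>z. f z \<partial>M2) = (\<integral>z. s * f z \<partial>\<nu> :: real)"
proof -
  interpret M1: finite_measure M1 by fact
  interpret M2: finite_measure M2 by fact
  interpret \<nu>: finite_measure \<nu> by fact
  have [measurable]: "f \<in> borel_measurable \<nu>" using f(1) measurable_cong_sets[OF sets(3) refl] by blast
  have cA: "- A \<in> sets borel" using singular(1) by (rule borel_comp)
  have split: "measure M S = measure M (S \<inter> A) + measure M (S \<inter> - A)"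
    if "finite_measure M" "sets M = sets borel" "S \<in> sets borel" for M :: "'a measure" and S
    using finite_measure.finite_measure_Union[OF that(1), of "S \<inter> A" "S \<inter> - A"] that singular(1) cA
    by (auto simp: Int_Un_distrib[symmetric] sets.Int)
  have M1A: "measure M1 (S \<inter> - A) = 0" if "S \<in> sets borel" for S
    using emeasure_mono[of "S \<inter> - A" "- A" M1] singular(2) cA by (simp add: sets measure_def)
  have M2A: "measure M2 (S \<inter> A) = 0" if "S \<in> sets borel" for S
    using emeasure_mono[of "S \<inter> A" A M2] singular(1,3) by (simp add: sets measure_def)
  have 1: "measure M1 S = max s 0 * measure \<nu> S" and 2: "measure M2 S = max (- s) 0 * measure \<nu> S"
    if S: "S \<in> sets borel" for S
  proof -
    have SA: "S \<inter> A \<in> sets borel" "S \<inter> - A \<in> sets borel" using S singular(1) cA by auto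
    have e1: "measure M1 S = s * measure \<nu> (S \<inter> A)"
      using split[OF fin(1) sets(1) S] eq[OF SA(1)] M1A[OF S] M2A[OF S] by simp
    have e2: "measure M2 S = - s * measure \<nu> (S \<inter> - A)"
      using split[OF fin(2) sets(2) S] eq[OF SA(2)] M1A[OF S] M2A[OF S] by simp
    have e3: "measure \<nu> S = measure \<nu> (S \<inter> A) + measure \<nu> (S \<inter> - A)"
      by (rule split[OF fin(3) sets(3) S])
    show "measure M1 S = max s 0 * measure \<nu> S" "measure M2 S = max (- s) 0 * measure \<nu> S"
    proof (atomize (full), cases "s \<ge> 0")
      case True
      have "0 \<le> - s * measure \<nu> (S \<inter> - A)" using measure_nonneg[of M2 S] e2 by simp
      then have "s * measure \<nu> (S \<inter> - A) = 0"
        using True mult_nonneg_nonneg[OF True measure_nonneg[of \<nu> "S \<inter> - A"]] by linarith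
      then show "measure M1 S = max s 0 * measure \<nu> S \<and> measure M2 S = max (- s) 0 * measure \<nu> S"
        using True e1 e2 e3 by (auto simp: distrib_left)
    next
      case False
      have "0 \<le> s * measure \<nu> (S \<inter> A)" using measure_nonneg[of M1 S] e1 by simp
      then have "s * measure \<nu> (S \<inter> A) = 0"
        using False mult_nonpos_nonneg[of s "measure \<nu> (S \<inter> A)"] by (simp add: order_antisym)
      then show "measure M1 S = max s 0 * measure \<nu> S \<and> measure M2 S = max (- s) 0 * measure \<nu> S"
        using False e1 e2 e3 by (auto simp: distrib_left)
    qed
  qed
  have D: "M = density \<nu> (\<lambda>_. ennreal c)"
    if "finite_measure M" "sets M = sets borel" "0 \<le> c" "\<And>S. S \<in> sets borel \<Longrightarrow> measure M S = c * measure \<nu> S"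
    for M :: "'a measure" and c
  proof (rule measure_eqI)
    fix S assume "S \<in> sets M"
    then have "S \<in> sets borel" using that(2) by simp
    then show "emeasure M S = emeasure (density \<nu> (\<lambda>_. ennreal c)) S"
      using that(3,4) finite_measure.emeasure_eq_measure[OF that(1)]
      by (simp add: emeasure_density_const sets \<nu>.emeasure_eq_measure ennreal_mult)
  qed (use that sets in simp)
  have D1: "M1 = density \<nu> (\<lambda>_. ennreal (max s 0))" by (rule D[OF fin(1) sets(1)]) (use 1 in auto)
  have D2: "M2 = density \<nu> (\<lambda>_. ennreal (max (- s) 0))" by (rule D[OF fin(2) sets(2)]) (use 2 in auto)
  have i: "integrable \<nu> (\<lambda>z. max s 0 * f z)" "integrable \<nu> (\<lambda>z. max (- s) 0 * f z)"
    using f(2,3) unfolding D1 D2 by (subst (asm) (1 2) integrable_density; simp)+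
  have s: "s * x = max s 0 * x - max (- s) 0 * x" for x by (simp add: left_diff_distrib[symmetric] max_def)
  show "integrable \<nu> (\<lambda>z. s * f z)" unfolding s using i by simp
  show "(\<integral>z. f z \<partial>M1) - (\<integral>z. f z \<partial>M2) = (\<integral>z. s * f z \<partial>\<nu>)"
    unfolding s using i unfolding D1 D2 by (simp add: integral_density)
qed

lemma test_function_half_line_integral:
  fixes A :: "real \<Rightarrow> real"
  assumes A: "A \<in> test_functions {a<..<b}"
  shows "(\<integral>x. (\<sigma>0 + \<sigma>1 * heaviside (- x + y)) * deriv A (x - x0) \<partial>lborel) = \<sigma>1 * A (y - x0)"
    and "integrable lborel (\<lambda>x. (\<sigma>0 + \<sigma>1 * heaviside (- x + y)) * deriv A (x - x0))"
proof -
  let ?D = "\<lambda>x. deriv A (x - x0)"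
  have i0: "integrable lborel (deriv A)" using integrable_test[OF test_functions_deriv(2)[OF A]] .
  have i: "integrable lborel ?D"
    using lborel_integrable_real_affine[OF i0, where c=1 and t="- x0"] by simp
  have iI: "integrable lborel (\<lambda>x. indicator {y..} x * ?D x)" for y
    using integrable_mult_indicator[OF _ i, of "{y..}"] by simp
  have tail: "(\<integral>x. indicator {y..} x * ?D x \<partial>lborel) = - A (y - x0)" for y
  proof -
    have "(\<integral>x. indicator {y..} x * ?D x \<partial>lborel) = (\<integral>x. indicator {y - x0..} x * deriv A x \<partial>lborel)"
      by (subst lborel_integral_real_affine[where c=1 and t=x0]) (auto simp: indicator_def add.commute intro!: Bochner_Integration.integral_cong)
    then show ?thesis using test_function_tail_integral[OF A] by simp
  qed
  define m where "m = min y (a + x0)"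
  have eq: "(\<sigma>0 + \<sigma>1 * heaviside (- x + y)) * ?D x = (\<sigma>0 + \<sigma>1) * (indicator {m..} x * ?D x) - \<sigma>1 * (indicator {y..} x * ?D x)" for x
  proof (cases "x < m")
    case True
    then have "x - x0 \<notin> {a<..<b}" by (auto simp: m_def)
    then have "?D x = 0" by (rule test_functions_outside[OF test_functions_deriv(2)[OF A]])
    then show ?thesis by simp
  next
    case False
    then show ?thesis by (auto simp: heaviside_def indicator_def algebra_simps m_def)
  qed
  show "integrable lborel (\<lambda>x. (\<sigma>0 + \<sigma>1 * heaviside (- x + y)) * ?D x)" unfolding eq using iI by simp
  have "A (m - x0) = 0" by (rule test_functions_outside[OF A]) (auto simp: m_def)
  then show "(\<integral>x. (\<sigma>0 + \<sigma>1 * heaviside (- x + y)) * ?D x \<partial>lborel) = \<sigma>1 * A (y - x0)"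
    unfolding eq using iI tail by simp
qed

text \<open>
  The \<open>x\<close>-derivative of the step \<open>\<sigma>r\<close> is \<open>- \<sigma>1\<close> times the image of \<open>dt\<close> under the curve.  For test functions this
  is immediate, but the identity is needed for integrands like \<open>u_hat u\<close> times a test function, which are
  only Borel.  Hence the two measures have to be identified.
\<close>

lemma signed_integral_step_x:
  fixes \<phi> :: "real \<Rightarrow> real"
  assumes \<phi>: "smooth_on {0<..} \<phi>" and cd: "0 < c" "c < d" and ab: "\<And>t. t \<in> {c<..<d} \<Longrightarrow> \<phi> t \<in> {a<..<b}"
    and form: "\<sigma>r = (\<lambda>(x, t). \<sigma>0 + \<sigma>1 * heaviside (- x + \<phi> t))"
    and deriv: "has_distr_deriv half_plane (1, 0) \<sigma>r \<mu>"
    and loc: "locally_integrable half_plane \<sigma>r"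
    and f: "f \<in> borel_measurable borel" "\<And>z. z \<notin> {a<..<b} \<times> {c<..<d} \<Longrightarrow> f z = 0"
    and int: "signed_integrable half_plane \<mu> f"
  shows "set_integrable lborel {c<..<d} (\<lambda>t. \<sigma>1 * f (\<phi> t, t))"
    and "signed_integral half_plane \<mu> f = - (LINT t:{c<..<d}|lborel. \<sigma>1 * f (\<phi> t, t))"
proof -
  let ?B = "{a<..<b} \<times> {c<..<d}"
  have B[measurable]: "?B \<in> sets borel" by (simp add: borel_Times)
  have "set_integrable lborel {c<..<d} (\<lambda>t. \<sigma>1 * f (\<phi> t, t)) \<and>
    signed_integral half_plane \<mu> f = - (LINT t:{c<..<d}|lborel. \<sigma>1 * f (\<phi> t, t))"
  proof (rule x_derivative_on_box[OF cd(1) loc deriv, of a b d])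
    fix M1 M2 A
    assume fin: "finite_measure M1" "finite_measure M2"
      and sets: "sets M1 = sets borel" "sets M2 = sets borel"
      and conc: "emeasure M1 (- ?B) = 0" "emeasure M2 (- ?B) = 0"
      and singular: "A \<in> sets borel" "emeasure M1 (- A) = 0" "emeasure M2 A = 0"
      and weak: "\<And>p q. p \<in> test_functions {a<..<b} \<Longrightarrow> q \<in> test_functions {c<..<d} \<Longrightarrow>
        (\<integral>z. deriv p (fst z) * q (snd z) * (indicator ?B z * \<sigma>r z) \<partial>lborel) =
        (\<integral>z. p (fst z) * q (snd z) \<partial>M2) - (\<integral>z. p (fst z) * q (snd z) \<partial>M1)"
      and int_iff: "\<And>f. f \<in> borel_measurable borel \<Longrightarrow> (\<And>z. z \<notin> ?B \<Longrightarrow> f z = 0) \<Longrightarrow>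
        signed_integrable half_plane \<mu> f \<longleftrightarrow> integrable M1 f \<and> integrable M2 f"
      and int_eq: "\<And>f. f \<in> borel_measurable borel \<Longrightarrow> (\<And>z. z \<notin> ?B \<Longrightarrow> f z = 0) \<Longrightarrow>
        signed_integral half_plane \<mu> f = (\<integral>z. f z \<partial>M1) - (\<integral>z. f z \<partial>M2)"
    define \<phi>0 where "\<phi>0 t = indicator {c<..<d} t * \<phi> t" for t
    have "{c<..<d} \<subseteq> {0<..}" using cd by auto
    then have "continuous_on {c<..<d} \<phi>" using smooth_on_continuous[OF \<phi>] by (rule continuous_on_subset[rotated])
    then have \<phi>0[measurable]: "\<phi>0 \<in> borel_measurable borel"
      using borel_measurable_continuous_on_indicator[of "{c<..<d}" \<phi>] by (simp add: \<phi>0_def[abs_def])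
    define \<nu> where "\<nu> = distr (density lborel (\<lambda>t. ennreal (indicat_real {c<..<d} t))) borel (\<lambda>t. (\<phi>0 t, t))"
    note \<nu> = curve_measure[OF \<phi>0, where c=c and d=d, folded \<nu>_def]
    have [measurable_cong]: "sets \<nu> = sets borel" by (rule \<nu>(2))
    have on_curve: "(LINT t:{c<..<d}|lborel. g (\<phi>0 t, t)) = (LINT t:{c<..<d}|lborel. g (\<phi> t, t) :: real)" for g
      unfolding set_lebesgue_integral_def
      by (rule Bochner_Integration.integral_cong) (auto simp: \<phi>0_def indicator_def)
    note iL = locally_integrable_box[OF cd(1) loc, of a b d]
    have eq: "measure M1 S - measure M2 S = - \<sigma>1 * measure \<nu> S" if S: "S \<in> sets borel" for S
    proof -
      have "measure M1 S - measure M2 S = (LINT z:S|\<nu>. - \<sigma>1 * indicator ?B z)"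
      proof (rule signed_measure_eqI_test_prod[OF fin sets \<nu>(2) conc _ _ _ S])
        show "- \<sigma>1 * indicator ?B z = 0" if "z \<notin> ?B" for z using that by simp
        show "integrable \<nu> (\<lambda>z. - \<sigma>1 * indicator ?B z)"
          by (rule finite_measure.integrable_const_bound[OF \<nu>(1), of _ "\<bar>\<sigma>1\<bar>"])
            (auto simp: indicator_def)
        fix p q assume p: "p \<in> test_functions {a<..<b}" and q: "q \<in> test_functions {c<..<d}"
        have [measurable]: "p \<in> borel_measurable borel" "q \<in> borel_measurable borel"
          using test_functions_borel[OF p] test_functions_borel[OF q] .
        have i: "integrable (lborel \<Otimes>\<^sub>M lborel) (\<lambda>(x, t). deriv p x * q t * (indicator ?B (x, t) * \<sigma>r (x, t)))"
          using integrable_test_prod_mult[OF test_functions_deriv(2)[OF p] q iL] by (simp add: lborel_prod case_prod_beta')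
        have "(\<integral>z. deriv p (fst z) * q (snd z) * (indicator ?B z * \<sigma>r z) \<partial>lborel) =
          (\<integral>t. \<integral>x. deriv p x * q t * (indicator ?B (x, t) * \<sigma>r (x, t)) \<partial>lborel \<partial>lborel)"
          using lborel_pair.integral_snd[OF i] by (simp add: lborel_prod case_prod_beta')
        also have "\<dots> = (\<integral>t. indicator {c<..<d} t * (\<sigma>1 * (p (\<phi> t) * q t)) \<partial>lborel)"
        proof (rule Bochner_Integration.integral_cong)
          fix t
          show "(\<integral>x. deriv p x * q t * (indicator ?B (x, t) * \<sigma>r (x, t)) \<partial>lborel) = indicator {c<..<d} t * (\<sigma>1 * (p (\<phi> t) * q t))"
          proof (cases "t \<in> {c<..<d}")
            case True
            have "deriv p x * q t * (indicator ?B (x, t) * \<sigma>r (x, t)) = q t * ((\<sigma>0 + \<sigma>1 * heaviside (- x + \<phi> t)) * deriv p (x - 0))" for x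
              using True test_functions_outside[OF test_functions_deriv(2)[OF p], of x] by (auto simp: form indicator_def)
            then have "(\<integral>x. deriv p x * q t * (indicator ?B (x, t) * \<sigma>r (x, t)) \<partial>lborel) =
                (\<integral>x. q t * ((\<sigma>0 + \<sigma>1 * heaviside (- x + \<phi> t)) * deriv p (x - 0)) \<partial>lborel)" by presburger
            also have "\<dots> = q t * (\<sigma>1 * p (\<phi> t))"
              using test_function_half_line_integral(1)[OF p, of \<sigma>0 \<sigma>1 "\<phi> t" 0] by simp
            finally show ?thesis using True by simp
          qed simp
        qed simp
        also have "\<dots> = (LINT t:{c<..<d}|lborel. \<sigma>1 * (p (\<phi> t) * q t))"
          by (simp only: set_lebesgue_integral_def real_scaleR_def)
        finally have "(\<integral>z. p (fst z) * q (snd z) \<partial>M1) - (\<integral>z. p (fst z) * q (snd z) \<partial>M2) =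
            - (LINT t:{c<..<d}|lborel. \<sigma>1 * (p (\<phi> t) * q t))"
          using weak[OF p q] by simp
        also have "\<dots> = (LINT t:{c<..<d}|lborel. p (\<phi> t) * q t * (- \<sigma>1 * indicator ?B (\<phi> t, t)))"
          unfolding set_lebesgue_integral_def integral_minus[symmetric]
          by (rule Bochner_Integration.integral_cong) (use ab in \<open>auto simp: indicator_def\<close>)
        also have "\<dots> = (\<integral>z. p (fst z) * q (snd z) * (- \<sigma>1 * indicator ?B z) \<partial>\<nu>)"
          using on_curve[of "\<lambda>z. p (fst z) * q (snd z) * (- \<sigma>1 * indicator ?B z)"] by (subst \<nu>(4)) simp_all
        finally show "(\<integral>z. p (fst z) * q (snd z) \<partial>M1) - (\<integral>z. p (fst z) * q (snd z) \<partial>M2) =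
            (\<integral>z. p (fst z) * q (snd z) * (- \<sigma>1 * indicator ?B z) \<partial>\<nu>)" .
      qed
      also have "\<dots> = (\<integral>z. indicator S z * (- \<sigma>1 * indicator ?B z) \<partial>\<nu>)" by (simp add: set_lebesgue_integral_def)
      also have "\<dots> = (LINT t:{c<..<d}|lborel. indicator S (\<phi>0 t, t) * (- \<sigma>1 * indicator ?B (\<phi>0 t, t)))"
        by (rule \<nu>(4)) (use S in measurable)
      also have "\<dots> = (LINT t:{c<..<d}|lborel. - \<sigma>1 * indicator S (\<phi>0 t, t))"
        unfolding set_lebesgue_integral_def
        by (rule Bochner_Integration.integral_cong) (use ab in \<open>auto simp: indicator_def \<phi>0_def\<close>)
      also have "\<dots> = (\<integral>z. - \<sigma>1 * indicator S z \<partial>\<nu>)"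
        by (rule \<nu>(4)[symmetric]) (use S in measurable)
      also have "\<dots> = - \<sigma>1 * measure \<nu> S" by (simp add: \<nu>(3))
      finally show ?thesis .
    qed
    have i12: "integrable M1 f" "integrable M2 f" using int int_iff[OF f] by auto
    note diff = singular_difference_multiple[OF fin \<nu>(1) sets \<nu>(2) singular eq f(1) i12]
    have [measurable]: "f \<in> borel_measurable borel" by fact
    have fm: "(\<lambda>z. - \<sigma>1 * f z) \<in> borel_measurable borel" by measurable
    have "set_integrable lborel {c<..<d} (\<lambda>t. - \<sigma>1 * f (\<phi>0 t, t))"
      using diff(1) \<nu>(5)[OF fm] by simp
    then have "integrable lborel (\<lambda>t. - (indicat_real {c<..<d} t * (- \<sigma>1 * f (\<phi>0 t, t))))"
      unfolding set_integrable_def real_scaleR_def by (rule Bochner_Integration.integrable_minus)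
    note i = this
    have e: "- (indicat_real {c<..<d} t * (- \<sigma>1 * f (\<phi>0 t, t))) = indicator {c<..<d} t * (\<sigma>1 * f (\<phi> t, t))" for t
      by (auto simp: \<phi>0_def indicator_def)
    from i have concl1: "set_integrable lborel {c<..<d} (\<lambda>t. \<sigma>1 * f (\<phi> t, t))"
      unfolding e set_integrable_def real_scaleR_def .
    have "signed_integral half_plane \<mu> f = (\<integral>z. - \<sigma>1 * f z \<partial>\<nu>)" using int_eq[OF f] diff(2) by simp
    also have "\<dots> = (LINT t:{c<..<d}|lborel. - \<sigma>1 * f (\<phi>0 t, t))" by (rule \<nu>(4)[OF fm])
    also have "\<dots> = - (LINT t:{c<..<d}|lborel. \<sigma>1 * f (\<phi>0 t, t))"
      by (simp only: set_lebesgue_integral_def real_scaleR_def mult_minus_left mult_minus_right integral_minus)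
    also have "\<dots> = - (LINT t:{c<..<d}|lborel. \<sigma>1 * f (\<phi> t, t))"
      using on_curve[of "\<lambda>z. \<sigma>1 * f z"] by (rule arg_cong)
    finally show "set_integrable lborel {c<..<d} (\<lambda>t. \<sigma>1 * f (\<phi> t, t)) \<and>
      signed_integral half_plane \<mu> f = - (LINT t:{c<..<d}|lborel. \<sigma>1 * f (\<phi> t, t))"
      using concl1 by blast
  qed
  then show "set_integrable lborel {c<..<d} (\<lambda>t. \<sigma>1 * f (\<phi> t, t))"
    and "signed_integral half_plane \<mu> f = - (LINT t:{c<..<d}|lborel. \<sigma>1 * f (\<phi> t, t))" by blast+
qed

section \<open>The flux of the first equation\<close>

lemma locally_integrable_test_mult:
  assumes w: "locally_integrable U w" and \<theta>: "\<theta> \<in> test_functions U"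
  shows "set_integrable lborel U (\<lambda>z. w z * \<theta> z)"
proof -
  obtain K where K: "compact K" "K \<subseteq> U" "\<And>p. p \<notin> K \<Longrightarrow> \<theta> p = 0"
    using test_functions_support[OF \<theta>] by metis
  have "integrable lborel (\<lambda>z. (indicator K z * w z) * \<theta> z)"
    using w K by (intro integrable_test_mult[OF \<theta>]) (auto simp: locally_integrable_def set_integrable_def)
  moreover have "(\<lambda>z. (indicator K z * w z) * \<theta> z) = (\<lambda>z. indicator U z *\<^sub>R (w z * \<theta> z))"
    using K by (auto simp: indicator_def fun_eq_iff)
  ultimately show ?thesis by (simp add: set_integrable_def)
qed

lemma test_function_plateau:
  assumes "0 < (c :: real)"
  obtains q where "q \<in> test_functions {c / 2<..<d + 1}" "\<And>t. c \<le> t \<Longrightarrow> t \<le> d \<Longrightarrow> q t = 1"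
proof -
  define k where "k = 2 + 4 / c"
  have k: "k > 0" "2 / k \<le> c / 2" "2 / k \<le> 1"
    using assms by (auto simp: k_def field_simps)
  have "cutoff (c / 2) (d + 1) k t = 1" if "c \<le> t" "t \<le> d" for t
  proof (rule cutoff_eq_1[OF k(1)])
    show "c / 2 + 2 / k \<le> t" "t \<le> d + 1 - 2 / k" using k(2,3) that by linarith+
  qed
  with cutoff_test[OF k(1), of "c / 2" "d + 1"] show thesis by (rule that)
qed

text \<open>
  The test function has \<open>x\<close>-derivative 1 on the given compact set.  As \<open>u\<close> times its \<open>t\<close>-derivative is
  integrable there, the integrability of the whole expression is passed on to \<open>G\<close>.
\<close>

lemma flux_locally_integrable:
  assumes u: "locally_integrable half_plane u"
    and int: "\<And>\<theta>. \<theta> \<in> test_functions half_plane \<Longrightarrow>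
      set_integrable lborel half_plane (\<lambda>p. u p * partial (0, 1) \<theta> p + G p * partial (1, 0) \<theta> p)"
  shows "locally_integrable half_plane G"
  unfolding locally_integrable_def
proof (intro allI impI)
  fix K :: "(real \<times> real) set" assume K: "compact K \<and> K \<subseteq> half_plane"
  show "set_integrable lborel K G"
  proof (cases "K = {}")
    case False
    obtain R where R: "\<And>z. z \<in> K \<Longrightarrow> norm z \<le> R" using K compact_imp_bounded[of K] by (auto simp: bounded_iff)
    have "compact (snd ` K)" using K by (intro compact_continuous_image continuous_intros) auto
    then obtain c where c: "c \<in> snd ` K" "\<And>t. t \<in> snd ` K \<Longrightarrow> c \<le> t"
      using compact_attains_inf[of "snd ` K"] False by auto
    have "0 < c" using c(1) K by (auto simp: half_plane_def)
    have KR: "\<bar>fst z\<bar> \<le> R" "c \<le> snd z" "snd z \<le> R" if "z \<in> K" for z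
      using R[OF that] c(2)[of "snd z"] that norm_fst_le[of z "0"] norm_fst_le[of "fst z" "snd z"]
        norm_snd_le[of "snd z" "fst z"] by (auto simp: abs_le_iff)
    define \<eta> where "\<eta> = cutoff (- R - 2) (R + 2) 2"
    define p where "p x = x * \<eta> x" for x
    have \<eta>: "\<eta> \<in> test_functions {- R - 2<..<R + 2}" unfolding \<eta>_def by (rule cutoff_test) simp
    obtain L where L: "compact L" "L \<subseteq> {- R - 2<..<R + 2}" "\<And>x. x \<notin> L \<Longrightarrow> \<eta> x = 0"
      using test_functions_support[OF \<eta>] by metis
    have p: "p \<in> test_functions {- R - 2<..<R + 2}"
    proof (rule test_functionsI[OF _ L(1,2)])
      show "smooth_on UNIV p" unfolding p_def[abs_def]
        by (rule smooth_on_mult[OF open_UNIV smooth_on_linear test_functions_smooth[OF \<eta>]]) simp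
    qed (use L(3) in \<open>simp add: p_def\<close>)
    have p1: "deriv p x = 1" if "\<bar>x\<bar> \<le> R" for x
    proof (rule DERIV_imp_deriv)
      have "p y = y" if "y \<in> {- R - 1<..<R + 1}" for y
        using that by (simp add: p_def \<eta>_def cutoff_eq_1)
      then show "(p has_real_derivative 1) (at x)"
        using that by (intro has_field_derivative_transform_within_open[OF DERIV_ident, of "{- R - 1<..<R + 1}"]) auto
    qed
    obtain q where q: "q \<in> test_functions {c / 2<..<R + 1}" and q1: "\<And>t. c \<le> t \<Longrightarrow> t \<le> R \<Longrightarrow> q t = 1"
      using test_function_plateau[OF \<open>0 < c\<close>] by blast
    note \<theta> = test_functions_prod[OF p q]
    have \<theta>h: "(\<lambda>z. p (fst z) * q (snd z)) \<in> test_functions half_plane"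
      by (rule test_functions_mono[OF \<theta>(1)]) (use \<open>0 < c\<close> in \<open>auto simp: half_plane_def\<close>)
    have Ks: "K \<in> sets lborel" using K by (simp add: borel_compact)
    have "set_integrable lborel K (\<lambda>z. u z * partial (0, 1) (\<lambda>z. p (fst z) * q (snd z)) z + G z * partial (1, 0) (\<lambda>z. p (fst z) * q (snd z)) z)"
      by (rule set_integrable_subset[OF int[OF \<theta>h] Ks]) (use K in auto)
    moreover have "set_integrable lborel K (\<lambda>z. u z * partial (0, 1) (\<lambda>z. p (fst z) * q (snd z)) z)"
      by (rule set_integrable_subset[OF locally_integrable_test_mult[OF u test_functions_partial[OF \<theta>h]] Ks])
        (use K in \<open>auto simp: Basis_prod_def\<close>)
    ultimately have "set_integrable lborel K (\<lambda>z. (u z * partial (0, 1) (\<lambda>z. p (fst z) * q (snd z)) z + G z * partial (1, 0) (\<lambda>z. p (fst z) * q (snd z)) z)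
        - u z * partial (0, 1) (\<lambda>z. p (fst z) * q (snd z)) z)"
      by (rule set_integral_diff(1))
    then have "set_integrable lborel K (\<lambda>z. G z * partial (1, 0) (\<lambda>z. p (fst z) * q (snd z)) z)" by simp
    moreover have "partial (1, 0) (\<lambda>z. p (fst z) * q (snd z)) z = 1" if "z \<in> K" for z
      unfolding \<theta>(2) using KR[OF that] p1 q1 by simp
    ultimately show ?thesis
      by (subst (asm) set_integrable_cong[OF refl refl, of K _ G]) auto
  qed simp
qed

text \<open>
  The conservation law reads \<open>G\<^sub>x = - u\<^sub>t\<close>; changing the sign exchanges the two parts of the Jordan
  decomposition.
\<close>

lemma flux_x_derivative:
  assumes u: "locally_integrable half_plane u" and G: "locally_integrable half_plane G"
    and deriv: "has_distr_deriv half_plane (0, 1) u \<mu>"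
    and weak: "\<And>\<theta>. \<theta> \<in> test_functions half_plane \<Longrightarrow>
      (LINT p:half_plane|lborel. u p * partial (0, 1) \<theta> p + G p * partial (1, 0) \<theta> p) = 0"
  shows "has_distr_deriv half_plane (1, 0) G (snd \<mu>, fst \<mu>)"
  unfolding has_distr_deriv_def
proof (intro conjI ballI)
  have rad: "signed_radon half_plane \<mu>" using deriv by (simp add: has_distr_deriv_def)
  then obtain A where A: "A \<in> sets borel" "emeasure (fst \<mu>) (- A) = 0" "emeasure (snd \<mu>) A = 0"
    unfolding signed_radon_def by auto
  have "\<exists>A\<in>sets borel. emeasure (snd \<mu>) (- A) = 0 \<and> emeasure (fst \<mu>) A = 0"
    by (rule bexI[of _ "- A"]) (use A in \<open>auto intro: borel_comp\<close>)
  with rad show "signed_radon half_plane (snd \<mu>, fst \<mu>)" unfolding signed_radon_def by auto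
  fix \<theta> :: "real \<times> real \<Rightarrow> real" assume \<theta>: "\<theta> \<in> test_functions half_plane"
  have i: "set_integrable lborel half_plane (\<lambda>p. u p * partial (0, 1) \<theta> p)"
    "set_integrable lborel half_plane (\<lambda>p. G p * partial (1, 0) \<theta> p)"
    by (rule locally_integrable_test_mult[OF u] locally_integrable_test_mult[OF G],
        rule test_functions_partial[OF \<theta>], simp add: Basis_prod_def)+
  have "(LINT p:half_plane|lborel. u p * partial (0, 1) \<theta> p) + (LINT p:half_plane|lborel. G p * partial (1, 0) \<theta> p) = 0"
    using weak[OF \<theta>] set_integral_add(2)[OF i] by simp
  moreover have "(LINT p:half_plane|lborel. u p * partial (0, 1) \<theta> p) = - signed_integral half_plane \<mu> \<theta>"
    using deriv \<theta> by (simp add: has_distr_deriv_def)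
  ultimately show "(LINT p:half_plane|lborel. G p * partial (1, 0) \<theta> p) = - signed_integral half_plane (snd \<mu>, fst \<mu>) \<theta>"
    by (simp add: signed_integral_def)
qed

section \<open>Functions along the curve\<close>

lemma AE_positive_if_AE_strips:
  fixes P :: "real \<Rightarrow> bool"
  assumes "\<And>c d. 0 < c \<Longrightarrow> c < d \<Longrightarrow> AE t in lborel. t \<in> {c<..<d} \<longrightarrow> P t"
  shows "AE t in lborel. 0 < t \<longrightarrow> P t"
proof -
  have "AE t in lborel. \<forall>n. t \<in> {1 / real (Suc n)<..<real n + 2} \<longrightarrow> P t"
    unfolding AE_all_countable
  proof
    fix n
    have "1 / real (Suc n) \<le> 1" by simp
    then have "1 / real (Suc n) < real n + 2" by linarith
    then show "AE t in lborel. t \<in> {1 / real (Suc n)<..<real n + 2} \<longrightarrow> P t" by (intro assms) simp_all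
  qed
  then show ?thesis
  proof eventually_elim
    case (elim t)
    show ?case
    proof
      assume "0 < t"
      obtain n1 where n1: "1 / real (Suc n1) < t" using nat_approx_posE[OF \<open>0 < t\<close>] by blast
      obtain n2 where n2: "t < real n2" using reals_Archimedean2 by blast
      have "1 / real (Suc (max n1 n2)) \<le> 1 / real (Suc n1)" by (rule divide_left_mono) auto
      then have "1 / real (Suc (max n1 n2)) < t" using n1 by linarith
      moreover have "t < real (max n1 n2) + 2" using n2 by auto
      ultimately show "P t" using elim by auto
    qed
  qed
qed

lemma smooth_along_curve:
  assumes \<phi>: "smooth_on {0<..} \<phi>" and e: "smooth_on half_plane e"
  shows "0 < t \<Longrightarrow> ((\<lambda>s. e (\<phi> s, s)) has_real_derivative deriv (\<lambda>s. e (\<phi> s, s)) t) (at t)"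
    and "continuous_on {0<..} (deriv (\<lambda>s. e (\<phi> s, s)))"
proof -
  define E' where "E' t = partial (1, 0) e (\<phi> t, t) * deriv \<phi> t + partial (0, 1) e (\<phi> t, t)" for t
  have D: "((\<lambda>s. e (\<phi> s, s)) has_real_derivative E' t) (at t)" if "0 < t" for t
  proof -
    have "e differentiable at (\<phi> t, t)" using smooth_on_differentiable[OF e] that by (auto simp: half_plane_def)
    then have De: "(e has_derivative frechet_derivative e (at (\<phi> t, t))) (at (\<phi> t, t))"
      by (simp add: frechet_derivative_works)
    have "(\<phi> has_derivative (*) (deriv \<phi> t)) (at t)"
      using smooth_real_deriv(1)[OF \<phi>] that by (auto simp: has_field_derivative_def)
    then have "((\<lambda>s. (\<phi> s, s)) has_derivative (\<lambda>h. (deriv \<phi> t * h, h))) (at t)"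
      by (intro has_derivative_Pair has_derivative_ident)
    from has_derivative_compose[OF this De]
    have "((\<lambda>s. e (\<phi> s, s)) has_derivative (\<lambda>h. frechet_derivative e (at (\<phi> t, t)) (deriv \<phi> t * h, h))) (at t)" .
    moreover have "frechet_derivative e (at (\<phi> t, t)) (deriv \<phi> t * h, h) = E' t * h" for h
    proof -
      have lin: "linear (frechet_derivative e (at (\<phi> t, t)))" using De has_derivative_linear by blast
      have "(deriv \<phi> t * h, h) = (deriv \<phi> t * h) *\<^sub>R (1, 0) + h *\<^sub>R (0, 1 :: real)" by simp
      then have "frechet_derivative e (at (\<phi> t, t)) (deriv \<phi> t * h, h) =
         (deriv \<phi> t * h) * partial (1, 0) e (\<phi> t, t) + h * partial (0, 1) e (\<phi> t, t)"
        using linear_add[OF lin] linear_scale[OF lin] unfolding partial_def by (metis real_scaleR_def)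
      then show ?thesis by (simp add: E'_def algebra_simps)
    qed
    ultimately show ?thesis by (simp add: has_field_derivative_def)
  qed
  then have eq: "deriv (\<lambda>s. e (\<phi> s, s)) t = E' t" if "0 < t" for t using that DERIV_imp_deriv by blast
  show "0 < t \<Longrightarrow> ((\<lambda>s. e (\<phi> s, s)) has_real_derivative deriv (\<lambda>s. e (\<phi> s, s)) t) (at t)"
    using D eq by simp
  have c: "continuous_on {0<..} (\<lambda>s. (\<phi> s, s))"
    by (intro continuous_on_Pair smooth_on_continuous[OF \<phi>] continuous_on_id)
  have "continuous_on {0<..} (\<lambda>s. partial b e (\<phi> s, s))" if "b \<in> Basis" for b
    by (rule continuous_on_compose2[OF smooth_on_continuous[OF smooth_on_partial[OF e that]] c])
      (auto simp: half_plane_def)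
  then have "continuous_on {0<..} E'"
    unfolding E'_def using smooth_real_deriv(2)[OF \<phi>] by (intro continuous_intros) (auto simp: Basis_prod_def)
  then show "continuous_on {0<..} (deriv (\<lambda>s. e (\<phi> s, s)))"
    by (rule continuous_on_eq) (use eq in simp)
qed

lemma set_integrable_continuous_strip:
  assumes "0 < c" "continuous_on {0<..} (f :: real \<Rightarrow> real)"
  shows "set_integrable lborel {c<..<d} f"
proof -
  have "set_integrable lborel {c..d} f"
    by (rule borel_integrable_compact[unfolded real_scaleR_def[symmetric], folded set_integrable_def])
      (use assms in \<open>auto intro: continuous_on_subset\<close>)
  then show ?thesis by (rule set_integrable_subset) auto
qed

lemma integration_by_parts_test:
  assumes "0 < c" "c < d" and E: "\<And>t. 0 < t \<Longrightarrow> (E has_real_derivative E' t) (at t)" "continuous_on {0<..} E'"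
    and q: "q \<in> test_functions {c<..<d}"
  shows "(LINT t:{c<..<d}|lborel. E t * deriv q t) = - (LINT t:{c<..<d}|lborel. E' t * q t)"
proof -
  have cE: "continuous_on {0<..} E" using E(1) by (meson DERIV_isCont continuous_at_imp_continuous_on greaterThan_iff)
  have cq: "continuous_on {0<..} q" "continuous_on {0<..} (deriv q)"
    using smooth_on_continuous[OF test_functions_smooth[OF q]]
      smooth_on_continuous[OF test_functions_smooth[OF test_functions_deriv(2)[OF q]]] continuous_on_subset by blast+
  have cont: "continuous_on {0<..} (\<lambda>t. E' t * q t)" "continuous_on {0<..} (\<lambda>t. E t * deriv q t)"
    by (intro continuous_intros E cE cq)+
  have i: "set_integrable lborel {c<..<d} (\<lambda>t. E' t * q t)" "set_integrable lborel {c<..<d} (\<lambda>t. E t * deriv q t)"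
    by (intro set_integrable_continuous_strip assms cont)+
  have sub: "{c..d} \<subseteq> {0<..}" using assms by auto
  have "(\<integral>t. indicator {c..d} t *\<^sub>R (E' t * q t + E t * deriv q t) \<partial>lborel) = E d * q d - E c * q c"
  proof (rule integral_FTC_atLeastAtMost[where F="\<lambda>t. E t * q t"])
    show "((\<lambda>t. E t * q t) has_vector_derivative E' t * q t + E t * deriv q t) (at t within {c..d})"
      if "c \<le> t" "t \<le> d" for t
    proof -
      have "((\<lambda>t. E t * q t) has_real_derivative E' t * q t + E t * deriv q t) (at t)"
        using that \<open>0 < c\<close> by (auto intro!: derivative_eq_intros E(1) test_functions_deriv(3)[OF q])
      then show ?thesis
        by (auto simp: has_real_derivative_iff_has_vector_derivative intro: has_vector_derivative_at_within)
    qed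
    show "continuous_on {c..d} (\<lambda>t. E' t * q t + E t * deriv q t)"
      by (rule continuous_on_subset[OF continuous_on_add[OF cont] sub])
  qed (use assms in simp)
  also have "\<dots> = 0" using test_functions_outside[OF q, of c] test_functions_outside[OF q, of d] by simp
  also have "(\<lambda>t. indicator {c..d} t *\<^sub>R (E' t * q t + E t * deriv q t)) = (\<lambda>t. indicator {c<..<d} t *\<^sub>R (E' t * q t + E t * deriv q t))"
  proof
    fix t
    have "q t = 0" "deriv q t = 0" if "t \<notin> {c<..<d}"
      using that test_functions_outside[OF q] test_functions_outside[OF test_functions_deriv(2)[OF q]] by auto
    then show "indicator {c..d} t *\<^sub>R (E' t * q t + E t * deriv q t) = indicator {c<..<d} t *\<^sub>R (E' t * q t + E t * deriv q t)"
      by (auto simp: indicator_def)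
  qed
  finally have "(LINT t:{c<..<d}|lborel. E' t * q t + E t * deriv q t) = 0" by (simp add: set_lebesgue_integral_def)
  then show ?thesis using set_integral_add(2)[OF i] by simp
qed

section \<open>The equation for the amplitude\<close>

text \<open>
  Integrate over \<open>x\<close> first.  The term with \<open>deriv q\<close> has the same spatial factor \<open>\<kappa>\<close> for all times, by
  translation, and thus integrates to zero.  In the other term the derivative of \<open>A\<close>, integrated against
  the step, gives \<open>\<sigma>1 * A 0\<close>.
\<close>

lemma signed_integral_step_t:
  assumes \<phi>: "smooth_on {0<..} \<phi>" and cd: "0 < c" "c < d"
    and form: "\<sigma>r = (\<lambda>(x, t). \<sigma>0 + \<sigma>1 * heaviside (- x + \<phi> t))"
    and loc: "locally_integrable half_plane \<sigma>r"
    and deriv: "has_distr_deriv half_plane (0, 1) \<sigma>r \<mu>"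
    and A: "A \<in> test_functions {-1<..<1}" and q: "q \<in> test_functions {c<..<d}"
  shows "signed_integral half_plane \<mu> (\<lambda>z. A (fst z - \<phi> (snd z)) * q (snd z)) =
    \<sigma>1 * A 0 * (LINT t:{c<..<d}|lborel. deriv \<phi> t * q t)"
proof -
  define \<theta> where "\<theta> = (\<lambda>z. A (fst z - \<phi> (snd z)) * q (snd z))"
  have AU: "A \<in> test_functions UNIV" using test_functions_mono[OF A] by simp
  note \<theta> = curve_test_function[OF \<phi> AU q cd, folded \<theta>_def]
  define \<kappa> where "\<kappa> = (\<integral>x. (\<sigma>0 + \<sigma>1 * heaviside (- x)) * A x \<partial>lborel)"
  have [measurable]: "A \<in> borel_measurable borel" using test_functions_borel[OF A] .
  have hv[measurable]: "heaviside \<in> borel_measurable borel" unfolding heaviside_def[abs_def] by measurable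
  have iA: "integrable lborel (\<lambda>x. (\<sigma>0 + \<sigma>1 * heaviside (- x)) * A x)"
    by (rule Bochner_Integration.integrable_bound[of _ "\<lambda>x. (\<bar>\<sigma>0\<bar> + \<bar>\<sigma>1\<bar>) * A x"])
      (use integrable_test[OF A] in \<open>auto simp: heaviside_def abs_mult intro!: mult_right_mono abs_triangle_ineq\<close>)
  have inner: "(\<integral>x. indicat_real half_plane (x, t) * (\<sigma>r (x, t) * partial (0, 1) \<theta> (x, t)) \<partial>lborel) =
      \<kappa> * deriv q t - \<sigma>1 * A 0 * (indicator {c<..<d} t * (deriv \<phi> t * q t))" for t
  proof (cases "t \<in> {c<..<d}")
    case True
    then have h: "(x, t) \<in> half_plane" for x using cd by (auto simp: half_plane_def)
    let ?s = "\<lambda>x. \<sigma>0 + \<sigma>1 * heaviside (- x + \<phi> t)"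
    have i1: "integrable lborel (\<lambda>x. ?s x * A (x - \<phi> t))"
      using lborel_integrable_real_affine[OF iA, where c=1 and t="- \<phi> t"] by (simp add: add.commute)
    have k1: "(\<integral>x. ?s x * A (x - \<phi> t) \<partial>lborel) = \<kappa>"
      unfolding \<kappa>_def by (subst lborel_integral_real_affine[where c=1 and t="\<phi> t"]) simp_all
    note i2 = test_function_half_line_integral[OF A, of \<sigma>0 \<sigma>1 "\<phi> t" "\<phi> t"]
    have eq: "indicat_real half_plane (x, t) * (\<sigma>r (x, t) * partial (0, 1) \<theta> (x, t)) =
        (?s x * A (x - \<phi> t)) * deriv q t - (deriv \<phi> t * q t) * (?s x * deriv A (x - \<phi> t))" for x
      unfolding \<theta>(3)[OF h] using h[of x] by (simp add: form algebra_simps)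
    have "(\<integral>x. indicat_real half_plane (x, t) * (\<sigma>r (x, t) * partial (0, 1) \<theta> (x, t)) \<partial>lborel) =
        \<kappa> * deriv q t - (deriv \<phi> t * q t) * (\<sigma>1 * A 0)"
      unfolding eq using i1 k1 i2 by simp
    then show ?thesis using True by simp
  next
    case False
    then have 0: "q t = 0" "deriv q t = 0"
      using test_functions_outside[OF q] test_functions_outside[OF test_functions_deriv(2)[OF q]] by auto
    have z: "indicat_real half_plane (x, t) * (\<sigma>r (x, t) * partial (0, 1) \<theta> (x, t)) = 0" for x
      using \<theta>(3)[of "(x, t)"] 0 by (auto simp: indicator_def)
    show ?thesis unfolding z using 0 by simp
  qed
  have iq: "integrable lborel (\<lambda>t. indicator {c<..<d} t * (deriv \<phi> t * q t))"
  proof -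
    have "set_integrable lborel {c<..<d} (deriv \<phi>)"
      by (rule set_integrable_continuous_strip[OF cd(1) smooth_real_deriv(2)[OF \<phi>]]) simp
    from integrable_test_mult[OF q this[unfolded set_integrable_def]] show ?thesis by (simp add: mult.assoc)
  qed
  have iq': "integrable lborel (deriv q)" by (rule integrable_test[OF test_functions_deriv(2)[OF q]])
  have q'0: "(\<integral>t. deriv q t \<partial>lborel) = 0"
  proof -
    have "(\<lambda>t. indicator {c..} t * deriv q t) = deriv q"
      using test_functions_outside[OF test_functions_deriv(2)[OF q]] by (auto simp: indicator_def fun_eq_iff)
    then show ?thesis using test_function_tail_integral[OF q, of c] test_functions_outside[OF q, of c] by simp
  qed
  have "signed_integral half_plane \<mu> \<theta> = - (LINT z:half_plane|lborel. \<sigma>r z * partial (0, 1) \<theta> z)"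
    using deriv \<theta>(1) by (simp add: has_distr_deriv_def)
  also have "(LINT z:half_plane|lborel. \<sigma>r z * partial (0, 1) \<theta> z) =
      (\<integral>t. \<integral>x. indicat_real half_plane (x, t) * (\<sigma>r (x, t) * partial (0, 1) \<theta> (x, t)) \<partial>lborel \<partial>lborel)"
  proof -
    have "set_integrable lborel half_plane (\<lambda>z. \<sigma>r z * partial (0, 1) \<theta> z)"
      by (rule locally_integrable_test_mult[OF loc test_functions_partial[OF \<theta>(1)]]) (simp add: Basis_prod_def)
    then have "integrable (lborel \<Otimes>\<^sub>M lborel) (\<lambda>(x, t). indicat_real half_plane (x, t) * (\<sigma>r (x, t) * partial (0, 1) \<theta> (x, t)))"
      by (simp add: set_integrable_def lborel_prod case_prod_beta')
    from lborel_pair.integral_snd[OF this] show ?thesis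
      by (simp add: set_lebesgue_integral_def lborel_prod case_prod_beta')
  qed
  also have "\<dots> = - (\<sigma>1 * A 0 * (\<integral>t. indicator {c<..<d} t * (deriv \<phi> t * q t) \<partial>lborel))"
    unfolding inner using iq iq' q'0 by simp
  finally show ?thesis unfolding \<theta>_def by (simp add: set_lebesgue_integral_def)
qed

text \<open>
  The integrand is known to be measurable only after multiplication with the test function, which also
  confines it to a box.
\<close>

lemma signed_integral_step_x_curve:
  assumes \<phi>: "smooth_on {0<..} \<phi>" and cd: "0 < c" "c < d"
    and form: "\<sigma>r = (\<lambda>(x, t). \<sigma>0 + \<sigma>1 * heaviside (- x + \<phi> t))"
    and loc: "locally_integrable half_plane \<sigma>r"
    and deriv: "has_distr_deriv half_plane (1, 0) \<sigma>r \<mu>"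
    and A: "A \<in> test_functions {-1<..<1}" and q: "q \<in> test_functions {c<..<d}"
    and int: "signed_integrable half_plane \<mu> (\<lambda>z. v z * (A (fst z - \<phi> (snd z)) * q (snd z)))"
  shows "set_integrable lborel {c<..<d} (\<lambda>t. \<sigma>1 * (v (\<phi> t, t) * A 0 * q t))"
    and "signed_integral half_plane \<mu> (\<lambda>z. v z * (A (fst z - \<phi> (snd z)) * q (snd z))) =
      - (LINT t:{c<..<d}|lborel. \<sigma>1 * (v (\<phi> t, t) * A 0 * q t))"
proof -
  have "{c..d} \<subseteq> {0<..}" using cd by auto
  then have "continuous_on {c..d} \<phi>" using smooth_on_continuous[OF \<phi>] by (rule continuous_on_subset[rotated])
  then have "bounded (\<phi> ` {c..d})" by (intro compact_imp_bounded compact_continuous_image) auto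
  then obtain B where "\<forall>t\<in>{c..d}. \<bar>\<phi> t\<bar> \<le> B" by (auto simp: bounded_iff)
  then have B: "\<bar>\<phi> t\<bar> \<le> B" if "t \<in> {c<..<d}" for t using that by auto
  define a b where "a = - B - 2" and "b = B + 2"
  have ab: "\<phi> t \<in> {a<..<b}" if "t \<in> {c<..<d}" for t using B[OF that] by (auto simp: a_def b_def)
  define f where "f z = indicator half_plane z * (v z * (A (fst z - \<phi> (snd z)) * q (snd z)))" for z
  have f0: "f z = 0" if "z \<notin> {a<..<b} \<times> {c<..<d}" for z
  proof (cases "snd z \<in> {c<..<d}")
    case True
    then have "fst z - \<phi> (snd z) \<notin> {-1<..<1}"
      using B[OF True] that by (cases z) (auto simp: a_def b_def)
    then show ?thesis using test_functions_outside[OF A] by (simp add: f_def)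
  next
    case False
    then show ?thesis using test_functions_outside[OF q] by (simp add: f_def)
  qed
  have sets: "sets (fst \<mu>) = sets borel" using deriv by (auto simp: has_distr_deriv_def signed_radon_def)
  have "f \<in> borel_measurable (fst \<mu>)"
    using int unfolding signed_integrable_def set_integrable_def f_def real_scaleR_def by auto
  then have fm: "f \<in> borel_measurable borel" using measurable_cong_sets[OF sets refl] by blast
  have idem: "indicat_real half_plane z *\<^sub>R f z = indicat_real half_plane z *\<^sub>R (v z * (A (fst z - \<phi> (snd z)) * q (snd z)))" for z
    by (simp add: f_def indicator_def)
  have fi: "signed_integrable half_plane \<mu> f"
    using int unfolding signed_integrable_def set_integrable_def idem .
  have on: "\<sigma>1 * f (\<phi> t, t) = \<sigma>1 * (v (\<phi> t, t) * A 0 * q t)" if "t \<in> {c<..<d}" for t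
    using that cd by (simp add: f_def half_plane_def)
  note step = signed_integral_step_x[OF \<phi> cd ab form deriv loc fm f0 fi]
  show "set_integrable lborel {c<..<d} (\<lambda>t. \<sigma>1 * (v (\<phi> t, t) * A 0 * q t))"
    using step(1) on by (subst set_integrable_cong[OF refl refl, symmetric]) auto
  have "signed_integral half_plane \<mu> (\<lambda>z. v z * (A (fst z - \<phi> (snd z)) * q (snd z))) = signed_integral half_plane \<mu> f"
    unfolding signed_integral_def set_lebesgue_integral_def idem ..
  also have "\<dots> = - (LINT t:{c<..<d}|lborel. \<sigma>1 * f (\<phi> t, t))" by (rule step(2))
  also have "\<dots> = - (LINT t:{c<..<d}|lborel. \<sigma>1 * (v (\<phi> t, t) * A 0 * q t))"
    unfolding set_lebesgue_integral_def
    by (intro arg_cong[where f=uminus] Bochner_Integration.integral_cong) (use on in \<open>auto simp: indicator_def\<close>)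
  finally show "signed_integral half_plane \<mu> (\<lambda>z. v z * (A (fst z - \<phi> (snd z)) * q (snd z))) =
      - (LINT t:{c<..<d}|lborel. \<sigma>1 * (v (\<phi> t, t) * A 0 * q t))" .
qed

text \<open>
  On the curve the test function \<open>A (x - \<phi> t) * q t\<close> with \<open>A 0 = 1\<close> reduces to \<open>q\<close>.  So the second identity of the
  solution concept becomes \<open>\<integral> \<sigma>1 (\<phi>\<^sub>t - v) q - \<integral> e q\<^sub>t = 0\<close>, and integration by parts and the fundamental lemma give
  the equation.
\<close>

lemma amplitude_equation_strip:
  assumes \<phi>: "smooth_on {0<..} \<phi>" and cd: "0 < c" "c < d" and e: "smooth_on half_plane e"
    and form: "\<sigma>r = (\<lambda>(x, t). \<sigma>0 + \<sigma>1 * heaviside (- x + \<phi> t))"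
    and loc: "locally_integrable half_plane \<sigma>r"
    and deriv: "has_distr_deriv half_plane (0, 1) \<sigma>r \<mu>t" "has_distr_deriv half_plane (1, 0) \<sigma>r \<mu>x"
    and int: "\<And>\<theta>. \<theta> \<in> test_functions UNIV \<Longrightarrow> signed_integrable half_plane \<mu>x (\<lambda>p. v p * \<theta> p)"
    and eq: "\<And>\<theta>. \<theta> \<in> test_functions UNIV \<Longrightarrow> signed_integral half_plane \<mu>t \<theta>
           + signed_integral half_plane \<mu>x (\<lambda>p. v p * \<theta> p)
           - (LINT t:{0<..}|lborel. e (\<phi> t, t) * deriv (\<lambda>s. \<theta> (\<phi> s, s)) t) = 0"
  shows "AE t in lborel. t \<in> {c<..<d} \<longrightarrow> deriv (\<lambda>s. e (\<phi> s, s)) t = \<sigma>1 * (v (\<phi> t, t) - deriv \<phi> t)"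
proof -
  define E where "E s = e (\<phi> s, s)" for s
  note E = smooth_along_curve[OF \<phi> e, folded E_def]
  define A where "A = cutoff (-1) 1 2"
  have A: "A \<in> test_functions {-1<..<1}" unfolding A_def by (rule cutoff_test) simp
  have A0: "A 0 = 1" unfolding A_def by (rule cutoff_eq_1) auto
  have AU: "A \<in> test_functions UNIV" using test_functions_mono[OF A] by simp
  have \<theta>: "(\<lambda>z. A (fst z - \<phi> (snd z)) * q (snd z)) \<in> test_functions UNIV"
    if "q \<in> test_functions {c'<..<d'}" "0 < c'" "c' < d'" for q c' d'
    using test_functions_mono[OF curve_test_function(1)[OF \<phi> AU that]] by simp
  have iv: "set_integrable lborel {c<..<d} (\<lambda>t. \<sigma>1 * v (\<phi> t, t))"
  proof -
    \<comment> \<open>Integrability of \<open>v\<close> on the curve is known only in products with test functions; one that equals 1 on the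
      strip needs a wider strip for its support.\<close>
    obtain q where q: "q \<in> test_functions {c / 2<..<d + 1}" and q1: "\<And>t. c \<le> t \<Longrightarrow> t \<le> d \<Longrightarrow> q t = 1"
      using test_function_plateau[OF cd(1)] by blast
    have cd': "0 < c / 2" "c / 2 < d + 1" using cd by auto
    have "set_integrable lborel {c / 2<..<d + 1} (\<lambda>t. \<sigma>1 * (v (\<phi> t, t) * A 0 * q t))"
      by (rule signed_integral_step_x_curve(1)[OF \<phi> cd' form loc deriv(2) A q int[OF \<theta>[OF q cd']]])
    then have "set_integrable lborel {c<..<d} (\<lambda>t. \<sigma>1 * (v (\<phi> t, t) * A 0 * q t))"
      by (rule set_integrable_subset) (use cd in auto)
    then show ?thesis
      using q1 A0 by (subst (asm) set_integrable_cong[OF refl refl, of _ _ "\<lambda>t. \<sigma>1 * v (\<phi> t, t)"]) auto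
  qed
  have i1: "set_integrable lborel {c<..<d} (deriv \<phi>)"
    by (rule set_integrable_continuous_strip[OF cd(1) smooth_real_deriv(2)[OF \<phi>]]) simp
  have i2: "set_integrable lborel {c<..<d} (deriv E)"
    by (rule set_integrable_continuous_strip[OF cd(1) E(2)])
  define h where "h t = deriv E t - \<sigma>1 * v (\<phi> t, t) + \<sigma>1 * deriv \<phi> t" for t
  have ih: "set_integrable lborel {c<..<d} h"
    unfolding h_def by (intro set_integral_add(1) set_integral_diff(1) i2 iv set_integrable_mult_right) (rule i1)
  have "AE t in lborel. t \<in> {c<..<d} \<longrightarrow> h t = 0"
  proof (rule fundamental_lemma[OF ih])
    fix q assume q: "q \<in> test_functions {c<..<d}"
    let ?\<theta> = "\<lambda>z. A (fst z - \<phi> (snd z)) * q (snd z)"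
    have \<theta>U: "?\<theta> \<in> test_functions UNIV" by (rule \<theta>[OF q cd])
    have mult: "set_integrable lborel {c<..<d} (\<lambda>t. g t * q t)" if "set_integrable lborel {c<..<d} g" for g
      using integrable_test_mult[OF q that[unfolded set_integrable_def]] by (simp add: set_integrable_def mult.assoc)
    have 1: "signed_integral half_plane \<mu>t ?\<theta> = (LINT t:{c<..<d}|lborel. (\<sigma>1 * deriv \<phi> t) * q t)"
      using signed_integral_step_t[OF \<phi> cd form loc deriv(1) A q] A0 by (simp add: mult.assoc)
    have 2: "signed_integral half_plane \<mu>x (\<lambda>z. v z * ?\<theta> z) = - (LINT t:{c<..<d}|lborel. (\<sigma>1 * v (\<phi> t, t)) * q t)"
      using signed_integral_step_x_curve(2)[OF \<phi> cd form loc deriv(2) A q int[OF \<theta>U]] A0 by (simp add: mult.assoc)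
    have "(LINT t:{0<..}|lborel. e (\<phi> t, t) * deriv (\<lambda>s. ?\<theta> (\<phi> s, s)) t) = (LINT t:{0<..}|lborel. E t * deriv q t)"
      by (simp add: A0 E_def)
    also have "\<dots> = (LINT t:{c<..<d}|lborel. E t * deriv q t)"
      unfolding set_lebesgue_integral_def
    proof (rule Bochner_Integration.integral_cong)
      fix t
      show "indicat_real {0<..} t *\<^sub>R (E t * deriv q t) = indicat_real {c<..<d} t *\<^sub>R (E t * deriv q t)"
        using test_functions_outside[OF test_functions_deriv(2)[OF q], of t] cd by (auto simp: indicator_def)
    qed simp
    also have "\<dots> = - (LINT t:{c<..<d}|lborel. deriv E t * q t)"
      by (rule integration_by_parts_test[OF cd E q])
    finally have 3: "(LINT t:{c<..<d}|lborel. deriv E t * q t) - (LINT t:{c<..<d}|lborel. (\<sigma>1 * v (\<phi> t, t)) * q t)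
        + (LINT t:{c<..<d}|lborel. (\<sigma>1 * deriv \<phi> t) * q t) = 0"
      using eq[OF \<theta>U] 1 2 by simp
    have m: "set_integrable lborel {c<..<d} (\<lambda>t. deriv E t * q t)" "set_integrable lborel {c<..<d} (\<lambda>t. (\<sigma>1 * v (\<phi> t, t)) * q t)"
      "set_integrable lborel {c<..<d} (\<lambda>t. (\<sigma>1 * deriv \<phi> t) * q t)"
      by (rule mult, rule i2, rule mult, rule iv, rule mult, rule set_integrable_mult_right, rule i1)
    have "(LINT t:{c<..<d}|lborel. (deriv E t * q t - (\<sigma>1 * v (\<phi> t, t)) * q t) + (\<sigma>1 * deriv \<phi> t) * q t) = 0"
      using 3 set_integral_add(2)[OF set_integral_diff(1)[OF m(1,2)] m(3)] set_integral_diff(2)[OF m(1,2)] by simp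
    moreover have "indicat_real {c<..<d} t *\<^sub>R ((deriv E t * q t - (\<sigma>1 * v (\<phi> t, t)) * q t) + (\<sigma>1 * deriv \<phi> t) * q t) = q t * h t" for t
      using test_functions_outside[OF q, of t] by (auto simp: h_def indicator_def algebra_simps)
    ultimately show "(\<integral>t. q t * h t \<partial>lborel) = 0" by (simp add: set_lebesgue_integral_def)
  qed
  then show ?thesis unfolding E_def[abs_def, symmetric] by eventually_elim (auto simp: h_def algebra_simps)
qed

section \<open>The generalised Rankine-Hugoniot conditions\<close>

lemma left_value_eqI: "has_left_value v x t l \<Longrightarrow> left_value v x t = l"
  and right_value_eqI: "has_right_value v x t r \<Longrightarrow> right_value v x t = r"
  unfolding has_left_value_def has_right_value_def left_value_def right_value_def
  by (simp_all add: tendsto_Lim ess_at_not_bot)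

lemma step_one_sided_values:
  "has_left_value (\<lambda>(x, t). \<sigma>0 + \<sigma>1 * heaviside (- x + \<phi> t)) (\<phi> t) t (\<sigma>0 + \<sigma>1)"
  "has_right_value (\<lambda>(x, t). \<sigma>0 + \<sigma>1 * heaviside (- x + \<phi> t)) (\<phi> t) t \<sigma>0"
proof -
  have "eventually (\<lambda>y. (case (y, t) of (x, t) \<Rightarrow> \<sigma>0 + \<sigma>1 * heaviside (- x + \<phi> t)) = \<sigma>0 + \<sigma>1) (ess_at_left (\<phi> t))"
    unfolding eventually_ess_at_left by (rule exI[of _ "\<phi> t - 1"]) (auto simp: heaviside_def)
  then show "has_left_value (\<lambda>(x, t). \<sigma>0 + \<sigma>1 * heaviside (- x + \<phi> t)) (\<phi> t) t (\<sigma>0 + \<sigma>1)"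
    unfolding has_left_value_def by (rule tendsto_eventually)
  have "eventually (\<lambda>y. (case (y, t) of (x, t) \<Rightarrow> \<sigma>0 + \<sigma>1 * heaviside (- x + \<phi> t)) = \<sigma>0) (ess_at_right (\<phi> t))"
    unfolding eventually_ess_at_right by (rule exI[of _ "\<phi> t + 1"]) (auto simp: heaviside_def)
  then show "has_right_value (\<lambda>(x, t). \<sigma>0 + \<sigma>1 * heaviside (- x + \<phi> t)) (\<phi> t) t \<sigma>0"
    unfolding has_right_value_def by (rule tendsto_eventually)
qed

lemma u_hat_mean: "u_hat u (x, t) = (left_value u x t + right_value u x t) / 2"
proof -
  let ?l = "left_value u x t" and ?r = "right_value u x t"
  have "((\<lambda>\<tau>. ?l + \<tau> * (?r - ?l)) has_integral (?l * 1 + 1\<^sup>2 / 2 * (?r - ?l) - (?l * 0 + 0\<^sup>2 / 2 * (?r - ?l)))) {0..1}"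
    by (rule fundamental_theorem_of_calculus)
      (auto simp flip: has_real_derivative_iff_has_vector_derivative intro!: derivative_eq_intros)
  then show ?thesis by (simp add: u_hat_def integral_unique field_simps)
qed

theorem theorem3p3:
  fixes \<Omega> :: "(real \<times> real) set" and \<phi> u0 :: "real \<Rightarrow> real"
    and u e \<sigma>r :: "real \<times> real \<Rightarrow> real" and \<sigma>0 \<sigma>1 :: real
  assumes domain: "open \<Omega>" "connected \<Omega>" "\<Omega> \<subseteq> half_plane"
    and curve: "smooth_on {0<..} \<phi>"
    and halves: "{(x, t) \<in> \<Omega>. x - \<phi> t < 0} \<noteq> {}" "{(x, t) \<in> \<Omega>. x - \<phi> t > 0} \<noteq> {}"
    and form: "\<sigma>r = (\<lambda>(x, t). \<sigma>0 + \<sigma>1 * heaviside (- x + \<phi> t))"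
    and solution: "gen_delta_shock_solution \<phi> u0 u \<sigma>r e"
    and jump_nonzero: "AE t in lborel. (\<phi> t, t) \<in> \<Omega> \<longrightarrow> jump \<phi> u t \<noteq> 0"
  shows "AE t in lborel. (\<phi> t, t) \<in> \<Omega> \<longrightarrow>
     (\<exists>l. has_left_value u (\<phi> t) t l) \<and> (\<exists>r. has_right_value u (\<phi> t) t r) \<and>
     (\<phi> has_real_derivative
        (jump \<phi> (\<lambda>p. (u p)\<^sup>2 / 2) t - jump \<phi> \<sigma>r t) / jump \<phi> u t) (at t) \<and>
     ((\<lambda>s. e (\<phi> s, s)) has_real_derivative (jump \<phi> \<sigma>r t)\<^sup>2 / jump \<phi> u t) (at t)"
proof -
  note sol = solution[unfolded gen_delta_shock_solution_def]
  define G where "G p = (u p)\<^sup>2 / 2 - \<sigma>r p" for p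
  have u: "locally_integrable half_plane u" and \<sigma>: "locally_integrable half_plane \<sigma>r"
    and e: "smooth_on half_plane e" using sol by (auto simp: BV_loc_def)
  have "(0, 1) \<in> (Basis :: (real \<times> real) set)" "(1, 0) \<in> (Basis :: (real \<times> real) set)"
    by (auto simp: Basis_prod_def)
  then obtain \<mu> \<nu> where \<mu>: "has_distr_deriv half_plane (1, 0) u \<mu>" and \<nu>: "has_distr_deriv half_plane (0, 1) u \<nu>"
    using sol unfolding BV_loc_def by meson
  have first: "set_integrable lborel half_plane (\<lambda>p. u p * partial (0, 1) \<theta> p + G p * partial (1, 0) \<theta> p)"
    "(LINT p:half_plane|lborel. u p * partial (0, 1) \<theta> p + G p * partial (1, 0) \<theta> p) = 0"
    if \<theta>: "\<theta> \<in> test_functions half_plane" for \<theta>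
  proof -
    have "\<theta> (x, 0) = 0" for x by (rule test_functions_outside[OF \<theta>]) (simp add: half_plane_def)
    moreover have "\<theta> \<in> test_functions UNIV" using test_functions_mono[OF \<theta>] by simp
    ultimately show "set_integrable lborel half_plane (\<lambda>p. u p * partial (0, 1) \<theta> p + G p * partial (1, 0) \<theta> p)"
      "(LINT p:half_plane|lborel. u p * partial (0, 1) \<theta> p + G p * partial (1, 0) \<theta> p) = 0"
      using sol unfolding G_def by auto
  qed
  have G: "locally_integrable half_plane G" by (rule flux_locally_integrable[OF u first(1)])
  have Gx: "has_distr_deriv half_plane (1, 0) G (snd \<nu>, fst \<nu>)" by (rule flux_x_derivative[OF u G \<nu> first(2)])
  have traces: "AE t in lborel. 0 < t \<longrightarrow> (\<exists>l r l' r'. has_left_value u (\<phi> t) t l \<and> has_right_value u (\<phi> t) t r \<and>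
     has_left_value G (\<phi> t) t l' \<and> has_right_value G (\<phi> t) t r' \<and> l' - r' = deriv \<phi> t * (l - r))"
    by (rule AE_positive_if_AE_strips, rule interface_jump_relation_strip[OF curve _ _ u \<mu> G Gx first(2)])
  obtain \<mu>t \<mu>x where second: "has_distr_deriv half_plane (0, 1) \<sigma>r \<mu>t" "has_distr_deriv half_plane (1, 0) \<sigma>r \<mu>x"
    "\<And>\<theta>. \<theta> \<in> test_functions UNIV \<Longrightarrow> signed_integrable half_plane \<mu>x (\<lambda>p. u_hat u p * \<theta> p)"
    "\<And>\<theta>. \<theta> \<in> test_functions UNIV \<Longrightarrow> signed_integral half_plane \<mu>t \<theta>
           + signed_integral half_plane \<mu>x (\<lambda>p. u_hat u p * \<theta> p)
           - (LINT t:{0<..}|lborel. e (\<phi> t, t) * deriv (\<lambda>s. \<theta> (\<phi> s, s)) t) = 0"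
    using sol by auto
  have amplitude: "AE t in lborel. 0 < t \<longrightarrow> deriv (\<lambda>s. e (\<phi> s, s)) t = \<sigma>1 * (u_hat u (\<phi> t, t) - deriv \<phi> t)"
    by (rule AE_positive_if_AE_strips, rule amplitude_equation_strip[OF curve _ _ e form \<sigma> second])
  show ?thesis
    using traces amplitude jump_nonzero
  proof eventually_elim
    case (elim t)
    show ?case
    proof
      assume in_\<Omega>: "(\<phi> t, t) \<in> \<Omega>"
      then have "0 < t" using domain(3) by (auto simp: half_plane_def)
      then obtain l r l' r' where lr: "has_left_value u (\<phi> t) t l" "has_right_value u (\<phi> t) t r"
        and lr': "has_left_value G (\<phi> t) t l'" "has_right_value G (\<phi> t) t r'" "l' - r' = deriv \<phi> t * (l - r)"
        using elim(1) by blast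
      note vals = left_value_eqI[OF lr(1)] right_value_eqI[OF lr(2)]
      have \<sigma>v: "has_left_value \<sigma>r (\<phi> t) t (\<sigma>0 + \<sigma>1)" "has_right_value \<sigma>r (\<phi> t) t \<sigma>0"
        unfolding form by (rule step_one_sided_values)+
      have sq: "has_left_value (\<lambda>p. (u p)\<^sup>2 / 2) (\<phi> t) t (l\<^sup>2 / 2)" "has_right_value (\<lambda>p. (u p)\<^sup>2 / 2) (\<phi> t) t (r\<^sup>2 / 2)"
        using lr unfolding has_left_value_def has_right_value_def by (auto intro!: tendsto_intros)
      have Gv: "has_left_value G (\<phi> t) t (l\<^sup>2 / 2 - (\<sigma>0 + \<sigma>1))" "has_right_value G (\<phi> t) t (r\<^sup>2 / 2 - \<sigma>0)"
        using sq \<sigma>v unfolding has_left_value_def has_right_value_def G_def by (auto intro!: tendsto_intros)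
      have l': "l' = l\<^sup>2 / 2 - (\<sigma>0 + \<sigma>1)" "r' = r\<^sup>2 / 2 - \<sigma>0"
        using left_value_eqI[OF lr'(1)] left_value_eqI[OF Gv(1)] right_value_eqI[OF lr'(2)] right_value_eqI[OF Gv(2)] by auto
      have ju: "jump \<phi> u t = l - r" using vals by (simp add: jump_def)
      have jsq: "jump \<phi> (\<lambda>p. (u p)\<^sup>2 / 2) t = l\<^sup>2 / 2 - r\<^sup>2 / 2"
        using left_value_eqI[OF sq(1)] right_value_eqI[OF sq(2)] by (simp add: jump_def)
      have j\<sigma>: "jump \<phi> \<sigma>r t = \<sigma>1"
        using left_value_eqI[OF \<sigma>v(1)] right_value_eqI[OF \<sigma>v(2)] by (simp add: jump_def)
      have nz: "l - r \<noteq> 0" using elim(3) in_\<Omega> ju by simp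
      have d\<phi>: "deriv \<phi> t = (l\<^sup>2 / 2 - r\<^sup>2 / 2 - \<sigma>1) / (l - r)"
        using lr'(3) nz unfolding l' by (simp add: field_simps)
      have "deriv (\<lambda>s. e (\<phi> s, s)) t = \<sigma>1 * ((l + r) / 2 - deriv \<phi> t)"
        using elim(2) \<open>0 < t\<close> vals by (simp add: u_hat_mean)
      \<comment> \<open>The quotient \<open>(l\<^sup>2 - r\<^sup>2) / 2 / (l - r)\<close> is the mean of the one-sided values, hence cancels against \<open>u_hat\<close>.\<close>
      also have "(l + r) / 2 - deriv \<phi> t = \<sigma>1 / (l - r)"
        unfolding d\<phi> using nz by (simp add: field_simps power2_eq_square)
      finally have de: "deriv (\<lambda>s. e (\<phi> s, s)) t = \<sigma>1\<^sup>2 / (l - r)" by (simp add: power2_eq_square)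
      have "(\<phi> has_real_derivative (jump \<phi> (\<lambda>p. (u p)\<^sup>2 / 2) t - jump \<phi> \<sigma>r t) / jump \<phi> u t) (at t)"
        using smooth_real_deriv(1)[OF curve open_greaterThan, of t] \<open>0 < t\<close> unfolding d\<phi> ju jsq j\<sigma> by simp
      moreover have "((\<lambda>s. e (\<phi> s, s)) has_real_derivative (jump \<phi> \<sigma>r t)\<^sup>2 / jump \<phi> u t) (at t)"
        using smooth_along_curve(1)[OF curve e \<open>0 < t\<close>] unfolding de ju j\<sigma> .
      ultimately show "(\<exists>l. has_left_value u (\<phi> t) t l) \<and> (\<exists>r. has_right_value u (\<phi> t) t r) \<and>
         (\<phi> has_real_derivative
            (jump \<phi> (\<lambda>p. (u p)\<^sup>2 / 2) t - jump \<phi> \<sigma>r t) / jump \<phi> u t) (at t) \<and>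
         ((\<lambda>s. e (\<phi> s, s)) has_real_derivative (jump \<phi> \<sigma>r t)\<^sup>2 / jump \<phi> u t) (at t)"
        using lr by blast
    qed
  qed
qed

end
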